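(* Let $r\in\mathbb{N}$. Suppose the $X_n$ are integer valued and conditions (A1), (A2) and $\widetilde{(A3)}$ are satisfied with $s=r+2$. Then $S_N$ admits the lattice Edgeworth expansion of order $r$: there are polynomials $P_{0,d},\dots,P_{r,d}$ such that $$\sqrt{N}\,\mathbb{P}(S_N=k)=\mathfrak{n}\left(\frac{k-NA}{\sqrt{N}}\right)\sum_{p=0}^r\frac{P_{p,d}((k-NA)/\sqrt{N})}{N^{p/2}}+o\left(N^{-r/2}\right)$$ uniformly for $k\in\mathbb{Z}$.
   Context: Let $X_1,X_2,\dots$ be integer-valued random variables and $S_N=\sum_{n=1}^N X_n$. Assume there are a complex Banach space $\mathcal{B}$ with dual $\mathcal{B}'$, a family of bounded linear operators $\mathcal{L}_t:\mathcal{B}\to\mathcal{B}$ ($t\in\mathbb{R}$), and vectors $v\in\mathcal{B}$, $\ell\in\mathcal{B}'$ such that $\mathbb{E}(e^{itS_N})=\ell(\mathcal{L}_t^N v)$ for all $t\in\mathbb{R}$ and $N\geq1$. The conditions are: (A1) $t\mapsto\mathcal{L}_t$ is continuous and there exist $s\in\mathbb{N}$ and $\delta>0$ such that $t\mapsto\mathcal{L}_t$ is $s$ times continuously differentiable for $|t|\leq\delta$. (A2) $1$ is an isolated and simple eigenvalue of $\mathcal{L}_0$, all other eigenvalues of $\mathcal{L}_0$ have absolute value less than $1$, and the essential spectrum of $\mathcal{L}_0$ is contained in a disk of radius strictly less than $1$. $\widetilde{(A3)}$ For $t\notin 2\pi\mathbb{Z}$ the spectrum of $\mathcal{L}_t$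 is contained in $\{|z|<1\}$, and for $t\in2\pi\mathbb{Z}$ it is contained in $\{|z|<1\}\cup\{1\}$. There are $A\in\mathbb{R}$ and $\sigma^2\geq0$ such that $(S_N-NA)/\sqrt{N}$ converges in distribution to $\mathcal{N}(0,\sigma^2)$; it is assumed that $\sigma^2>0$. $\mathfrak{n}(y)=\frac{1}{\sqrt{2\pi\sigma^2}}e^{-y^2/(2\sigma^2)}$. *)

theory Defs
  imports "HOL-Probability.Probability" "HOL-Computational_Algebra.Polynomial"
begin

class complex_normed_space = real_normed_vector +
  fixes cscale :: "complex \<Rightarrow> 'a \<Rightarrow> 'a"
  assumes cscale_add_right: "cscale c (x + y) = cscale c x + cscale c y"
    and cscale_add_left: "cscale (c + d) x = cscale c x + cscale d x"
    and cscale_cscale: "cscale c (cscale d x) = cscale (c * d) x"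
    and cscale_one: "cscale 1 x = x"
    and scaleR_cscale: "scaleR r x = cscale (complex_of_real r) x"
    and norm_cscale: "norm (cscale c x) = cmod c * norm x"

class complex_banach = complex_normed_space + banach

instantiation complex :: complex_banach
begin
definition cscale_complex :: "complex \<Rightarrow> complex \<Rightarrow> complex" where
  "cscale_complex c x = c * x"
instance
  by standard (auto simp: cscale_complex_def algebra_simps norm_mult scaleR_conv_of_real)
end

text \<open>Complex linearity of a map (maps are given as bounded real-linear maps).\<close>
definition clinear_map :: "('a::complex_normed_space \<Rightarrow> 'b::complex_normed_space) \<Rightarrow> bool" where
  "clinear_map f \<longleftrightarrow> (\<forall>c x. f (cscale c x) = cscale c (f x))"

definition bounded_clinear_op :: "('a::complex_normed_space \<Rightarrow>\<^sub>L 'a) \<Rightarrow> bool" where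
  "bounded_clinear_op T \<longleftrightarrow> clinear_map (blinfun_apply T)"

definition cdual :: "('a::complex_normed_space \<Rightarrow> complex) \<Rightarrow> bool" where
  "cdual l \<longleftrightarrow> bounded_linear l \<and> (\<forall>c x. l (cscale c x) = c * l x)"

definition shift_op :: "('a::complex_normed_space \<Rightarrow>\<^sub>L 'a) \<Rightarrow> complex \<Rightarrow> 'a \<Rightarrow> 'a" where
  "shift_op T z = (\<lambda>x. blinfun_apply T x - cscale z x)"

definition op_spectrum :: "('a::complex_normed_space \<Rightarrow>\<^sub>L 'a) \<Rightarrow> complex set" where
  "op_spectrum T = {z. \<not> (\<exists>S. bounded_linear S \<and> S \<circ> shift_op T z = id \<and> shift_op T z \<circ> S = id)}"

definition op_eigenvalue :: "('a::complex_normed_space \<Rightarrow>\<^sub>L 'a) \<Rightarrow> complex \<Rightarrow> bool" where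
  "op_eigenvalue T z \<longleftrightarrow> (\<exists>x. x \<noteq> 0 \<and> blinfun_apply T x = cscale z x)"

definition cspan :: "'a::complex_normed_space set \<Rightarrow> 'a set" where
  "cspan S = {y. \<exists>F c. finite F \<and> F \<subseteq> S \<and> y = (\<Sum>x\<in>F. cscale (c x) x)}"

definition cfinite_dim :: "'a::complex_normed_space set \<Rightarrow> bool" where
  "cfinite_dim V \<longleftrightarrow> (\<exists>F. finite F \<and> V \<subseteq> cspan F)"

definition gen_eigenspace :: "('a::complex_normed_space \<Rightarrow>\<^sub>L 'a) \<Rightarrow> complex \<Rightarrow> 'a set" where
  "gen_eigenspace T z = {x. \<exists>k. (shift_op T z ^^ k) x = 0}"

definition simple_eigenvalue :: "('a::complex_normed_space \<Rightarrow>\<^sub>L 'a) \<Rightarrow> complex \<Rightarrow> bool" where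
  "simple_eigenvalue T z \<longleftrightarrow> (\<exists>x. x \<noteq> 0 \<and> gen_eigenspace T z = cspan {x})"

definition isolated_in_spectrum :: "('a::complex_normed_space \<Rightarrow>\<^sub>L 'a) \<Rightarrow> complex \<Rightarrow> bool" where
  "isolated_in_spectrum T z \<longleftrightarrow> z \<in> op_spectrum T \<and> (\<exists>e>0. op_spectrum T \<inter> ball z e = {z})"

definition fredholm :: "('a::complex_normed_space \<Rightarrow> 'a) \<Rightarrow> bool" where
  "fredholm f \<longleftrightarrow> cfinite_dim {x. f x = 0} \<and> closed (range f) \<and>
     (\<exists>F. finite F \<and> range f + cspan F = UNIV)"

text \<open>Essential spectrum (in the sense of Wolf): z such that T - z I is not Fredholm.\<close>
definition ess_spectrum :: "('a::complex_normed_space \<Rightarrow>\<^sub>L 'a) \<Rightarrow> complex set" where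
  "ess_spectrum T = {z. \<not> fredholm (shift_op T z)}"

definition Ck_on :: "nat \<Rightarrow> (real \<Rightarrow> 'b::real_normed_vector) \<Rightarrow> real set \<Rightarrow> bool" where
  "Ck_on k f S \<longleftrightarrow> (\<exists>D. D 0 = f \<and>
      (\<forall>j<k. \<forall>t\<in>S. (D j has_vector_derivative D (Suc j) t) (at t within S)) \<and>
      (\<forall>j\<le>k. continuous_on S (D j)))"

definition gauss_n :: "real \<Rightarrow> real \<Rightarrow> real" where
  "gauss_n sigma2 y = 1 / sqrt (2 * pi * sigma2) * exp (- y\<^sup>2 / (2 * sigma2))"

end

theory Submission
  imports Defs "HOL-Complex_Analysis.Complex_Analysis"
begin

text \<open>Because \<open>1\<close> is a simple isolated point of the spectrum of \<open>L\<^sub>0\<close> and \<open>L\<^sub>0 - 1\<close> is Fredholm,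
  the space splits into the eigenline and the closed range of \<open>L\<^sub>0 - 1\<close>. For small \<open>t\<close> a fixed point
  argument continues the eigenvector, so \<open>E exp (i t S\<^sub>N) = \<kappa>(t)\<^sup>N z(t) + O(R\<^sup>-\<^sup>N)\<close> with \<open>R > 1\<close>; away from
  \<open>2\<pi>\<int>\<close> the characteristic function decays exponentially by compactness and Cauchy's inequality.
  Only Taylor expansions of \<open>\<kappa>\<close> and \<open>z\<close> at \<open>0\<close> are needed, and these follow from the fixed point
  equations by bootstrapping one order at a time. The central limit theorem identifies
  \<open>\<kappa>(t) = exp (i A t - \<sigma>\<^sup>2 t\<^sup>2 / 2 + t\<^sup>2 g(t))\<close> with \<open>g(0) = 0\<close>. Expanding
  \<open>exp (u\<^sup>2 g(u/\<surd>N)) z(u/\<surd>N)\<close> in powers of \<open>u/\<surd>N\<close> and inverting the Fourier transform on \<open>[-\<pi>, \<pi>]\<close>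
  turns each power of \<open>u\<close> into a polynomial times the Gaussian density.\<close>

text \<open>As \<open>L\<close> has only finitely many derivatives, analytic perturbation theory
  does not apply. The eigenvector and the resolvent vector are characterised by equations whose
  right-hand side carries an explicit factor \<open>t\<close>, so knowing a solution to order
  \<open>k\<close> gives it to order \<open>k + 1\<close>. The value \<open>r + 2\<close> has a
  precise source: at \<open>t = u / sqrt N\<close> the \<open>N\<close>-th power multiplies the
  logarithm of the eigenvalue by \<open>N\<close>, so that logarithm is divided by
  \<open>t^2\<close>, which spends two orders and leaves \<open>r\<close> for \<open>g\<close>.
  Invertibility is studied for \<open>I - z T\<close> with \<open>|z| \<le> 1\<close> instead of
  \<open>T - w\<close> with \<open>|w| \<ge> 1\<close>: this parameter set is compact and
  \<open>z = 0\<close> is harmless, so one constant serves all \<open>z\<close> and a perturbation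
  enlarges the disc to some \<open>R > 1\<close>. That radius is the origin of every exponential
  rate. Expansions at the single point \<open>0\<close> suffice: for \<open>|t| \<ge> d\<close>
  everything is exponentially small, and for \<open>|t| \<le> d\<close> the error is
  \<open>o(|t|^r)\<close> times a weight of size at most a polynomial times
  \<open>exp (s u^2 / 4)\<close>, which uses up only half of the Gaussian exponent.\<close>

lemma bounded_bilinear_cscale:
  "bounded_bilinear (cscale :: complex \<Rightarrow> 'a \<Rightarrow> 'a::complex_normed_space)"
proof
  fix r :: real and c :: complex and x :: 'a
  show "cscale (r *\<^sub>R c) x = r *\<^sub>R cscale c x"
    by (simp add: scaleR_cscale[where ?'a='a] cscale_cscale scaleR_conv_of_real)
  show "cscale c (r *\<^sub>R x) = r *\<^sub>R cscale c x"
    by (simp add: scaleR_cscale cscale_cscale mult.commute)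
qed (auto simp: cscale_add_left cscale_add_right norm_cscale intro!: exI[of _ 1])

interpretation cscale: bounded_bilinear "cscale :: complex \<Rightarrow> 'a \<Rightarrow> 'a::complex_normed_space"
  by (rule bounded_bilinear_cscale)

lemmas cscale_simps = cscale.zero_left cscale.zero_right cscale.minus_left cscale.minus_right
  cscale.diff_left cscale.diff_right cscale_add_left cscale_add_right cscale_cscale cscale_one

definition cscale_op :: "complex \<Rightarrow> ('a::complex_normed_space \<Rightarrow>\<^sub>L 'a)" where
  "cscale_op c = Blinfun (cscale c)"

lemma cscale_op_apply [simp]: "blinfun_apply (cscale_op c) x = cscale c x"
  by (simp add: cscale_op_def bounded_linear_Blinfun_apply cscale.bounded_linear_right)

lemma norm_cscale_op_diff_le: "norm (cscale_op a - cscale_op b :: 'a::complex_normed_space \<Rightarrow>\<^sub>L 'a) \<le> cmod (a - b)"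
  by (rule norm_blinfun_bound) (auto simp: blinfun.diff_left norm_cscale simp flip: cscale.diff_left)

lemma norm_cscale_op_le: "norm (cscale_op a :: 'a::complex_normed_space \<Rightarrow>\<^sub>L 'a) \<le> cmod a"
  by (rule norm_blinfun_bound) (auto simp: norm_cscale)

lemma continuous_on_cscale_op:
  "continuous_on S (cscale_op :: complex \<Rightarrow> ('a::complex_normed_space \<Rightarrow>\<^sub>L 'a))"
  unfolding continuous_on_iff dist_norm
proof (intro ballI allI impI)
  fix x and e :: real
  assume "0 < e"
  then show "\<exists>d>0. \<forall>x'\<in>S. norm (x' - x) < d \<longrightarrow> norm (cscale_op x' - cscale_op x :: 'a \<Rightarrow>\<^sub>L 'a) < e"
    by (intro exI[of _ e]) (use norm_cscale_op_diff_le order_le_less_trans in blast)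
qed

section \<open>Quantitative invertibility of operators\<close>

text \<open>Bijectivity with an inverse bounded by \<open>C\<close>, stated without naming the
  inverse, so that the constant can be followed through perturbation and compactness
  arguments.\<close>

definition bounded_below_surj :: "real \<Rightarrow> ('a::real_normed_vector \<Rightarrow>\<^sub>L 'b::real_normed_vector) \<Rightarrow> bool" where
  "bounded_below_surj C T \<longleftrightarrow> (\<forall>x. norm x \<le> C * norm (T x)) \<and> surj (blinfun_apply T)"

lemma bounded_below_surj_mono:
  "bounded_below_surj C T \<Longrightarrow> C \<le> D \<Longrightarrow> bounded_below_surj D T"
  unfolding bounded_below_surj_def
  by (meson mult_right_mono norm_ge_zero order_trans)

text \<open>The equation \<open>T' x = y\<close> is rewritten as
  \<open>x = S (y - (T' - T) x)\<close> with \<open>S\<close> inverse to \<open>T\<close>; the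
  hypothesis makes the right-hand side a contraction with factor 1/2. Absorbing the same half in the
  lower bound doubles the constant.\<close>

lemma bounded_below_surj_perturb:
  fixes T T' :: "'a::banach \<Rightarrow>\<^sub>L 'b::real_normed_vector"
  assumes T: "bounded_below_surj C T" and close: "C * norm (T' - T) \<le> 1/2" and C: "C \<ge> 0"
  shows "bounded_below_surj (2 * C) T'"
proof -
  have below: "norm x \<le> C * norm (T x)" for x
    using T by (auto simp: bounded_below_surj_def)
  have pert: "C * norm ((T' - T) x) \<le> norm x / 2" for x
  proof -
    have "C * norm ((T' - T) x) \<le> C * (norm (T' - T) * norm x)"
      by (intro mult_left_mono norm_blinfun C)
    also have "\<dots> = (C * norm (T' - T)) * norm x" by simp
    also have "\<dots> \<le> 1/2 * norm x" by (intro mult_right_mono close) auto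
    finally show ?thesis by simp
  qed
  have "norm x \<le> 2 * C * norm (T' x)" for x
  proof -
    have "norm (T x) \<le> norm (T' x) + norm ((T' - T) x)"
      by (smt (verit) blinfun.diff_left norm_triangle_ineq3 norm_minus_commute)
    then have "C * norm (T x) \<le> C * norm (T' x) + C * norm ((T' - T) x)"
      using mult_left_mono[OF _ C] by (metis distrib_left)
    then show ?thesis using below[of x] pert[of x] by simp
  qed
  moreover have "y \<in> range (blinfun_apply T')" for y
  proof -
    define S where "S = inv (blinfun_apply T)"
    have TS: "T (S u) = u" for u
      using T by (simp add: S_def bounded_below_surj_def surj_f_inv_f)
    have "\<exists>!x. S (y - (T' - T) x) = x"
    proof (rule banach_fix_type[where c="1/2"])
      show "\<forall>u w. dist (S (y - (T' - T) u)) (S (y - (T' - T) w)) \<le> 1/2 * dist u w"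
      proof (intro allI)
        fix u w
        have "norm (S (y - (T' - T) u) - S (y - (T' - T) w)) \<le> C * norm ((T' - T) (u - w))"
          using below[of "S (y - (T' - T) u) - S (y - (T' - T) w)"]
          by (simp add: blinfun.diff_right TS norm_minus_commute)
        then show "dist (S (y - (T' - T) u)) (S (y - (T' - T) w)) \<le> 1/2 * dist u w"
          using pert[of "u - w"] by (simp add: dist_norm)
      qed
    qed auto
    then obtain x where "S (y - (T' - T) x) = x" by blast
    then have "T x = y - (T' - T) x" by (metis TS)
    then have "T' x = y" by (simp add: blinfun.diff_left)
    then show ?thesis by blast
  qed
  ultimately show ?thesis
    by (auto simp: bounded_below_surj_def)
qed

text \<open>Around each \<open>F k\<close> the constant \<open>2 * c k\<close> works on a ball of
  radius \<open>1 / (2 * c k)\<close>, and finitely many such balls cover the compact image of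
  \<open>K\<close>.\<close>

lemma compact_uniformly_bounded_below_surj:
  fixes F :: "'c::topological_space \<Rightarrow> ('a::banach \<Rightarrow>\<^sub>L 'b::real_normed_vector)"
  assumes "compact K" "continuous_on K F" and inv: "\<And>k. k \<in> K \<Longrightarrow> \<exists>C. bounded_below_surj C (F k)"
  obtains C where "C > 0" "\<And>k. k \<in> K \<Longrightarrow> bounded_below_surj C (F k)"
proof -
  have "\<exists>C. C > 0 \<and> bounded_below_surj C (F k)" if "k \<in> K" for k
    using inv[OF that] bounded_below_surj_mono by (meson linorder_le_cases zero_less_one le_less_trans order_less_le_trans)
  then obtain c where c: "\<And>k. k \<in> K \<Longrightarrow> c k > 0" "\<And>k. k \<in> K \<Longrightarrow> bounded_below_surj (c k) (F k)"
    by metis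
  have cp: "compact (F ` K)"
    by (rule compact_continuous_image) fact+
  have cv: "F ` K \<subseteq> (\<Union>k\<in>K. ball (F k) (1 / (2 * c k)))"
    using c(1) by force
  obtain K' where K': "K' \<subseteq> K" "finite K'" "F ` K \<subseteq> (\<Union>k\<in>K'. ball (F k) (1 / (2 * c k)))"
    by (rule compactE_image[OF cp _ cv]) (auto intro: that)
  \<comment> \<open>The sum replaces a maximum; the summand 1 keeps \<open>C\<close> positive when
    \<open>K'\<close> is empty.\<close>
  define C where "C = 1 + (\<Sum>k\<in>K'. 2 * c k)"
  have "\<And>k. k \<in> K' \<Longrightarrow> 0 \<le> 2 * c k" using c(1) K'(1) by (simp add: less_imp_le subset_iff)
  then have C: "0 < C" "\<And>k. k \<in> K' \<Longrightarrow> 2 * c k \<le> C"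
    unfolding C_def using sum_nonneg[of K' "\<lambda>k. 2 * c k"] member_le_sum[of _ K' "\<lambda>k. 2 * c k"] K'(2)
    by (smt (verit) DiffD1)+
  show ?thesis
  proof (rule that[OF C(1)])
    fix k assume "k \<in> K"
    then obtain j where j: "j \<in> K'" "F k \<in> ball (F j) (1 / (2 * c j))"
      using K'(3) by blast
    then have "j \<in> K" using K'(1) by blast
    have "norm (F k - F j) < 1 / (2 * c j)" using j(2) by (simp add: dist_norm norm_minus_commute)
    then have "c j * norm (F k - F j) \<le> 1/2"
      using c(1)[OF \<open>j \<in> K\<close>] by (simp add: field_simps)
    then have "bounded_below_surj (2 * c j) (F k)"
      using bounded_below_surj_perturb c \<open>j \<in> K\<close> by (metis less_imp_le)
    then show "bounded_below_surj C (F k)"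
      using bounded_below_surj_mono C(2) j(1) by blast
  qed
qed

text \<open>A point of modulus between 1 and \<open>R\<close> is compared with its radial projection
  to the unit circle, at distance at most \<open>R - 1\<close>. The gained radius is what later
  turns invertibility into exponential decay.\<close>

lemma bounded_below_surj_larger_disc:
  fixes T :: "'a::complex_banach \<Rightarrow>\<^sub>L 'a"
  assumes inv: "\<And>z. cmod z \<le> 1 \<Longrightarrow> bounded_below_surj C (id_blinfun - (cscale_op z o\<^sub>L T))" and "C > 0"
    and R: "R \<ge> 1" "2 * C * (R - 1) * norm T \<le> 1" and z: "cmod z \<le> R"
  shows "bounded_below_surj (2 * C) (id_blinfun - (cscale_op z o\<^sub>L T))"
proof (cases "cmod z \<le> 1")
  case True
  show ?thesis using bounded_below_surj_mono[OF inv[OF True], of "2 * C"] \<open>C > 0\<close> by simp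
next
  case False
  define w where "w = z / cmod z"
  have w: "cmod w \<le> 1" using False by (simp add: w_def norm_divide)
  have "z \<noteq> 0" using False by (metis norm_zero zero_le_one)
  then have "w - z = of_real (1 / cmod z - 1) * z" by (simp add: w_def field_simps)
  then have "cmod (w - z) = \<bar>1 / cmod z - 1\<bar> * cmod z" by (metis norm_mult norm_of_real)
  also have "\<dots> = cmod z - 1" using False \<open>z \<noteq> 0\<close> by (simp add: field_simps abs_if)
  finally have wz: "cmod (w - z) \<le> R - 1" using z by simp
  have "(id_blinfun - (cscale_op z o\<^sub>L T)) - (id_blinfun - (cscale_op w o\<^sub>L T)) = (cscale_op w - cscale_op z) o\<^sub>L T"
    by (simp add: blinfun_eqI blinfun.diff_left)
  then have "norm ((id_blinfun - (cscale_op z o\<^sub>L T)) - (id_blinfun - (cscale_op w o\<^sub>L T))) \<le> norm (cscale_op w - cscale_op z :: 'a \<Rightarrow>\<^sub>L 'a) * norm T"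
    by (metis norm_blinfun_compose)
  also have "\<dots> \<le> (R - 1) * norm T"
    by (intro mult_right_mono order_trans[OF norm_cscale_op_diff_le wz]) auto
  finally have "C * norm ((id_blinfun - (cscale_op z o\<^sub>L T)) - (id_blinfun - (cscale_op w o\<^sub>L T))) \<le> C * ((R - 1) * norm T)"
    using \<open>C > 0\<close> by (intro mult_left_mono) auto
  also have "\<dots> \<le> 1/2" using R(2) by (simp add: algebra_simps)
  finally show ?thesis
    using \<open>C > 0\<close> by (intro bounded_below_surj_perturb[OF inv[OF w]]) auto
qed

section \<open>Decay of operator powers by Cauchy estimates\<close>

text \<open>Induction step for reading off the coefficients of a generating function: replacing the
  vector \<open>v\<close> by \<open>T v\<close> shifts the coefficient sequence by one.\<close>

lemma fps_nth_fps_expansion_times_id: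
  assumes "f holomorphic_on ball 0 R" "g holomorphic_on ball 0 R" "R > 0"
    and "\<And>z. z \<in> ball 0 R \<Longrightarrow> f z = c + z * g z"
  shows "fps_nth (fps_expansion f 0) (Suc n) = fps_nth (fps_expansion g 0) n"
proof -
  have "g has_fps_expansion fps_expansion g 0" "f has_fps_expansion fps_expansion f 0"
    using assms by (auto intro!: has_fps_expansion_fps_expansion[of "ball 0 R"])
  then have "(\<lambda>z. c + z * g z) has_fps_expansion (fps_const c + fps_X * fps_expansion g 0)"
    by (intro fps_expansion_intros)
  moreover have "eventually (\<lambda>z. f z = c + z * g z) (nhds 0)"
    using eventually_nhds_in_open[of "ball 0 R" 0] assms(3,4) by (auto elim: eventually_mono)
  ultimately have "f has_fps_expansion (fps_const c + fps_X * fps_expansion g 0)"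
    using has_fps_expansion_cong by fastforce
  then have "fps_expansion f 0 = fps_const c + fps_X * fps_expansion g 0"
    using \<open>f has_fps_expansion fps_expansion f 0\<close> fps_expansion_unique_complex by blast
  then show ?thesis by simp
qed

text \<open>The function \<open>\<psi> ((I - z T)\<^sup>-\<^sup>1 v)\<close> is the generating function of the sequence
  \<open>\<psi> (T\<^sup>n v)\<close>, so the estimate is Cauchy's inequality for its coefficients.\<close>

lemma power_bound_off_spectrum:
  fixes T :: "'a::complex_banach \<Rightarrow>\<^sub>L 'a"
  assumes T: "bounded_clinear_op T" and psi: "cdual \<psi>" "\<And>x. cmod (\<psi> x) \<le> B * norm x" and B: "B \<ge> 0"
    and inv: "\<And>z. cmod z \<le> R \<Longrightarrow> bounded_below_surj C (id_blinfun - (cscale_op z o\<^sub>L T))"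
    and R: "R > 0" and C: "C > 0"
  shows "cmod (\<psi> ((blinfun_apply T ^^ n) v)) \<le> B * C * norm v / R ^ n"
proof -
  \<comment> \<open>\<open>inv\<close> is meaningful only for \<open>|z| \<le> R\<close>, where the
    operator is bijective; every fact about \<open>G\<close> carries this restriction.\<close>
  define G where "G z = inv (blinfun_apply (id_blinfun - (cscale_op z o\<^sub>L T)))" for z
  have G: "G z x - cscale z (T (G z x)) = x" if "cmod z \<le> R" for z x
  proof -
    have "(id_blinfun - (cscale_op z o\<^sub>L T)) (G z x) = x"
      using inv[OF that] by (simp add: G_def bounded_below_surj_def surj_f_inv_f)
    then show ?thesis by (simp add: blinfun.diff_left)
  qed
  have below: "norm u \<le> C * norm (u - cscale z (T u))" if "cmod z \<le> R" for z u
    using inv[OF that] by (simp add: bounded_below_surj_def blinfun.diff_left)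
  have Gb: "norm (G z x) \<le> C * norm x" if "cmod z \<le> R" for z x
    using below[OF that, of "G z x"] G[OF that] by simp
  have uniq: "u = G z x" if "cmod z \<le> R" "u - cscale z (T u) = x" for u z x
  proof -
    have "norm (u - G z x) \<le> C * norm (u - G z x - cscale z (T (u - G z x)))"
      by (rule below[OF that(1)])
    also have "u - G z x - cscale z (T (u - G z x)) = (u - cscale z (T u)) - (G z x - cscale z (T (G z x)))"
      by (simp add: blinfun.diff_right cscale_simps)
    also have "\<dots> = 0" using that G by simp
    finally show ?thesis by simp
  qed
  have Tc: "T (cscale c x) = cscale c (T x)" for c x
    using T by (simp add: bounded_clinear_op_def clinear_map_def)
  have psic: "\<psi> (cscale c x) = c * \<psi> x" and psil: "linear \<psi>" for c x
    using psi(1) by (auto simp: cdual_def bounded_linear.linear)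
  \<comment> \<open>Resolvent identity. The candidate \<open>u\<close> is checked to solve the
    equation that determines \<open>G z' x\<close>; both continuity and differentiability in
    \<open>z\<close> follow from it.\<close>
  have Gdiff: "G z' x - G z x = cscale (z' - z) (G z' (T (G z x)))" if "cmod z \<le> R" "cmod z' \<le> R" for z z' x
  proof -
    define u where "u = G z x + cscale (z' - z) (G z' (T (G z x)))"
    have "u - cscale z' (T u) = (G z x - cscale z' (T (G z x))) + cscale (z' - z) (G z' (T (G z x)) - cscale z' (T (G z' (T (G z x)))))"
      by (simp add: u_def blinfun.add_right blinfun.diff_right Tc cscale_simps algebra_simps)
    also have "\<dots> = (G z x - cscale z' (T (G z x))) + cscale (z' - z) (T (G z x))"
      using G[OF that(2), of "T (G z x)"] by simp
    also have "\<dots> = x"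
      using G[OF that(1), of x] by (simp add: cscale_simps)
    finally have "u = G z' x" by (rule uniq[OF that(2)])
    then show ?thesis unfolding u_def by (simp add: algebra_simps)
  qed
  have contG: "continuous_on (cball 0 R) (\<lambda>z. \<psi> (G z x))" for x
  proof (cases "norm x = 0")
    case True
    then have "G z x = 0" if "z \<in> cball 0 R" for z using Gb[of z x] that by simp
    then show ?thesis using continuous_on_cong by (metis (mono_tags, lifting) continuous_on_const)
  next
    case False
    define M where "M = B * (C * (norm T * (C * norm x)))"
    have "dist (\<psi> (G z' x)) (\<psi> (G z x)) \<le> M * dist z' z" if "cmod z \<le> R" "cmod z' \<le> R" for z z'
    proof -
      have "\<psi> (G z' x) - \<psi> (G z x) = \<psi> (G z' x - G z x)" by (simp add: linear_diff psil)
      also have "\<dots> = (z' - z) * \<psi> (G z' (T (G z x)))" by (simp add: Gdiff that psic)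
      finally have "dist (\<psi> (G z' x)) (\<psi> (G z x)) = cmod (\<psi> (G z' (T (G z x)))) * dist z' z"
        by (simp add: dist_norm norm_mult)
      moreover have "cmod (\<psi> (G z' (T (G z x)))) \<le> M"
      proof -
        have "norm (T (G z x)) \<le> norm T * (C * norm x)"
          by (rule order_trans[OF norm_blinfun mult_left_mono[OF Gb[OF that(1)]]]) simp
        then have "norm (G z' (T (G z x))) \<le> C * (norm T * (C * norm x))"
          using Gb[OF that(2), of "T (G z x)"] C by (smt (verit) mult_left_mono)
        then show ?thesis unfolding M_def using psi(2)[of "G z' (T (G z x))"] B by (smt (verit) mult_left_mono)
      qed
      ultimately show ?thesis by (simp add: mult_right_mono)
    qed
    then have "M-lipschitz_on (cball 0 R) (\<lambda>z. \<psi> (G z x))"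
      by (intro lipschitz_onI) (auto simp: M_def B C less_imp_le)
    then show ?thesis by (rule lipschitz_on_continuous_on)
  qed
  have holG: "(\<lambda>z. \<psi> (G z x)) holomorphic_on ball 0 R" for x
  proof (rule holomorphic_onI)
    fix z assume z: "z \<in> ball (0::complex) R"
    have "((\<lambda>z. \<psi> (G z x)) has_field_derivative \<psi> (G z (T (G z x)))) (at z)"
      unfolding has_field_derivative_iff
    \<comment> \<open>The resolvent identity makes the difference quotient equal to
      \<open>\<psi> (G z' (T (G z x)))\<close>, so continuity alone yields the derivative.\<close>
    proof (rule Lim_transform_within_open[of "\<lambda>z'. \<psi> (G z' (T (G z x)))" _ _ _ "ball 0 R"])
      show "(\<lambda>z'. \<psi> (G z' (T (G z x)))) \<midarrow>z\<rightarrow> \<psi> (G z (T (G z x)))"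
        using continuous_on_subset[OF contG ball_subset_cball] z
        by (metis continuous_on_eq_continuous_at isCont_def open_ball)
      show "\<psi> (G z' (T (G z x))) = (\<psi> (G z' x) - \<psi> (G z x)) / (z' - z)" if "z' \<in> ball 0 R" "z' \<noteq> z" for z'
      proof -
        have "\<psi> (G z' x) - \<psi> (G z x) = \<psi> (G z' x - G z x)" by (simp add: linear_diff psil)
        also have "\<dots> = (z' - z) * \<psi> (G z' (T (G z x)))" using that z by (simp add: Gdiff psic)
        finally show ?thesis using that by simp
      qed
    qed (use z in auto)
    then show "(\<lambda>z. \<psi> (G z x)) field_differentiable at z within ball 0 R"
      using field_differentiable_at_within field_differentiable_def by blast
  qed
  have coeff: "fps_nth (fps_expansion (\<lambda>z. \<psi> (G z v)) 0) n = \<psi> ((blinfun_apply T ^^ n) v)" for v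
  proof (induction n arbitrary: v)
    case 0
    have "G 0 v = v" using G[of 0 v] R by (simp add: cscale_simps)
    then show ?case by (simp add: fps_expansion_def)
  next
    case (Suc n)
    have "\<psi> (G z v) = \<psi> v + z * \<psi> (G z (T v))" if "z \<in> ball 0 R" for z
    proof -
      have z: "cmod z \<le> R" "cmod 0 \<le> R" using that R by auto
      have "G 0 v = v" using G[of 0 v] R by (simp add: cscale_simps)
      then have "G z v = v + cscale z (G z (T v))" using Gdiff[OF z(2,1), of v] by (simp add: algebra_simps)
      then show ?thesis by (metis psic psil linear_add)
    qed
    from fps_nth_fps_expansion_times_id[OF holG holG R this] Suc.IH show ?case
      by (simp add: funpow_Suc_right del: funpow.simps)
  qed
  have "cmod ((deriv ^^ n) (\<lambda>z. \<psi> (G z v)) 0) \<le> fact n * (B * (C * norm v)) / R ^ n"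
  proof (rule Cauchy_inequality[OF holG contG R])
    fix z assume "cmod (0 - z) = R"
    then have "norm (G z v) \<le> C * norm v" by (intro Gb) simp
    then show "cmod (\<psi> (G z v)) \<le> B * (C * norm v)"
      using psi(2)[of "G z v"] B by (smt (verit) mult_left_mono)
  qed
  moreover have "(deriv ^^ n) (\<lambda>z. \<psi> (G z v)) 0 = fact n * \<psi> ((blinfun_apply T ^^ n) v)"
    using coeff[of v] by (simp add: fps_expansion_def field_simps)
  ultimately have "fact n * cmod (\<psi> ((blinfun_apply T ^^ n) v)) \<le> fact n * (B * C * norm v / R ^ n)"
    by (simp add: norm_mult mult_ac)
  then show ?thesis by (subst (asm) mult_le_cancel_left_pos) auto
qed

section \<open>Operators with closed range\<close>

text \<open>Baire's theorem in the complete space \<open>Y\<close>, as for the open mapping theorem: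
  the sets \<open>G n\<close> cover \<open>Y\<close>, so one of them has an interior point relative
  to \<open>Y\<close>. Since the \<open>G n\<close> are closures of images, only approximate
  preimages result.\<close>

lemma closed_range_approximate_preimage:
  fixes T :: "'a::banach \<Rightarrow>\<^sub>L 'b::banach"
  assumes "closed (range (blinfun_apply T))"
  obtains M where "M \<ge> 0"
    "\<And>y. y \<in> range (blinfun_apply T) \<Longrightarrow> \<exists>u. norm u \<le> M * norm y \<and> norm (y - T u) \<le> norm y / 2"
proof -
  define Y where "Y = range (blinfun_apply T)"
  define X where "X = top_of_set Y"
  define G where "G n = closure (blinfun_apply T ` cball 0 (real n))" for n
  have clY: "closed Y" using assms by (simp add: Y_def)
  have GY: "G n \<subseteq> Y" for n
    unfolding G_def by (rule closure_minimal[OF _ clY]) (auto simp: Y_def)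
  have "\<exists>n. X interior_of (G n) \<noteq> {}"
  proof (rule ccontr)
    assume "\<nexists>n. X interior_of (G n) \<noteq> {}"
    then have int: "X interior_of (G n) = {}" for n by blast
    have "X interior_of (\<Union>(range G)) = {}"
    proof (rule Baire_category_alt)
      show "completely_metrizable_space X \<or> locally_compact_space X \<and> regular_space X"
        unfolding X_def using completely_metrizable_space_closedin[OF completely_metrizable_space_euclidean] clY by auto
      show "closedin X S \<and> X interior_of S = {}" if "S \<in> range G" for S
        using that int GY by (auto simp: X_def G_def intro!: closed_subset)
    qed auto
    moreover have "\<Union>(range G) = Y"
    proof (intro equalityI)
      show "Y \<subseteq> \<Union>(range G)"
      proof
        fix y assume "y \<in> Y"
        then obtain x where "y = T x" by (auto simp: Y_def)
        moreover obtain n where "norm x \<le> real n" using real_arch_simple by blast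
        ultimately have "y \<in> G n" unfolding G_def by (intro subsetD[OF closure_subset]) auto
        then show "y \<in> \<Union>(range G)" by blast
      qed
    qed (use GY in blast)
    ultimately have "Y = {}" unfolding X_def
      by (metis interior_of_topspace topspace_euclidean_subtopology)
    then show False by (simp add: Y_def)
  qed
  then obtain n y0 where "y0 \<in> X interior_of (G n)" by blast
  then obtain U where U: "openin X U" "y0 \<in> U" "U \<subseteq> G n" by (auto simp: interior_of_def)
  then obtain e where e: "e > 0" "ball y0 e \<inter> Y \<subseteq> U"
    unfolding X_def openin_contains_ball by blast
  have y0: "y0 \<in> Y" "y0 \<in> G n" using U GY by blast+
  have scaleY: "c *\<^sub>R y \<in> Y" if "y \<in> Y" for c y
    using that unfolding Y_def by (metis (no_types, lifting) blinfun.scaleR_right rangeE rangeI)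
  have addY: "y + z \<in> Y" if "y \<in> Y" "z \<in> Y" for y z
    using that unfolding Y_def by (metis (no_types, lifting) blinfun.add_right rangeE rangeI)
  \<comment> \<open>Approximating \<open>y0 + y\<close> and \<open>y0\<close> separately and
    subtracting moves the interior point to 0; the radius \<open>n\<close> and the error
    \<open>e / 8\<close> both double.\<close>
  have small: "\<exists>u. norm u \<le> 2 * real n \<and> norm (T u - y) \<le> e / 4" if "y \<in> Y" "norm y < e" for y
  proof -
    have "y0 + y \<in> ball y0 e \<inter> Y" using that y0 addY by (simp add: dist_norm)
    then have "y0 + y \<in> G n" using e U by blast
    then obtain u1 where u1: "norm u1 \<le> real n" "norm (T u1 - (y0 + y)) < e / 8"
      using e(1) unfolding G_def closure_approachable dist_norm
      by (smt (verit) divide_pos_pos imageE mem_cball_0)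
    from y0(2) obtain u2 where u2: "norm u2 \<le> real n" "norm (T u2 - y0) < e / 8"
      using e(1) unfolding G_def closure_approachable dist_norm
      by (smt (verit) divide_pos_pos imageE mem_cball_0)
    have "T (u1 - u2) - y = (T u1 - (y0 + y)) - (T u2 - y0)" by (simp add: blinfun.diff_right)
    then have "norm (T (u1 - u2) - y) = norm ((T u1 - (y0 + y)) - (T u2 - y0))" by (rule arg_cong)
    then have "norm (T (u1 - u2) - y) \<le> e / 4"
      using u1(2) u2(2) norm_triangle_ineq4[of "T u1 - (y0 + y)" "T u2 - y0"] by linarith
    moreover have "norm (u1 - u2) \<le> 2 * real n"
      using u1(1) u2(1) norm_triangle_ineq4[of u1 u2] by linarith
    ultimately show ?thesis by (intro exI[of _ "u1 - u2"] conjI)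
  qed
  have "\<exists>u. norm u \<le> (4 * real n / e) * norm y \<and> norm (y - T u) \<le> norm y / 2" if "y \<in> Y" for y
  proof (cases "y = 0")
    case False
    \<comment> \<open>Brings \<open>y\<close> to norm \<open>e / 2\<close>, so that the error
      \<open>e / 4\<close> scales back to exactly \<open>norm y / 2\<close>.\<close>
    define c where "c = e / (2 * norm y)"
    have c: "c > 0" using e False by (simp add: c_def)
    have "norm (c *\<^sub>R y) < e" using False e by (simp add: c_def)
    then obtain u where u: "norm u \<le> 2 * real n" "norm (T u - c *\<^sub>R y) \<le> e / 4"
      using small scaleY \<open>y \<in> Y\<close> by blast
    have "norm (u /\<^sub>R c) \<le> (4 * real n / e) * norm y"
      using u(1) e(1) False by (simp add: c_def field_simps)
    moreover have "y - T (u /\<^sub>R c) = - (T u - c *\<^sub>R y) /\<^sub>R c"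
      using c by (simp add: blinfun.scaleR_right scaleR_diff_right)
    then have "norm (y - T (u /\<^sub>R c)) = norm (T u - c *\<^sub>R y) / c" using c by (simp add: divide_inverse_commute norm_minus_commute)
    then have "norm (y - T (u /\<^sub>R c)) \<le> (e / 4) / c"
      using u(2) c by (metis divide_right_mono less_imp_le)
    then have "norm (y - T (u /\<^sub>R c)) \<le> norm y / 2"
      using e False by (simp add: c_def)
    ultimately show ?thesis by blast
  qed (auto intro!: exI[of _ 0] simp: e less_imp_le)
  then show ?thesis
    using e(1) by (intro that[of "4 * real n / e"]) (auto simp: Y_def)
qed

text \<open>Successive correction: an approximate preimage of the current residual is added at each
  stage. The residual halves, the corrections form a geometric series, and completeness of the
  domain makes the sum an exact preimage; this costs a factor 2.\<close>

lemma closed_range_bounded_preimage: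
  fixes T :: "'a::banach \<Rightarrow>\<^sub>L 'b::banach"
  assumes cl: "closed (range (blinfun_apply T))"
  obtains K where "K \<ge> 0" "\<And>x. \<exists>u. T u = T x \<and> norm u \<le> K * norm (T x)"
proof -
  define Y where "Y = range (blinfun_apply T)"
  obtain M where M: "M \<ge> 0" "\<And>y. y \<in> Y \<Longrightarrow> \<exists>u. norm u \<le> M * norm y \<and> norm (y - T u) \<le> norm y / 2"
    using closed_range_approximate_preimage[OF cl] unfolding Y_def by metis
  then obtain s where s: "\<And>y. y \<in> Y \<Longrightarrow> norm (s y) \<le> M * norm y"
      "\<And>y. y \<in> Y \<Longrightarrow> norm (y - T (s y)) \<le> norm y / 2"
    by metis
  have diffY: "y - T u \<in> Y" if "y \<in> Y" for y u
    using that unfolding Y_def by (metis (no_types, lifting) blinfun.diff_right rangeE rangeI)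
  have "\<exists>u. T u = y \<and> norm u \<le> (2 * M) * norm y" if "y \<in> Y" for y
  proof -
    \<comment> \<open>\<open>\<rho> k\<close> is the residual after \<open>k\<close> corrections.
      Its differences are the images of the corrections, so these images telescope to
      \<open>y\<close>.\<close>
    define \<rho> where "\<rho> k = ((\<lambda>y. y - T (s y)) ^^ k) y" for k
    have \<rho>Suc: "\<rho> (Suc k) = \<rho> k - T (s (\<rho> k))" for k by (simp add: \<rho>_def)
    have \<rho>Y: "\<rho> k \<in> Y" for k
      by (induction k) (auto simp: \<rho>Suc diffY, simp add: \<rho>_def that)
    have \<rho>b: "norm (\<rho> k) \<le> norm y * (1/2) ^ k" for k
    proof (induction k)
      case (Suc k)
      then show ?case using s(2)[OF \<rho>Y[of k]] by (simp add: \<rho>Suc)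
    qed (simp add: \<rho>_def)
    have sb: "norm (s (\<rho> k)) \<le> (M * norm y) * (1/2) ^ k" for k
    proof -
      have "norm (s (\<rho> k)) \<le> M * norm (\<rho> k)" by (rule s(1)[OF \<rho>Y])
      also have "\<dots> \<le> M * (norm y * (1/2) ^ k)" by (intro mult_left_mono \<rho>b M(1))
      finally show ?thesis by (simp add: mult_ac)
    qed
    have gsum: "summable (\<lambda>k. (M * norm y) * (1/2) ^ k)"
      by (intro summable_mult summable_geometric) simp
    have nsum: "summable (\<lambda>k. norm (s (\<rho> k)))"
      by (rule summable_comparison_test'[OF gsum]) (use sb in auto)
    have sm: "summable (\<lambda>k. s (\<rho> k))" by (rule summable_norm_cancel[OF nsum])
    have "norm (\<Sum>k. s (\<rho> k)) \<le> (\<Sum>k. norm (s (\<rho> k)))" by (rule summable_norm[OF nsum])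
    also have "\<dots> \<le> (\<Sum>k. (M * norm y) * (1/2) ^ k)" by (rule suminf_le[OF sb nsum gsum])
    also have "\<dots> = 2 * M * norm y"
      by (subst suminf_mult) (auto simp: suminf_geometric)
    finally have 1: "norm (\<Sum>k. s (\<rho> k)) \<le> 2 * M * norm y" .
    have "\<rho> \<longlonglongrightarrow> 0"
    proof (rule Lim_null_comparison)
      show "\<forall>\<^sub>F k in sequentially. norm (\<rho> k) \<le> norm y * (1/2) ^ k" using \<rho>b by simp
      show "(\<lambda>k. norm y * (1/2) ^ k) \<longlonglongrightarrow> 0"
        by (rule tendsto_mult_right_zero) (simp add: LIMSEQ_power_zero)
    qed
    then have "(\<lambda>k. \<rho> k - \<rho> (Suc k)) sums (\<rho> 0 - 0)" by (rule telescope_sums')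
    then have "(\<lambda>k. T (s (\<rho> k))) sums y" by (simp add: \<rho>Suc) (simp add: \<rho>_def)
    moreover have "(\<lambda>k. T (s (\<rho> k))) sums T (\<Sum>k. s (\<rho> k))"
      using summable_sums[OF sm] by (rule bounded_linear.sums[OF blinfun.bounded_linear_right])
    ultimately have "T (\<Sum>k. s (\<rho> k)) = y" by (rule sums_unique2[symmetric])
    with 1 show ?thesis by blast
  qed
  then show ?thesis using M(1) by (intro that[of "2 * M"]) (auto simp: Y_def)
qed

section \<open>Splitting off the simple eigenvalue\<close>

definition rank_one :: "('a::complex_normed_space \<Rightarrow> complex) \<Rightarrow> 'a \<Rightarrow> ('a \<Rightarrow>\<^sub>L 'a)" where
  "rank_one \<phi> x = Blinfun (\<lambda>u. cscale (\<phi> u) x)"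

lemma rank_one_apply:
  assumes "cdual \<phi>"
  shows "blinfun_apply (rank_one \<phi> x) u = cscale (\<phi> u) x"
proof -
  have "bounded_linear (\<lambda>u. cscale (\<phi> u) x)"
    using assms bounded_linear_compose[OF cscale.bounded_linear_left] by (auto simp: cdual_def)
  then show ?thesis by (simp add: rank_one_def bounded_linear_Blinfun_apply)
qed

lemma cspan_singleton: "cspan {x} = range (\<lambda>c. cscale c x)"
proof -
  have "y \<in> cspan {x} \<longleftrightarrow> (\<exists>c. y = cscale c x)" for y
  proof
    assume "y \<in> cspan {x}"
    then obtain F c where F: "finite F" "F \<subseteq> {x}" "y = (\<Sum>x\<in>F. cscale (c x) x)"
      by (auto simp: cspan_def)
    then consider "F = {}" | "F = {x}" by blast
    then show "\<exists>c. y = cscale c x"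
      by cases (use F(3) cscale.zero_left in \<open>auto intro: exI[of _ 0]\<close>)
  next
    assume "\<exists>c. y = cscale c x"
    then obtain c where "y = cscale c x" by blast
    then show "y \<in> cspan {x}" unfolding cspan_def mem_Collect_eq
      by (intro exI[of _ "{x}"] exI[of _ "\<lambda>_. c"]) simp
  qed
  then show ?thesis by auto
qed

text \<open>For nonzero \<open>z\<close> one has \<open>I - z T = - z (T - 1 / z)\<close>, and the
  bounded inverse of \<open>T - 1 / z\<close> supplies both the lower bound and the
  preimages.\<close>

lemma bounded_below_surj_off_spectrum:
  fixes T :: "'a::complex_banach \<Rightarrow>\<^sub>L 'a"
  assumes T: "bounded_clinear_op T" and z: "z = 0 \<or> 1 / z \<notin> op_spectrum T"
  shows "\<exists>C. bounded_below_surj C (id_blinfun - (cscale_op z o\<^sub>L T))"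
proof (cases "z = 0")
  case True
  then have "blinfun_apply (id_blinfun - (cscale_op z o\<^sub>L T)) = (\<lambda>x. x)"
    by (simp add: fun_eq_iff blinfun.diff_left cscale_simps)
  then have "bounded_below_surj 1 (id_blinfun - (cscale_op z o\<^sub>L T))"
    by (simp add: bounded_below_surj_def)
  then show ?thesis by blast
next
  case False
  define w where "w = 1 / z"
  have zw: "z * w = 1" using False by (simp add: w_def)
  obtain S where S: "bounded_linear S" "\<And>x. S (T x - cscale w x) = x" "\<And>x. T (S x) - cscale w (S x) = x"
    using z False by (auto simp: w_def op_spectrum_def shift_op_def fun_eq_iff o_def)
  obtain k where k: "k > 0" "\<And>x. norm (S x) \<le> norm x * k"
    using bounded_linear.pos_bounded[OF S(1)] by blast
  define D where "D = id_blinfun - (cscale_op z o\<^sub>L T)"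
  have D: "D y = cscale (-z) (T y - cscale w y)" for y
    by (simp add: D_def blinfun.diff_left cscale_simps zw)
  have wD: "T y - cscale w y = cscale (-w) (D y)" for y
    using zw by (simp add: D cscale_cscale cscale_one mult.commute)
  have "norm y \<le> (k * cmod w) * norm (D y)" for y
  proof -
    have "norm y \<le> norm (T y - cscale w y) * k" using k(2)[of "T y - cscale w y"] by (simp only: S(2))
    then show ?thesis unfolding wD by (simp add: norm_cscale mult_ac)
  qed
  moreover have "y \<in> range (blinfun_apply D)" for y
  proof -
    have "D (S (cscale (-w) y)) = y" unfolding D S(3) using zw by (simp add: cscale_cscale cscale_one)
    then show ?thesis by (metis rangeI)
  qed
  ultimately have "bounded_below_surj (k * cmod w) D" unfolding bounded_below_surj_def by blast
  then show ?thesis unfolding D_def by blast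
qed

text \<open>Builds the spectral projection \<open>u \<mapsto> \<phi> u x0\<close> without contour
  integrals. With \<open>A = T - I\<close> and \<open>Y\<close> its closed range, simplicity keeps
  \<open>x0\<close> out of \<open>Y\<close>, and isolation of 1 shows that \<open>A\<close> maps
  \<open>Y\<close> onto \<open>Y\<close>; hence the space is the sum of the eigenline and
  \<open>Y\<close>. Subtracting the projection kills \<open>x0\<close> and leaves \<open>T\<close>
  unchanged on \<open>Y\<close>, which removes 1 from the spectrum.\<close>

lemma simple_eigenvalue_splitting:
  fixes T :: "'a::complex_banach \<Rightarrow>\<^sub>L 'a"
  assumes T: "bounded_clinear_op T" and simple: "simple_eigenvalue T 1" and iso: "isolated_in_spectrum T 1"
    and fred: "fredholm (shift_op T 1)" and spec: "op_spectrum T \<subseteq> ball 0 1 \<union> {1}"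
  obtains x\<^sub>0 \<phi> where "T x\<^sub>0 = x\<^sub>0" "cdual \<phi>" "\<phi> x\<^sub>0 = 1" "\<And>x. \<phi> (T x) = \<phi> x"
    "\<And>z. cmod z \<le> 1 \<Longrightarrow> \<exists>C. bounded_below_surj C (id_blinfun - (cscale_op z o\<^sub>L (T - rank_one \<phi> x\<^sub>0)))"
proof -
  define A where "A = T - id_blinfun"
  define Y where "Y = range (blinfun_apply A)"
  have Tc: "T (cscale c x) = cscale c (T x)" for c x
    using T by (simp add: bounded_clinear_op_def clinear_map_def)
  have Ac: "A (cscale c x) = cscale c (A x)" for c x
    by (simp add: A_def blinfun.diff_left Tc cscale_simps)
  have TA: "T x = x + A x" for x by (simp add: A_def blinfun.diff_left)
  have sA: "shift_op T 1 = blinfun_apply A"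
    by (simp add: fun_eq_iff shift_op_def A_def blinfun.diff_left cscale_one)
  obtain x\<^sub>0 where x0: "x\<^sub>0 \<noteq> 0" "gen_eigenspace T 1 = range (\<lambda>c. cscale c x\<^sub>0)"
    using simple by (auto simp: simple_eigenvalue_def cspan_singleton)
  have gen: "x \<in> gen_eigenspace T 1 \<longleftrightarrow> (\<exists>k. (blinfun_apply A ^^ k) x = 0)" for x
    by (simp add: gen_eigenspace_def sA)
  have genI: "\<exists>c. x = cscale c x\<^sub>0" if "(blinfun_apply A ^^ k) x = 0" for k x
    using that gen x0(2) by blast
  \<comment> \<open>The generalised eigenspace is the line through \<open>x0\<close> and is mapped
    into itself, so \<open>A x0 = c x0\<close>; nilpotency on \<open>x0\<close> forces
    \<open>c = 0\<close>.\<close>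
  have Ax0: "A x\<^sub>0 = 0"
  proof -
    have "x\<^sub>0 \<in> gen_eigenspace T 1" unfolding x0(2) using cscale_one by (metis rangeI)
    then obtain k where k: "(blinfun_apply A ^^ k) x\<^sub>0 = 0" using gen by blast
    have "(blinfun_apply A ^^ k) (A x\<^sub>0) = A ((blinfun_apply A ^^ k) x\<^sub>0)"
      by (rule funpow_swap1[symmetric])
    then have "(blinfun_apply A ^^ k) (A x\<^sub>0) = 0" using k by simp
    then obtain c where c: "A x\<^sub>0 = cscale c x\<^sub>0" using genI by blast
    have "(blinfun_apply A ^^ j) x\<^sub>0 = cscale (c ^ j) x\<^sub>0" for j
      by (induction j) (auto simp: cscale_one Ac c cscale_cscale mult.commute)
    then have "norm (cscale (c ^ k) x\<^sub>0) = 0" using k by simp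
    then have "c = 0" using x0(1) by (simp add: norm_cscale)
    then show ?thesis using c by (simp add: cscale_simps)
  qed
  have ker: "\<exists>c. x = cscale c x\<^sub>0" if "A x = 0" for x
    using genI[of 1 x] that by simp
  have addY: "y + z \<in> Y" if "y \<in> Y" "z \<in> Y" for y z
    using that unfolding Y_def by (metis (no_types, lifting) blinfun.add_right rangeE rangeI)
  have cscaleY: "cscale c y \<in> Y" if "y \<in> Y" for c y
    using that unfolding Y_def by (metis (no_types, lifting) Ac rangeE rangeI)
  have diffY: "y - z \<in> Y" if "y \<in> Y" "z \<in> Y" for y z
    using that unfolding Y_def by (metis (no_types, lifting) blinfun.diff_right rangeE rangeI)
  have zeroY: "0 \<in> Y" unfolding Y_def by (metis blinfun.zero_right rangeI)
  have AY: "A x \<in> Y" for x unfolding Y_def by blast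
  have clY: "closed Y" using fred by (simp add: fredholm_def Y_def sA)
  \<comment> \<open>A preimage of \<open>x0\<close> would be a generalised eigenvector, hence a
    multiple of \<open>x0\<close>, hence in the kernel of \<open>A\<close>: there is no Jordan
    chain.\<close>
  have "x\<^sub>0 \<notin> Y"
  proof
    assume "x\<^sub>0 \<in> Y"
    then obtain y where y: "x\<^sub>0 = A y" by (auto simp: Y_def)
    then have "(blinfun_apply A ^^ 2) y = 0" using Ax0 by (simp add: numeral_2_eq_2)
    then obtain c where "y = cscale c x\<^sub>0" using genI by blast
    then show False using y Ac[of c "x\<^sub>0"] Ax0 x0(1) by (metis cscale.zero_right)
  qed
  then obtain d where d: "d > 0" "ball x\<^sub>0 d \<subseteq> - Y"
    using clY open_contains_ball[of "- Y"] by (auto simp: open_Compl)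
  \<comment> \<open>The positive distance from \<open>x0\<close> to \<open>Y\<close>, in scaled
    form; it bounds the coordinate along \<open>x0\<close> and later the functional
    \<open>\<phi>\<close>.\<close>
  have dist: "d * cmod a \<le> norm (y + cscale a x\<^sub>0)" if "y \<in> Y" for y a
  proof (cases "a = 0")
    case False
    have "- y = cscale (-1) y" by (simp add: cscale_simps)
    then have "cscale (- 1 / a) y \<in> Y" using cscaleY that by blast
    then have "d \<le> norm (x\<^sub>0 - cscale (- 1 / a) y)"
      using d(2) by (force simp: dist_norm not_le[symmetric])
    then have "d * cmod a \<le> norm (cscale a (x\<^sub>0 - cscale (- 1 / a) y))"
      by (metis norm_cscale mult.commute mult_right_mono norm_ge_zero)
    also have "cscale a (x\<^sub>0 - cscale (- 1 / a) y) = y + cscale a x\<^sub>0"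
      using False by (simp add: cscale_simps)
    finally show ?thesis .
  qed simp
  obtain K where K: "K \<ge> 0" "\<And>x. \<exists>u. A u = A x \<and> norm u \<le> K * norm (A x)"
    using closed_range_bounded_preimage[of A] clY unfolding Y_def by metis
  \<comment> \<open>The factor \<open>1 + norm x0 / d\<close> pays for removing the kernel component
    from a preimage of controlled norm; the last 1 makes \<open>K'\<close> positive.\<close>
  define K' where "K' = (1 + norm x\<^sub>0 / d) * K + 1"
  have K'0: "K' > 0" using K d by (simp add: K'_def add_nonneg_pos)
  have below: "norm y \<le> K' * norm (A y)" if "y \<in> Y" for y
  proof -
    obtain u where u: "A u = A y" "norm u \<le> K * norm (A y)" using K by blast
    then have "A (u - y) = 0" by (simp add: blinfun.diff_right)
    then obtain a where "u - y = cscale a x\<^sub>0" using ker by blast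
    then have ua: "u = y + cscale a x\<^sub>0" by (simp add: algebra_simps)
    have a: "cmod a \<le> norm u / d" using dist[OF that, of a] d(1) by (simp add: ua field_simps)
    have "y = u - cscale a x\<^sub>0" by (simp add: ua)
    then have "norm y \<le> norm u + cmod a * norm x\<^sub>0"
      using norm_triangle_ineq4[of u "cscale a x\<^sub>0"] by (simp add: norm_cscale)
    also have "\<dots> \<le> norm u + norm u / d * norm x\<^sub>0"
      using a by (intro add_left_mono mult_right_mono) auto
    also have "\<dots> = (1 + norm x\<^sub>0 / d) * norm u" by (simp add: algebra_simps)
    also have "\<dots> \<le> (1 + norm x\<^sub>0 / d) * (K * norm (A y))"
      using d(1) by (intro mult_left_mono u(2)) auto
    also have "\<dots> \<le> K' * norm (A y)" by (simp add: K'_def algebra_simps)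
    finally show ?thesis .
  qed
  have resolvent: "\<exists>S. bounded_linear S \<and> (\<forall>x. S (T x - cscale w x) = x) \<and> (\<forall>x. T (S x) - cscale w (S x) = x)"
    if "w \<notin> op_spectrum T" for w
    using that by (auto simp: op_spectrum_def shift_op_def fun_eq_iff o_def)
  \<comment> \<open>The image of \<open>Y\<close> under \<open>A\<close> is closed because
    \<open>A\<close> is bounded below on \<open>Y\<close>, so density is enough. For density,
    \<open>A u = y\<close> is replaced by \<open>A u - w u = y\<close>, solvable as
    \<open>1 + w\<close> is off the spectrum; the error \<open>w u\<close> is small because the
    bound on \<open>u\<close> does not depend on \<open>w\<close>.\<close>
  have ontoY: "\<exists>u\<in>Y. A u = y" if y: "y \<in> Y" for y
  proof -
    have sub: "subspace Y"
      unfolding subspace_def using addY zeroY cscaleY by (auto simp: scaleR_cscale)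
    have "\<forall>x\<in>Y. 1 / K' * norm x \<le> norm (A x)"
      using below K'0 by (simp add: field_simps)
    then have cl: "closed (blinfun_apply A ` Y)"
      using complete_isometric_image[of "1 / K'" Y "blinfun_apply A"] sub clY K'0
      by (simp add: complete_eq_closed blinfun.bounded_linear_right)
    have "y \<in> closure (blinfun_apply A ` Y)"
      unfolding closure_approachable
    proof (intro allI impI)
      fix e :: real assume e: "e > 0"
      obtain e' where e': "e' > 0" "op_spectrum T \<inter> ball 1 e' = {1}"
        using iso by (auto simp: isolated_in_spectrum_def)
      \<comment> \<open>The three entries keep \<open>1 + w\<close> in the isolating ball, let
        \<open>K' * w \<le> 1/2\<close> be absorbed into the left side, and make the error smaller
        than \<open>e\<close>.\<close>
      define w where "w = min (e' / 2) (min (1 / (2 * K')) (e / (2 * K' * norm y + 1) / 2))"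
      have den: "2 * K' * norm y + 1 > 0" using K'0 by (simp add: add_nonneg_pos)
      have w: "w > 0" "w < e'" "K' * w \<le> 1/2" "w * (2 * K' * norm y + 1) < e"
      proof -
        show "w > 0" using e' e K'0 den by (simp add: w_def)
        show "w < e'" using e' by (simp add: w_def min_def)
        have "w \<le> 1 / (2 * K')" by (simp add: w_def)
        then show "K' * w \<le> 1/2" using K'0 by (simp add: field_simps)
        have "w \<le> e / (2 * K' * norm y + 1) / 2" by (simp add: w_def)
        then have "w * (2 * K' * norm y + 1) \<le> e / 2" using den by (simp add: field_simps)
        then show "w * (2 * K' * norm y + 1) < e" using e by linarith
      qed
      have "1 + of_real w \<notin> op_spectrum T"
      proof
        assume "1 + of_real w \<in> op_spectrum T"
        moreover have "1 + of_real w \<in> ball (1::complex) e'" using w by (simp add: dist_norm)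
        ultimately have "1 + of_real w = (1::complex)" using e'(2) by blast
        then show False using w(1) by simp
      qed
      then obtain u where u: "T u - cscale (1 + of_real w) u = y"
        using resolvent by blast
      have Au: "A u = y + w *\<^sub>R u"
        using u by (simp add: TA cscale_simps scaleR_cscale algebra_simps)
      have "w *\<^sub>R u \<in> Y" using diffY[OF AY[of u] y] Au by simp
      then have "(1/w) *\<^sub>R (w *\<^sub>R u) \<in> Y" using subspace_scale[OF sub] by blast
      then have uY: "u \<in> Y" using w(1) by simp
      have "norm (y + w *\<^sub>R u) \<le> norm y + w * norm u"
        using norm_triangle_ineq[of y "w *\<^sub>R u"] w(1) by simp
      then have "norm u \<le> K' * (norm y + w * norm u)"
        using below[OF uY] K'0 unfolding Au by (smt (verit) mult_left_mono)
      also have "\<dots> = K' * norm y + (K' * w) * norm u" by (simp add: algebra_simps)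
      also have "\<dots> \<le> K' * norm y + 1/2 * norm u" using w(3) by (intro add_left_mono mult_right_mono) auto
      finally have "norm u \<le> 2 * K' * norm y" by simp
      then have "w * norm u \<le> w * (2 * K' * norm y + 1)" using w(1) by (intro mult_left_mono) auto
      then have "w * norm u < e" using w(4) by linarith
      then have "dist (A u) y < e" using w(1) by (simp add: Au dist_norm)
      then show "\<exists>y'\<in>blinfun_apply A ` Y. dist y' y < e" using uY by blast
    qed
    then show ?thesis using cl by (auto simp: closure_closed)
  qed
  have decomp: "\<exists>a. u - cscale a x\<^sub>0 \<in> Y" for u
  proof -
    obtain y where y: "y \<in> Y" "A y = A u" using ontoY[OF AY] by blast
    then have "A (u - y) = 0" by (simp add: blinfun.diff_right)
    then obtain a where "u - y = cscale a x\<^sub>0" using ker by blast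
    then have "u - cscale a x\<^sub>0 = y" by (simp add: algebra_simps)
    then show ?thesis using y(1) by blast
  qed
  \<comment> \<open>The coordinate along \<open>x0\<close>. It is unique because \<open>x0\<close>
    has positive distance from \<open>Y\<close>, and uniqueness gives linearity of the
    choice.\<close>
  define \<phi> where "\<phi> u = (SOME a. u - cscale a x\<^sub>0 \<in> Y)" for u
  have phiY: "u - cscale (\<phi> u) x\<^sub>0 \<in> Y" for u
    unfolding \<phi>_def by (rule someI_ex[OF decomp])
  have phiI: "\<phi> u = a" if "u - cscale a x\<^sub>0 \<in> Y" for u a
  proof -
    have "u - cscale a x\<^sub>0 - (u - cscale (\<phi> u) x\<^sub>0) \<in> Y" by (intro diffY that phiY)
    then have "cscale (\<phi> u - a) x\<^sub>0 \<in> Y" by (simp add: cscale_simps)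
    then have "d * cmod (a - \<phi> u) \<le> norm (cscale (\<phi> u - a) x\<^sub>0 + cscale (a - \<phi> u) x\<^sub>0)" by (rule dist)
    then have "d * cmod (a - \<phi> u) \<le> 0" by (simp add: cscale_simps)
    then show ?thesis using d(1) by (simp add: mult_le_0_iff)
  qed
  have phi_y: "\<phi> (y + cscale a x\<^sub>0) = a" if "y \<in> Y" for y a
    by (rule phiI) (simp add: that)
  have phi_le: "cmod (\<phi> u) \<le> norm u / d" for u
    using dist[OF phiY[of u], of "\<phi> u"] d(1) by (simp add: field_simps)
  have phi_c: "\<phi> (cscale c u) = c * \<phi> u" for c u
  proof (rule phiI)
    have "cscale c (u - cscale (\<phi> u) x\<^sub>0) \<in> Y" by (intro cscaleY phiY)
    then show "cscale c u - cscale (c * \<phi> u) x\<^sub>0 \<in> Y" by (simp add: cscale_simps)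
  qed
  have phi_add: "\<phi> (u + v) = \<phi> u + \<phi> v" for u v
  proof (rule phiI)
    have "(u - cscale (\<phi> u) x\<^sub>0) + (v - cscale (\<phi> v) x\<^sub>0) \<in> Y" by (intro addY phiY)
    then show "(u + v) - cscale (\<phi> u + \<phi> v) x\<^sub>0 \<in> Y" by (simp add: cscale_simps algebra_simps)
  qed
  have dual: "cdual \<phi>"
    unfolding cdual_def
  proof (intro conjI allI phi_c bounded_linear_intro[where K="1/d"])
    show "\<phi> (r *\<^sub>R x) = r *\<^sub>R \<phi> x" for r x
      by (simp add: scaleR_cscale[where ?'a='a] phi_c scaleR_conv_of_real)
    show "norm (\<phi> x) \<le> norm x * (1/d)" for x using phi_le by simp
  qed (rule phi_add)
  have phi_x0: "\<phi> x\<^sub>0 = 1" using phi_y[OF zeroY, of 1] by (simp add: cscale_one)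
  have phi_0: "\<phi> y = 0" if "y \<in> Y" for y using phi_y[OF that, of 0] by (simp add: cscale_simps)
  have phi_T: "\<phi> (T x) = \<phi> x" for x
    by (simp add: TA phi_add phi_0 AY)
  have Tx0: "T x\<^sub>0 = x\<^sub>0" by (simp add: TA Ax0)
  have TY: "T y \<in> Y" if "y \<in> Y" for y unfolding TA by (intro addY AY that)
  have "\<exists>C. bounded_below_surj C (id_blinfun - (cscale_op z o\<^sub>L (T - rank_one \<phi> x\<^sub>0)))" if z: "cmod z \<le> 1" for z
  proof -
    define D where "D y = y - cscale z (T y)" for y
    define B where "B = id_blinfun - (cscale_op z o\<^sub>L (T - rank_one \<phi> x\<^sub>0))"
    have DY: "D y \<in> Y" if "y \<in> Y" for y unfolding D_def by (intro diffY cscaleY TY that)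
    have B: "B (y + cscale a x\<^sub>0) = D y + cscale a x\<^sub>0" if "y \<in> Y" for y a
      using that by (simp add: B_def D_def blinfun.diff_left blinfun.add_right rank_one_apply[OF dual] phi_add phi_c phi_0[OF that] phi_x0
          Tc Tx0 cscale_simps)
    \<comment> \<open>Invertibility on \<open>Y\<close> alone. At \<open>z = 1\<close> the map
      \<open>D\<close> is \<open>- A\<close>; otherwise \<open>z\<close> is 0 or
      \<open>1 / z\<close> lies off the spectrum, and it remains to see that the solution stays in
      \<open>Y\<close>.\<close>
    have D: "\<exists>c>0. (\<forall>y\<in>Y. norm y \<le> c * norm (D y)) \<and> (\<forall>y\<in>Y. \<exists>u\<in>Y. D u = y)"
    proof -
      consider "z = 1" | "z = 0" | "z \<noteq> 1" "z \<noteq> 0" by blast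
      then show ?thesis
      proof cases
        case 1
        then have DA: "D y = - A y" for y by (simp add: D_def TA cscale_one)
        have "\<exists>u\<in>Y. D u = y" if "y \<in> Y" for y
        proof -
          have "- y \<in> Y" using diffY[OF zeroY that] by simp
          then show ?thesis using ontoY by (metis DA minus_minus)
        qed
        then show ?thesis using below K'0 by (intro exI[of _ K']) (auto simp: DA)
      next
        case 2
        then show ?thesis by (intro exI[of _ 1]) (auto simp: D_def cscale_simps)
      next
        case 3
        define w where "w = 1 / z"
        have zw: "z * w = 1" and w1: "w \<noteq> 1" using 3 by (auto simp: w_def)
        have "cmod w \<ge> 1" using z 3 by (simp add: w_def norm_divide)
        then have "1 / z \<notin> op_spectrum T" using spec w1 by (auto simp: w_def subset_iff)
        then obtain c where c: "bounded_below_surj c (id_blinfun - (cscale_op z o\<^sub>L T))"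
          using bounded_below_surj_off_spectrum[OF T] by blast
        have Dz: "(id_blinfun - (cscale_op z o\<^sub>L T)) y = D y" for y
          by (simp add: D_def blinfun.diff_left)
        have below_D: "norm y \<le> c * norm (D y)" for y
          using c by (simp add: bounded_below_surj_def Dz)
        have "norm y \<le> (\<bar>c\<bar> + 1) * norm (D y)" for y
          by (rule order_trans[OF below_D mult_right_mono]) auto
        moreover have "\<exists>u\<in>Y. D u = y" if "y \<in> Y" for y
        proof -
          obtain u where u: "D u = y"
            using c unfolding bounded_below_surj_def Dz[symmetric] by (metis surjD)
          have "cscale w (D u) = cscale w u - T u" using zw by (simp add: D_def cscale_simps mult.commute)
          \<comment> \<open>The right-hand side lies in \<open>Y\<close>, and
            \<open>w \<noteq> 1\<close> permits division, so the solution found in the whole space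
            belongs to \<open>Y\<close>.\<close>
          then have "cscale (1 - w) u = cscale (-w) y - A u"
            using u by (simp add: TA cscale_simps algebra_simps)
          then have "cscale (1 - w) u \<in> Y" by (simp add: diffY cscaleY AY that)
          then have "cscale (1 / (1 - w)) (cscale (1 - w) u) \<in> Y" by (rule cscaleY)
          then have "u \<in> Y" using w1 by (simp add: cscale_cscale cscale_one)
          then show ?thesis using u by blast
        qed
        ultimately show ?thesis by (intro exI[of _ "\<bar>c\<bar> + 1"]) auto
      qed
    qed
    then obtain c where c: "c > 0" "\<And>y. y \<in> Y \<Longrightarrow> norm y \<le> c * norm (D y)" "\<And>y. y \<in> Y \<Longrightarrow> \<exists>u\<in>Y. D u = y"
      by blast
    have "norm u \<le> (c * (1 + norm x\<^sub>0 / d) + norm x\<^sub>0 / d) * norm (B u)" for u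
    proof -
      define y a where "y = u - cscale (\<phi> u) x\<^sub>0" and "a = \<phi> u"
      have y: "y \<in> Y" and u: "u = y + cscale a x\<^sub>0" using phiY by (simp_all add: y_def a_def)
      have Bu: "B u = D y + cscale a x\<^sub>0" unfolding u by (rule B[OF y])
      have "cmod a \<le> norm (B u) / d" using dist[OF DY[OF y], of a] d(1) by (simp add: Bu field_simps)
      then have a: "norm (cscale a x\<^sub>0) \<le> norm (B u) / d * norm x\<^sub>0"
        by (simp only: norm_cscale mult_right_mono norm_ge_zero)
      have "D y = B u - cscale a x\<^sub>0" by (simp add: Bu)
      then have "norm (D y) \<le> norm (B u) + norm (B u) / d * norm x\<^sub>0"
        using norm_triangle_ineq4[of "B u" "cscale a x\<^sub>0"] a by simp
      then have "norm y \<le> c * (norm (B u) + norm (B u) / d * norm x\<^sub>0)"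
        using c(1) c(2)[OF y] by (smt (verit) mult_left_mono)
      then have "norm u \<le> c * (norm (B u) + norm (B u) / d * norm x\<^sub>0) + norm (B u) / d * norm x\<^sub>0"
        using norm_triangle_ineq[of y "cscale a x\<^sub>0"] a unfolding u[symmetric] by linarith
      then show ?thesis by (simp add: algebra_simps)
    qed
    moreover have "v \<in> range (blinfun_apply B)" for v
    proof -
      obtain y where y: "y \<in> Y" "D y = v - cscale (\<phi> v) x\<^sub>0" using c(3)[OF phiY] by blast
      then have "B (y + cscale (\<phi> v) x\<^sub>0) = v" using B by simp
      then show ?thesis by (metis rangeI)
    qed
    ultimately have "bounded_below_surj (c * (1 + norm x\<^sub>0 / d) + norm x\<^sub>0 / d) B"
      unfolding bounded_below_surj_def by blast
    then show ?thesis unfolding B_def by blast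
  qed
  then show ?thesis using that Tx0 dual phi_x0 phi_T by blast
qed

section \<open>Taylor expansions at a single point\<close>

text \<open>The difference quotient at 0 can be formed \<open>n\<close> times and the last one is
  continuous at 0. This is equivalent to a Taylor expansion with remainder \<open>o(t^n)\<close>,
  but the recursive form suits induction and the bootstrapping of implicit equations.\<close>

primrec expands :: "nat \<Rightarrow> (real \<Rightarrow> 'a::real_normed_vector) \<Rightarrow> bool" where
  "expands 0 f \<longleftrightarrow> isCont f 0"
| "expands (Suc n) f \<longleftrightarrow> (\<exists>g. expands n g \<and> (\<forall>\<^sub>F t in nhds 0. f t = f 0 + t *\<^sub>R g t))"

text \<open>Any constant \<open>c\<close> is admissible because \<open>nhds 0\<close> includes the
  point \<open>t = 0\<close>, which forces \<open>c = f 0\<close>.\<close>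

lemma expands_SucI:
  assumes "expands n g" "\<forall>\<^sub>F t in nhds 0. f t = c + t *\<^sub>R g t"
  shows "expands (Suc n) f"
proof -
  have "f 0 = c" using eventually_nhds_x_imp_x[OF assms(2)] by simp
  then show ?thesis using assms by auto
qed

lemma expands_Suc_imp_expands: "expands (Suc n) f \<Longrightarrow> expands n f"
proof (induction n arbitrary: f)
  case 0
  then obtain g where g: "isCont g 0" "\<forall>\<^sub>F t in nhds 0. f t = f 0 + t *\<^sub>R g t" by auto
  have "isCont (\<lambda>t. f 0 + t *\<^sub>R g t) 0" by (intro continuous_intros g(1))
  then show ?case using isCont_cong[OF g(2)] by simp
next
  case (Suc n)
  then show ?case by auto
qed

lemma expands_mono: "expands n f \<Longrightarrow> m \<le> n \<Longrightarrow> expands m f"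
proof (induction n)
  case (Suc n)
  then show ?case using expands_Suc_imp_expands[of n f] by (cases "m = Suc n") (simp_all del: expands.simps)
qed simp

lemma expands_imp_isCont: "expands n f \<Longrightarrow> isCont f 0"
  using expands_mono[of n f 0] by simp

lemma expands_const: "expands n (\<lambda>_. c)"
proof (induction n arbitrary: c)
  case (Suc n)
  show ?case by (rule expands_SucI[OF Suc.IH[of 0], where c=c]) simp
qed simp

lemma expands_bounded_linear:
  assumes "bounded_linear h"
  shows "expands n f \<Longrightarrow> expands n (\<lambda>t. h (f t))"
proof (induction n arbitrary: f)
  case 0
  then show ?case using bounded_linear.isCont[OF assms] by simp
next
  case (Suc n)
  then obtain g where g: "expands n g" "\<forall>\<^sub>F t in nhds 0. f t = f 0 + t *\<^sub>R g t" by auto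
  interpret bounded_linear h by fact
  show ?case
    by (rule expands_SucI[OF Suc.IH[OF g(1)], where c="h (f 0)"])
      (use g(2) in \<open>auto elim!: eventually_mono simp: add scaleR\<close>)
qed

lemma expands_add: "expands n f \<Longrightarrow> expands n g \<Longrightarrow> expands n (\<lambda>t. f t + g t)"
proof (induction n arbitrary: f g)
  case 0
  then show ?case by simp
next
  case (Suc n)
  then obtain f' g' where *: "expands n f'" "\<forall>\<^sub>F t in nhds 0. f t = f 0 + t *\<^sub>R f' t"
    "expands n g'" "\<forall>\<^sub>F t in nhds 0. g t = g 0 + t *\<^sub>R g' t" by auto
  show ?case
    by (rule expands_SucI[OF Suc.IH[OF *(1,3)], where c="f 0 + g 0"])
      (rule eventually_mono[OF eventually_conj[OF *(2) *(4)]], simp add: algebra_simps)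
qed

lemma expands_minus: "expands n f \<Longrightarrow> expands n (\<lambda>t. - f t)"
  using expands_bounded_linear[OF bounded_linear_minus[OF bounded_linear_ident]] by blast

lemma expands_diff: "expands n f \<Longrightarrow> expands n g \<Longrightarrow> expands n (\<lambda>t. f t - g t)"
  using expands_add[of n f "\<lambda>t. - g t"] expands_minus[of n g] by simp

text \<open>The quotient of the product is \<open>b (f' t) (g t) + b (f 0) (g' t)\<close>, an
  asymmetric Leibniz rule in which only one function appears undivided, at an order already
  available.\<close>

lemma expands_bounded_bilinear:
  assumes "bounded_bilinear b"
  shows "expands n f \<Longrightarrow> expands n g \<Longrightarrow> expands n (\<lambda>t. b (f t) (g t))"
proof (induction n arbitrary: f g)
  case 0
  then show ?case using bounded_bilinear.isCont[OF assms] by simp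
next
  case (Suc n)
  then obtain f' g' where *: "expands n f'" "\<forall>\<^sub>F t in nhds 0. f t = f 0 + t *\<^sub>R f' t"
    "expands n g'" "\<forall>\<^sub>F t in nhds 0. g t = g 0 + t *\<^sub>R g' t" by auto
  interpret bounded_bilinear b by fact
  have "expands n (\<lambda>t. b (f' t) (g t) + b (f 0) (g' t))"
    by (rule expands_add[OF Suc.IH[OF *(1) expands_Suc_imp_expands[OF Suc.prems(2)]] Suc.IH[OF expands_const *(3)]])
  moreover have "\<forall>\<^sub>F t in nhds 0. b (f t) (g t) = b (f 0) (g 0) + t *\<^sub>R (b (f' t) (g t) + b (f 0) (g' t))"
  proof (rule eventually_mono[OF eventually_conj[OF *(2) *(4)]])
    fix t assume elim: "f t = f 0 + t *\<^sub>R f' t \<and> g t = g 0 + t *\<^sub>R g' t"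
    have "b (f t) (g t) = b (f 0) (g t) + t *\<^sub>R b (f' t) (g t)"
      by (subst elim[THEN conjunct1]) (simp add: add_left scaleR_left)
    also have "b (f 0) (g t) = b (f 0) (g 0) + t *\<^sub>R b (f 0) (g' t)"
      by (subst elim[THEN conjunct2]) (simp add: add_right scaleR_right)
    finally show "b (f t) (g t) = b (f 0) (g 0) + t *\<^sub>R (b (f' t) (g t) + b (f 0) (g' t))"
      by (simp add: scaleR_add_right)
  qed
  ultimately show ?case by (rule expands_SucI)
qed

lemmas expands_mult = expands_bounded_bilinear[OF bounded_bilinear_mult]
lemmas expands_blinfun_apply = expands_bounded_bilinear[OF bounded_bilinear_blinfun_apply]
lemmas expands_cscale = expands_bounded_bilinear[OF bounded_bilinear_cscale]

lemma expands_power: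
  fixes f :: "real \<Rightarrow> 'a::{real_normed_algebra_1}"
  shows "expands n f \<Longrightarrow> expands n (\<lambda>t. f t ^ k)"
proof (induction k)
  case (Suc k)
  then show ?case using expands_mult[OF Suc.prems Suc.IH] by simp
qed (simp add: expands_const)

lemma expands_id: "expands n (\<lambda>t::real. t)"
proof (cases n)
  case (Suc m)
  show ?thesis unfolding Suc by (rule expands_SucI[OF expands_const[of m 1], where c=0]) simp
qed simp

text \<open>The quotient \<open>(F z - F (f 0)) / (z - f 0)\<close> extends holomorphically over
  \<open>f 0\<close>, so the induction may change \<open>F\<close> and lower the order.\<close>

lemma expands_holomorphic_compose:
  fixes f :: "real \<Rightarrow> complex"
  assumes "open U"
  shows "expands n f \<Longrightarrow> F holomorphic_on U \<Longrightarrow> f 0 \<in> U \<Longrightarrow> expands n (\<lambda>t. F (f t))"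
proof (induction n arbitrary: F)
  case 0
  have "isCont f 0" using 0(1) by simp
  moreover have "isCont F (f 0)"
    using holomorphic_on_imp_continuous_on[OF 0(2)] continuous_on_eq_continuous_at[OF assms] 0(3) by blast
  ultimately show ?case by (simp add: isCont_o2)
next
  case (Suc n)
  then obtain f' where f': "expands n f'" "\<forall>\<^sub>F t in nhds 0. f t = f 0 + t *\<^sub>R f' t" by auto
  define F' where "F' z = (if z = f 0 then deriv F (f 0) else (F z - F (f 0)) / (z - f 0))" for z
  have "F' holomorphic_on U"
    unfolding F'_def by (rule pole_lemma_open[OF Suc.prems(2) assms])
  then have "expands n (\<lambda>t. F' (f t))"
    by (rule Suc.IH[OF expands_Suc_imp_expands[OF Suc.prems(1)] _ Suc.prems(3)])
  then have "expands n (\<lambda>t. f' t * F' (f t))" by (rule expands_mult[OF f'(1)])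
  moreover have "\<forall>\<^sub>F t in nhds 0. F (f t) = F (f 0) + t *\<^sub>R (f' t * F' (f t))"
    using f'(2)
  proof eventually_elim
    case (elim t)
    have "F z = F (f 0) + (z - f 0) * F' z" for z by (simp add: F'_def)
    from this[of "f t"] have "F (f t) = F (f 0) + (f t - f 0) * F' (f t)" .
    also have "f t - f 0 = t *\<^sub>R f' t" using elim by simp
    finally show ?case by simp
  qed
  ultimately show ?case by (rule expands_SucI)
qed

lemma expands_of_real_exp: "expands n (\<lambda>t. exp (c * of_real t :: complex))"
proof (rule expands_holomorphic_compose[OF open_UNIV, of n "\<lambda>t. c * of_real t" exp])
  show "expands n (\<lambda>t. c * of_real t)"
    by (rule expands_mult[OF expands_const expands_bounded_linear[OF bounded_linear_of_real expands_id]])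
qed (auto intro: holomorphic_intros)

text \<open>The same regularity with visible coefficients; nothing is claimed about derivatives of
  \<open>f\<close> away from 0.\<close>

definition peano_expansion :: "nat \<Rightarrow> (real \<Rightarrow> 'a::real_normed_vector) \<Rightarrow> (nat \<Rightarrow> 'a) \<Rightarrow> bool" where
  "peano_expansion n f c \<longleftrightarrow> (\<forall>\<epsilon>>0. \<exists>d>0. \<forall>t. \<bar>t\<bar> < d \<longrightarrow> norm (f t - (\<Sum>k\<le>n. t ^ k *\<^sub>R c k)) \<le> \<epsilon> * \<bar>t\<bar> ^ n)"

lemma peano_expansion_0: "peano_expansion 0 f c \<longleftrightarrow> isCont f 0 \<and> f 0 = c 0"
proof
  assume *: "peano_expansion 0 f c"
  have "norm (f 0 - c 0) \<le> e" if "e > 0" for e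
    using * that by (auto simp: peano_expansion_def)
  then have "f 0 = c 0" using field_le_epsilon[of "norm (f 0 - c 0)" 0] by simp
  moreover have "\<exists>d>0. \<forall>x. dist x 0 < d \<longrightarrow> dist (f x) (f 0) < e" if "e > 0" for e
  proof -
    have "\<exists>d>0. \<forall>t. \<bar>t\<bar> < d \<longrightarrow> norm (f t - c 0) \<le> e / 2"
      using *[unfolded peano_expansion_def, rule_format, of "e / 2"] that by simp
    then obtain d where "d > 0" "\<And>t. \<bar>t\<bar> < d \<Longrightarrow> norm (f t - c 0) \<le> e / 2"
      by blast
    moreover have "dist (f x) (f 0) < e" if "dist x 0 < d" for x
      using \<open>d > 0\<close> \<open>e > 0\<close> \<open>\<And>t. \<bar>t\<bar> < d \<Longrightarrow> norm (f t - c 0) \<le> e / 2\<close>[of x] that \<open>f 0 = c 0\<close>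
      by (simp add: dist_norm)
    ultimately show ?thesis by blast
  qed
  ultimately show "isCont f 0 \<and> f 0 = c 0" by (auto simp: continuous_at_eps_delta dist_norm)
next
  assume *: "isCont f 0 \<and> f 0 = c 0"
  have "\<exists>d>0. \<forall>t. \<bar>t\<bar> < d \<longrightarrow> norm (f t - c 0) \<le> e" if "e > 0" for e
  proof -
    obtain d where "d > 0" "\<And>t. norm (t - 0) < d \<Longrightarrow> norm (f t - f 0) < e"
      using * \<open>e > 0\<close> unfolding continuous_at_eps_delta dist_norm by blast
    then show ?thesis using * by (intro exI[of _ d]) (auto simp: less_imp_le)
  qed
  then show "peano_expansion 0 f c" by (simp add: peano_expansion_def)
qed

lemma peano_expansion_Suc:
  assumes "\<forall>\<^sub>F t in nhds 0. f t = c 0 + t *\<^sub>R g t"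
  shows "peano_expansion n g (\<lambda>k. c (Suc k)) \<Longrightarrow> peano_expansion (Suc n) f c"
  unfolding peano_expansion_def
proof (intro allI impI)
  fix e :: real
  assume e: "e > 0" and "\<forall>\<epsilon>>0. \<exists>d>0. \<forall>t. \<bar>t\<bar> < d \<longrightarrow> norm (g t - (\<Sum>k\<le>n. t ^ k *\<^sub>R c (Suc k))) \<le> \<epsilon> * \<bar>t\<bar> ^ n"
  then obtain d where d: "d > 0" "\<And>t. \<bar>t\<bar> < d \<Longrightarrow> norm (g t - (\<Sum>k\<le>n. t ^ k *\<^sub>R c (Suc k))) \<le> e * \<bar>t\<bar> ^ n"
    by blast
  obtain d' where d': "d' > 0" "\<And>t. \<bar>t\<bar> < d' \<Longrightarrow> f t = c 0 + t *\<^sub>R g t"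
    using assms by (auto simp: eventually_nhds_metric dist_norm)
  have "norm (f t - (\<Sum>k\<le>Suc n. t ^ k *\<^sub>R c k)) \<le> e * \<bar>t\<bar> ^ Suc n" if t: "\<bar>t\<bar> < min d d'" for t
  proof -
    have "f t - (\<Sum>k\<le>Suc n. t ^ k *\<^sub>R c k) = t *\<^sub>R (g t - (\<Sum>k\<le>n. t ^ k *\<^sub>R c (Suc k)))"
      using d'(2)[of t] t by (simp add: sum.atMost_Suc_shift scaleR_sum_right scaleR_diff_right del: sum.atMost_Suc)
    then have "norm (f t - (\<Sum>k\<le>Suc n. t ^ k *\<^sub>R c k)) = \<bar>t\<bar> * norm (g t - (\<Sum>k\<le>n. t ^ k *\<^sub>R c (Suc k)))"
      by simp
    also have "\<dots> \<le> \<bar>t\<bar> * (e * \<bar>t\<bar> ^ n)" using d(2) t by (intro mult_left_mono) auto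
    finally show ?thesis by (simp add: mult_ac)
  qed
  then show "\<exists>d>0. \<forall>t. \<bar>t\<bar> < d \<longrightarrow> norm (f t - (\<Sum>k\<le>Suc n. t ^ k *\<^sub>R c k)) \<le> e * \<bar>t\<bar> ^ Suc n"
    using d(1) d'(1) by (intro exI[of _ "min d d'"]) auto
qed

lemma expands_imp_peano: "expands n f \<Longrightarrow> \<exists>c. peano_expansion n f c"
proof (induction n arbitrary: f)
  case 0
  then show ?case by (auto simp: peano_expansion_0 intro: exI[of _ "\<lambda>_. f 0"])
next
  case (Suc n)
  then obtain g where g: "expands n g" "\<forall>\<^sub>F t in nhds 0. f t = f 0 + t *\<^sub>R g t" by auto
  then obtain c where c: "peano_expansion n g c" using Suc.IH by blast
  show ?case
    using peano_expansion_Suc[of f "case_nat (f 0) c" g n] g(2) c by (intro exI[of _ "case_nat (f 0) c"]) simp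
qed

text \<open>The difference quotient, given the value \<open>c 1\<close> at 0, has the coefficient
  sequence shifted by one.\<close>

lemma peano_imp_expands: "peano_expansion n f c \<Longrightarrow> expands n f"
proof (induction n arbitrary: f c)
  case 0
  then show ?case by (simp add: peano_expansion_0)
next
  case (Suc n)
  define g where "g t = (if t = 0 then c 1 else (f t - c 0) /\<^sub>R t)" for t
  have "peano_expansion n g (\<lambda>k. c (Suc k))"
    unfolding peano_expansion_def
  proof (intro allI impI)
    fix e :: real assume "e > 0"
    then obtain d where d: "d > 0" "\<And>t. \<bar>t\<bar> < d \<Longrightarrow> norm (f t - (\<Sum>k\<le>Suc n. t ^ k *\<^sub>R c k)) \<le> e * \<bar>t\<bar> ^ Suc n"
      using Suc.prems unfolding peano_expansion_def by metis
    have "norm (g t - (\<Sum>k\<le>n. t ^ k *\<^sub>R c (Suc k))) \<le> e * \<bar>t\<bar> ^ n" if t: "\<bar>t\<bar> < d" for t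
    proof (cases "t = 0")
      case True
      have "(\<Sum>k\<le>n. (0::real) ^ k *\<^sub>R c (Suc k)) = c 1"
        by (subst sum.atMost_shift) (simp add: One_nat_def)
      then show ?thesis using True \<open>e > 0\<close> by (simp add: g_def)
    next
      case False
      have "f t - (\<Sum>k\<le>Suc n. t ^ k *\<^sub>R c k) = t *\<^sub>R (g t - (\<Sum>k\<le>n. t ^ k *\<^sub>R c (Suc k)))"
        using False by (simp add: g_def sum.atMost_Suc_shift scaleR_sum_right scaleR_diff_right del: sum.atMost_Suc)
      then have "\<bar>t\<bar> * norm (g t - (\<Sum>k\<le>n. t ^ k *\<^sub>R c (Suc k))) \<le> \<bar>t\<bar> * (e * \<bar>t\<bar> ^ n)"
        using d(2)[OF t] by (simp add: mult_ac)
      then show ?thesis using False by (subst (asm) mult_le_cancel_left_pos) auto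
    qed
    then show "\<exists>d>0. \<forall>t. \<bar>t\<bar> < d \<longrightarrow> norm (g t - (\<Sum>k\<le>n. t ^ k *\<^sub>R c (Suc k))) \<le> e * \<bar>t\<bar> ^ n"
      using d(1) by blast
  qed
  then have "expands n g" by (rule Suc.IH)
  moreover have "f 0 = c 0"
  proof -
    obtain d where d: "d > 0" "\<And>t. \<bar>t\<bar> < d \<Longrightarrow> norm (f t - (\<Sum>k\<le>Suc n. t ^ k *\<^sub>R c k)) \<le> 1 * \<bar>t\<bar> ^ Suc n"
      using Suc.prems unfolding peano_expansion_def by (metis zero_less_one)
    have "(\<Sum>k\<le>Suc n. (0::real) ^ k *\<^sub>R c k) = c 0" by (subst sum.atMost_shift) simp
    then show ?thesis using d(2)[of 0] d(1) by simp
  qed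
  then have "\<forall>\<^sub>F t in nhds 0. f t = c 0 + t *\<^sub>R g t"
    by (intro always_eventually) (auto simp: g_def)
  ultimately show ?case by (rule expands_SucI)
qed

text \<open>The remainder of \<open>f\<close> has the remainder of \<open>D\<close> as its
  derivative, so the mean value inequality on the interval of radius \<open>|t|\<close> gains one
  factor \<open>|t|\<close>.\<close>

lemma peano_expansion_antiderivative:
  assumes D: "\<And>t. \<bar>t\<bar> \<le> \<delta> \<Longrightarrow> (f has_vector_derivative D t) (at t within {-\<delta>..\<delta>})" and "\<delta> > 0"
    and "peano_expansion n D c"
  shows "peano_expansion (Suc n) f (case_nat (f 0) (\<lambda>k. c k /\<^sub>R real (Suc k)))"
  unfolding peano_expansion_def
proof (intro allI impI)
  fix e :: real assume "e > 0"
  then obtain d where d: "d > 0" "\<And>t. \<bar>t\<bar> < d \<Longrightarrow> norm (D t - (\<Sum>k\<le>n. t ^ k *\<^sub>R c k)) \<le> e * \<bar>t\<bar> ^ n"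
    using assms(3) unfolding peano_expansion_def by metis
  define R where "R t = f t - (\<Sum>k\<le>Suc n. t ^ k *\<^sub>R case_nat (f 0) (\<lambda>k. c k /\<^sub>R real (Suc k)) k)" for t
  have Req: "R = (\<lambda>t. f t - (f 0 + (\<Sum>k\<le>n. t ^ Suc k *\<^sub>R (c k /\<^sub>R real (Suc k)))))"
    by (simp add: R_def fun_eq_iff sum.atMost_Suc_shift del: sum.atMost_Suc)
  have R0: "R 0 = 0" by (simp add: Req)
  have RD: "(R has_vector_derivative (D t - (\<Sum>k\<le>n. t ^ k *\<^sub>R c k))) (at t within {-\<delta>..\<delta>})" if "\<bar>t\<bar> \<le> \<delta>" for t
  proof -
    have "((\<lambda>t. t ^ Suc k *\<^sub>R (c k /\<^sub>R real (Suc k))) has_vector_derivative t ^ k *\<^sub>R c k) (at t within {-\<delta>..\<delta>})" for k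
    proof -
      have "((\<lambda>t. t ^ Suc k) has_vector_derivative (real (Suc k) * t ^ k)) (at t within {-\<delta>..\<delta>})"
        unfolding has_real_derivative_iff_has_vector_derivative[symmetric]
        by (rule derivative_eq_intros refl)+ simp
      then have "((\<lambda>t. t ^ Suc k *\<^sub>R (c k /\<^sub>R real (Suc k))) has_vector_derivative
          (real (Suc k) * t ^ k) *\<^sub>R (c k /\<^sub>R real (Suc k))) (at t within {-\<delta>..\<delta>})"
        by (rule bounded_linear.has_vector_derivative[OF bounded_linear_scaleR_left])
      moreover have "(real (Suc k) * t ^ k) *\<^sub>R (c k /\<^sub>R real (Suc k)) = t ^ k *\<^sub>R c k"
        by simp
      ultimately show ?thesis by (simp only:)
    qed
    then have "((\<lambda>t. \<Sum>k\<le>n. t ^ Suc k *\<^sub>R (c k /\<^sub>R real (Suc k))) has_vector_derivative (\<Sum>k\<le>n. t ^ k *\<^sub>R c k)) (at t within {-\<delta>..\<delta>})"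
      by (rule has_vector_derivative_sum)
    then have "((\<lambda>t. f 0 + (\<Sum>k\<le>n. t ^ Suc k *\<^sub>R (c k /\<^sub>R real (Suc k)))) has_vector_derivative 0 + (\<Sum>k\<le>n. t ^ k *\<^sub>R c k)) (at t within {-\<delta>..\<delta>})"
      by (intro has_vector_derivative_add has_vector_derivative_const)
    then show ?thesis unfolding Req using has_vector_derivative_diff[OF D[OF that]] by simp
  qed
  have "norm (R t) \<le> e * \<bar>t\<bar> ^ Suc n" if t: "\<bar>t\<bar> < min d \<delta>" for t
  proof -
    define S where "S = cball (0::real) \<bar>t\<bar>"
    have SS: "S \<subseteq> {-\<delta>..\<delta>}" using t by (auto simp: S_def dist_norm)
    have "norm (R t - R 0) \<le> (e * \<bar>t\<bar> ^ n) * norm (t - 0)"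
    proof (rule differentiable_bound[where S=S and f'="\<lambda>s x. x *\<^sub>R (D s - (\<Sum>k\<le>n. s ^ k *\<^sub>R c k))"])
      show "convex S" by (simp add: S_def)
      fix s assume s: "s \<in> S"
      then have s': "\<bar>s\<bar> \<le> \<bar>t\<bar>" by (simp add: S_def dist_norm)
      show "(R has_derivative (\<lambda>x. x *\<^sub>R (D s - (\<Sum>k\<le>n. s ^ k *\<^sub>R c k)))) (at s within S)"
        using has_vector_derivative_within_subset[OF RD SS, of s] s' t by (simp add: has_vector_derivative_def)
      have "norm (D s - (\<Sum>k\<le>n. s ^ k *\<^sub>R c k)) \<le> e * \<bar>s\<bar> ^ n" using d(2) s' t by simp
      also have "\<dots> \<le> e * \<bar>t\<bar> ^ n" using s' \<open>e > 0\<close> by (intro mult_left_mono power_mono) auto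
      finally show "onorm (\<lambda>x. x *\<^sub>R (D s - (\<Sum>k\<le>n. s ^ k *\<^sub>R c k))) \<le> e * \<bar>t\<bar> ^ n"
        by (intro onorm_bound) (use \<open>e > 0\<close> in \<open>auto simp: mult.commute mult_left_mono\<close>)
    qed (auto simp: S_def)
    then show ?thesis using R0 by (simp add: mult_ac)
  qed
  then show "\<exists>d>0. \<forall>t. \<bar>t\<bar> < d \<longrightarrow> norm (f t - (\<Sum>k\<le>Suc n. t ^ k *\<^sub>R case_nat (f 0) (\<lambda>k. c k /\<^sub>R real (Suc k)) k)) \<le> e * \<bar>t\<bar> ^ Suc n"
    using d(1) \<open>\<delta> > 0\<close> unfolding R_def by (intro exI[of _ "min d \<delta>"]) auto
qed

text \<open>Starts from the continuity of the highest derivative and descends, each antiderivative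
  gaining one order.\<close>

lemma Ck_on_imp_expands:
  assumes "Ck_on n f {-\<delta>..\<delta>}" "\<delta> > 0"
  shows "expands n f"
proof -
  obtain D where D: "D 0 = f" "\<And>j t. j < n \<Longrightarrow> t \<in> {-\<delta>..\<delta>} \<Longrightarrow> (D j has_vector_derivative D (Suc j) t) (at t within {-\<delta>..\<delta>})"
    "\<And>j. j \<le> n \<Longrightarrow> continuous_on {-\<delta>..\<delta>} (D j)"
    using assms(1) unfolding Ck_on_def by blast
  have "\<exists>c. peano_expansion k (D (n - k)) c" if "k \<le> n" for k
    using that
  proof (induction k)
    case 0
    have "isCont (D n) 0"
      using continuous_on_interior[OF D(3)[of n], of 0] \<open>\<delta> > 0\<close> by (simp add: interior_atLeastAtMost_real)
    then show ?case by (auto simp: peano_expansion_0 intro: exI[of _ "\<lambda>_. D n 0"])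
  next
    case (Suc k)
    then obtain c where c: "peano_expansion k (D (n - k)) c" by auto
    have "(D (n - Suc k) has_vector_derivative D (n - k) t) (at t within {-\<delta>..\<delta>})" if "\<bar>t\<bar> \<le> \<delta>" for t
      using D(2)[of "n - Suc k" t] Suc.prems that by (simp add: Suc_diff_Suc abs_le_iff)
    from peano_expansion_antiderivative[OF this assms(2) c] show ?case by blast
  qed
  from this[of n] show ?thesis using D(1) peano_imp_expands by auto
qed

section \<open>Perturbation of the leading eigenvalue\<close>

lemma cdual_boundE:
  assumes "cdual \<phi>"
  obtains B where "B > 0" "\<And>x. cmod (\<phi> x) \<le> B * norm x"
  using bounded_linear.pos_bounded[of \<phi>] assms by (auto simp: cdual_def mult.commute)

text \<open>Linearity in the vector, which carries an expansion of the eigenvector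
  \<open>h t\<close> over to the operator \<open>rank_one \<phi> (h t)\<close>.\<close>

lemma bounded_linear_rank_one:
  assumes "cdual \<phi>"
  shows "bounded_linear (rank_one \<phi>)"
proof -
  obtain B where B: "B > 0" "\<And>x. cmod (\<phi> x) \<le> B * norm x" using cdual_boundE[OF assms] by blast
  show ?thesis
  proof (rule bounded_linear_intro[where K=B])
    show "rank_one \<phi> (x + y) = rank_one \<phi> x + rank_one \<phi> y" for x y
      by (rule blinfun_eqI) (simp add: rank_one_apply[OF assms] blinfun.add_left cscale_simps)
    show "rank_one \<phi> (r *\<^sub>R x) = r *\<^sub>R rank_one \<phi> x" for r x
      by (rule blinfun_eqI) (simp add: rank_one_apply[OF assms] blinfun.scaleR_left cscale.scaleR_right)
    show "norm (rank_one \<phi> x) \<le> norm x * B" for x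
    proof (rule norm_blinfun_bound)
      fix u
      have "norm (rank_one \<phi> x u) = cmod (\<phi> u) * norm x" by (simp add: rank_one_apply[OF assms] norm_cscale)
      also have "\<dots> \<le> (B * norm u) * norm x" by (intro mult_right_mono B(2)) simp
      finally show "norm (rank_one \<phi> x u) \<le> norm x * B * norm u" by (simp add: mult_ac)
    qed (use B(1) in simp)
  qed
qed

lemma isCont_0_normD:
  fixes f :: "real \<Rightarrow> 'a::real_normed_vector"
  assumes "isCont f 0" "e > 0"
  obtains d where "d > 0" "\<And>t. \<bar>t\<bar> \<le> d \<Longrightarrow> norm (f t - f 0) \<le> e"
proof -
  obtain d where d: "d > 0" "\<And>t. dist t 0 < d \<Longrightarrow> dist (f t) (f 0) < e"
    using assms unfolding continuous_at_eps_delta by blast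
  have "norm (f t - f 0) \<le> e" if "\<bar>t\<bar> \<le> d / 2" for t
    using d(2)[of t] that d(1) by (simp add: dist_norm)
  then show ?thesis using d(1) by (intro that[of "d / 2"]) auto
qed

lemma isCont_0_normI:
  fixes f :: "real \<Rightarrow> 'a::real_normed_vector"
  assumes "(g \<longlongrightarrow> 0) (nhds 0)" "\<forall>\<^sub>F t in nhds 0. norm (f t - f 0) \<le> g t"
  shows "isCont f 0"
proof -
  have "((\<lambda>t. f t - f 0) \<longlongrightarrow> 0) (nhds 0)"
    by (rule Lim_null_comparison[OF assms(2,1)])
  then have "((\<lambda>t. f t - f 0) \<longlongrightarrow> 0) (at 0)"
    by (rule tendsto_mono[rotated]) (simp add: at_within_def)
  then show ?thesis by (simp add: isCont_def LIM_zero_iff)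
qed

text \<open>The outcome of the splitting at \<open>t = 0\<close> taken as assumptions, with
  \<open>n\<close> the available order of expansion of \<open>L\<close>.\<close>

locale perturbed_operator =
  fixes L :: "real \<Rightarrow> ('a::complex_banach \<Rightarrow>\<^sub>L 'a)" and x\<^sub>0 :: 'a and \<phi> :: "'a \<Rightarrow> complex" and n :: nat
  assumes L_clin: "\<And>t. bounded_clinear_op (L t)"
    and L0_x0: "L 0 x\<^sub>0 = x\<^sub>0"
    and phi: "cdual \<phi>"
    and phi_x0: "\<phi> x\<^sub>0 = 1"
    and phi_L0: "\<And>x. \<phi> (L 0 x) = \<phi> x"
    and inv: "\<And>z. cmod z \<le> 1 \<Longrightarrow> \<exists>C. bounded_below_surj C (id_blinfun - (cscale_op z o\<^sub>L (L 0 - rank_one \<phi> x\<^sub>0)))"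
    and exp_L: "expands n L"
begin

lemma L_cscale: "L t (cscale c x) = cscale c (L t x)"
  using L_clin[of t] by (simp add: bounded_clinear_op_def clinear_map_def)

lemma bl_phi: "bounded_linear \<phi>" and phi_cscale: "\<phi> (cscale c x) = c * \<phi> x"
  using phi by (auto simp: cdual_def)

lemmas phi_simps = linear_add[OF bounded_linear.linear[OF bl_phi]] linear_diff[OF bounded_linear.linear[OF bl_phi]]
  linear_0[OF bounded_linear.linear[OF bl_phi]] phi_cscale

text \<open>\<open>K0\<close> kills \<open>x0\<close> and agrees with \<open>L 0\<close> on the
  kernel of \<open>\<phi>\<close>; by \<open>inv\<close> the operator \<open>I - z K0\<close> is
  invertible on the whole closed unit disc.\<close>

definition K0 where "K0 = L 0 - rank_one \<phi> x\<^sub>0"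

lemma K0_apply: "K0 u = L 0 u - cscale (\<phi> u) x\<^sub>0"
  by (simp add: K0_def blinfun.diff_left rank_one_apply[OF phi])

lemma ex_uniform: "\<exists>C>0. \<forall>z. cmod z \<le> 1 \<longrightarrow> bounded_below_surj C (id_blinfun - (cscale_op z o\<^sub>L K0))"
proof -
  have "continuous_on (cball 0 1) (\<lambda>z. id_blinfun - (cscale_op z o\<^sub>L K0))"
    by (intro continuous_intros bounded_bilinear.continuous_on[OF bounded_bilinear_blinfun_compose] continuous_on_cscale_op)
  from compact_uniformly_bounded_below_surj[OF compact_cball this] show ?thesis
    using inv unfolding K0_def by (metis mem_cball_0)
qed

text \<open>The inverse of \<open>I - K0\<close>, the case \<open>z = 1\<close>, as a bounded linear
  map that can be applied to expansions.\<close>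

lemma ex_solution_operator: "\<exists>J. bounded_linear J \<and> (\<forall>u. J u - K0 (J u) = u) \<and> (\<forall>u. J (u - K0 u) = u)"
proof -
  obtain C where C: "C > 0" "bounded_below_surj C (id_blinfun - (cscale_op 1 o\<^sub>L K0))"
    using ex_uniform norm_one[where 'a=complex] by (metis order_refl)
  define B where "B = id_blinfun - (cscale_op 1 o\<^sub>L K0)"
  have B: "B u = u - K0 u" for u by (simp add: B_def blinfun.diff_left cscale_one)
  define J where "J = inv (blinfun_apply B)"
  have below: "norm u \<le> C * norm (B u)" for u using C(2) by (simp add: bounded_below_surj_def B_def)
  have BJ: "B (J u) = u" for u
    using C(2) by (simp add: J_def B_def[symmetric] bounded_below_surj_def surj_f_inv_f)
  have inj: "u = v" if "B u = B v" for u v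
  proof -
    have "norm (u - v) \<le> 0" using below[of "u - v"] that by (simp add: blinfun.diff_right)
    then show ?thesis by simp
  qed
  have JB: "J (B u) = u" for u by (rule inj) (simp add: BJ)
  have "bounded_linear J"
  proof (rule bounded_linear_intro[where K=C])
    show "J (x + y) = J x + J y" for x y by (rule inj) (simp add: BJ blinfun.add_right)
    show "J (r *\<^sub>R x) = r *\<^sub>R J x" for r x by (rule inj) (simp add: BJ blinfun.scaleR_right)
    show "norm (J x) \<le> norm x * C" for x using below[of "J x"] by (simp add: BJ mult.commute)
  qed
  then show ?thesis using BJ JB by (auto simp: B)
qed

text \<open>With \<open>h = x0 + y\<close>, \<open>\<phi> y = 0\<close> and
  \<open>\<Delta> = L t - L 0\<close>, the eigenvalue must be
  \<open>1 + \<phi> (\<Delta> h)\<close>, and the eigenvalue equation becomes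
  \<open>y - K0 y = \<Delta> h - \<phi> (\<Delta> h) h\<close>. Applying \<open>J\<close> gives a
  fixed point problem that contracts for small \<open>\<Delta>\<close>.\<close>

lemma ex_eigenvector:
  obtains h d where "d > 0" "h 0 = x\<^sub>0" "expands n h" "\<And>t. \<bar>t\<bar> \<le> d \<Longrightarrow> norm (h t) \<le> norm x\<^sub>0 + 1"
    "\<And>t. \<bar>t\<bar> \<le> d \<Longrightarrow> L t (h t) = cscale (1 + \<phi> ((L t - L 0) (h t))) (h t)" "\<And>t. \<bar>t\<bar> \<le> d \<Longrightarrow> \<phi> (h t) = 1"
proof -
  obtain J where J: "bounded_linear J" "\<And>u. J u - K0 (J u) = u" "\<And>u. J (u - K0 u) = u"
    using ex_solution_operator by blast
  obtain C where C: "C > 0" "\<And>u. norm (J u) \<le> C * norm u"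
    using bounded_linear.pos_bounded[OF J(1)] by (auto simp: mult.commute)
  obtain B where B: "B > 0" "\<And>x. cmod (\<phi> x) \<le> B * norm x" using cdual_boundE[OF phi] by blast
  define X where "X = norm x\<^sub>0 + 1"
  define \<Delta> where "\<Delta> t = L t - L 0" for t
  define F where "F t y = J (\<Delta> t (x\<^sub>0 + y) - cscale (\<phi> (\<Delta> t (x\<^sub>0 + y))) (x\<^sub>0 + y))" for t y
  \<comment> \<open>Chosen to dominate three quantities relative to
    \<open>norm (\<Delta> t)\<close>: the size of \<open>F t\<close> on the unit ball, its Lipschitz
    constant, and, through the summand \<open>B * X\<close>, the modulus of
    \<open>\<phi> (\<Delta> t h)\<close>.\<close>
  define M where "M = C * (1 + 2 * B * X) * X + B * X"
  have X: "X \<ge> 1" by (simp add: X_def)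
  have M: "M > 0" using C B X by (simp add: M_def add_pos_pos)
  have Jdiff: "J u - J v = J (u - v)" for u v by (simp add: linear_diff bounded_linear.linear[OF J(1)])
  have J0: "J 0 = 0" by (simp add: linear_0 bounded_linear.linear[OF J(1)])
  have hX: "norm (x\<^sub>0 + y) \<le> X" if "norm y \<le> 1" for y
    using norm_triangle_ineq[of x\<^sub>0 y] that by (simp add: X_def)
  have p_le: "norm (\<Delta> t (x\<^sub>0 + y)) \<le> norm (\<Delta> t) * X" if "norm y \<le> 1" for t y
    by (rule order_trans[OF norm_blinfun mult_left_mono[OF hX[OF that]]]) simp
  have phip_le: "cmod (\<phi> (\<Delta> t (x\<^sub>0 + y))) \<le> B * (norm (\<Delta> t) * X)" if "norm y \<le> 1" for t y
    by (rule order_trans[OF B(2) mult_left_mono[OF p_le[OF that]]]) (use B in simp)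
  have F_le: "norm (F t y) \<le> M * norm (\<Delta> t)" if "norm y \<le> 1" for t y
  proof -
    have "norm (cscale (\<phi> (\<Delta> t (x\<^sub>0 + y))) (x\<^sub>0 + y)) \<le> (B * (norm (\<Delta> t) * X)) * X"
      unfolding norm_cscale by (intro mult_mono phip_le hX that) (use B X in auto)
    then have "norm (\<Delta> t (x\<^sub>0 + y) - cscale (\<phi> (\<Delta> t (x\<^sub>0 + y))) (x\<^sub>0 + y)) \<le> norm (\<Delta> t) * X + (B * (norm (\<Delta> t) * X)) * X"
      using p_le[OF that, of t] norm_triangle_ineq4[of "\<Delta> t (x\<^sub>0 + y)" "cscale (\<phi> (\<Delta> t (x\<^sub>0 + y))) (x\<^sub>0 + y)"] by linarith
    then have "norm (F t y) \<le> C * (norm (\<Delta> t) * X + (B * (norm (\<Delta> t) * X)) * X)"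
      unfolding F_def using C by (intro order_trans[OF C(2)] mult_left_mono) auto
    also have "\<dots> = (C * (1 + B * X) * X) * norm (\<Delta> t)" by (simp add: algebra_simps)
    also have "\<dots> \<le> M * norm (\<Delta> t)"
      using C B X by (intro mult_right_mono) (auto simp: M_def algebra_simps)
    finally show ?thesis .
  qed
  have F_lip: "norm (F t y - F t y') \<le> (M * norm (\<Delta> t)) * norm (y - y')" if "norm y \<le> 1" "norm y' \<le> 1" for t y y'
  proof -
    define p where "p = \<Delta> t (x\<^sub>0 + y)"
    define p' where "p' = \<Delta> t (x\<^sub>0 + y')"
    have pp: "p - p' = \<Delta> t (y - y')" by (simp add: p_def p'_def blinfun.diff_right blinfun.add_right)
    have a: "norm (p - p') \<le> norm (\<Delta> t) * norm (y - y')" unfolding pp by (rule norm_blinfun)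
    have "F t y - F t y' = J ((p - p') - (cscale (\<phi> p) (y - y') + cscale (\<phi> (p - p')) (x\<^sub>0 + y')))"
      unfolding F_def Jdiff p_def[symmetric] p'_def[symmetric]
      by (rule arg_cong[where f=J]) (simp add: cscale_simps phi_simps algebra_simps)
    then have "norm (F t y - F t y') \<le> C * norm ((p - p') - (cscale (\<phi> p) (y - y') + cscale (\<phi> (p - p')) (x\<^sub>0 + y')))"
      using C(2) by simp
    also have "\<dots> \<le> C * (norm (p - p') + (cmod (\<phi> p) * norm (y - y') + cmod (\<phi> (p - p')) * norm (x\<^sub>0 + y')))"
      unfolding norm_cscale[symmetric] using C(1)
      by (intro mult_left_mono order_trans[OF norm_triangle_ineq4] add_left_mono norm_triangle_ineq) auto
    also have "\<dots> \<le> C * (norm (\<Delta> t) * norm (y - y') + ((B * (norm (\<Delta> t) * X)) * norm (y - y') + (B * (norm (\<Delta> t) * norm (y - y'))) * X))"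
    proof (intro mult_left_mono add_mono mult_right_mono mult_mono a hX that)
      show "cmod (\<phi> p) \<le> B * (norm (\<Delta> t) * X)" unfolding p_def by (rule phip_le[OF that(1)])
      show "cmod (\<phi> (p - p')) \<le> B * (norm (\<Delta> t) * norm (y - y'))"
        by (rule order_trans[OF B(2) mult_left_mono[OF a]]) (use B in simp)
    qed (use B C X in auto)
    also have "\<dots> = (C * (1 + 2 * B * X) * 1) * norm (\<Delta> t) * norm (y - y')" by (simp add: algebra_simps)
    also have "\<dots> \<le> M * norm (\<Delta> t) * norm (y - y')"
    proof (intro mult_right_mono)
      have "C * (1 + 2 * B * X) * 1 \<le> C * (1 + 2 * B * X) * X" using C B X by (intro mult_left_mono) auto
      then show "C * (1 + 2 * B * X) * 1 \<le> M" using B X by (simp add: M_def add_increasing2)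
    qed auto
    finally show ?thesis .
  qed
  have contL: "isCont L 0" using exp_L by (rule expands_imp_isCont)
  obtain d where d: "d > 0" "\<And>t. \<bar>t\<bar> \<le> d \<Longrightarrow> norm (L t - L 0) \<le> 1 / (2 * M)"
    using isCont_0_normD[OF contL, of "1 / (2 * M)"] M by auto
  have MD: "M * norm (\<Delta> t) \<le> 1/2" if "\<bar>t\<bar> \<le> d" for t
    using d(2)[OF that] M by (simp add: \<Delta>_def field_simps)
  have ex: "\<exists>y. norm y \<le> 1 \<and> F t y = y" if "\<bar>t\<bar> \<le> d" for t
  proof -
    have "\<exists>!y\<in>cball 0 1. F t y = y"
    proof (rule Banach_fix[where c="1/2"])
      show "F t ` cball 0 1 \<subseteq> cball 0 1"
        using F_le[of _ t] MD[OF that] by (force simp: subset_iff)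
      show "dist (F t x) (F t y) \<le> 1/2 * dist x y" if "x \<in> cball 0 1" "y \<in> cball 0 1" for x y
      proof -
        have "norm (F t x - F t y) \<le> (M * norm (\<Delta> t)) * norm (x - y)" using that by (intro F_lip) auto
        also have "\<dots> \<le> 1/2 * norm (x - y)" using MD[OF \<open>\<bar>t\<bar> \<le> d\<close>] by (intro mult_right_mono) auto
        finally show ?thesis by (simp add: dist_norm)
      qed
    qed (auto simp: complete_eq_closed)
    then show ?thesis by auto
  qed
  define y where "y t = (SOME y. norm y \<le> 1 \<and> F t y = y)" for t
  have y: "norm (y t) \<le> 1" "F t (y t) = y t" if "\<bar>t\<bar> \<le> d" for t
    using someI_ex[OF ex[OF that]] by (auto simp: y_def)
  define h where "h t = x\<^sub>0 + y t" for t
  have "\<Delta> 0 = 0" by (simp add: \<Delta>_def)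
  then have y0: "y 0 = 0" using F_le[of "y 0" 0] y[of 0] d(1) by simp
  have y_h: "y t = J (\<Delta> t (h t) - cscale (\<phi> (\<Delta> t (h t))) (h t))" if "\<bar>t\<bar> \<le> d" for t
    using y(2)[OF that] by (simp add: F_def h_def)
  have eig: "L t (h t) = cscale (1 + \<phi> (\<Delta> t (h t))) (h t) \<and> \<phi> (h t) = 1" if t: "\<bar>t\<bar> \<le> d" for t
  proof -
    define p where "p = \<Delta> t (h t)"
    have "cmod (\<phi> p) \<le> B * (norm (\<Delta> t) * X)" unfolding p_def h_def by (rule phip_le[OF y(1)[OF t]])
    also have "\<dots> = (B * X) * norm (\<Delta> t)" by simp
    also have "\<dots> \<le> M * norm (\<Delta> t)" using C B X by (intro mult_right_mono) (auto simp: M_def)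
    also have "\<dots> \<le> 1/2" by (rule MD[OF t])
    finally have "cmod (\<phi> p) \<le> 1/2" .
    have ne: "1 + \<phi> p \<noteq> 0" 
    proof
      assume "1 + \<phi> p = 0"
      then have "\<phi> p = - 1" by (simp add: add_eq_0_iff)
      then show False using \<open>cmod (\<phi> p) \<le> 1/2\<close> by simp
    qed
    have eq: "y t - K0 (y t) = p - cscale (\<phi> p) (h t)"
      using J(2)[of "p - cscale (\<phi> p) (h t)"] y_h[OF t] by (simp add: p_def)
    \<comment> \<open>The fixed point is not assumed to satisfy \<open>\<phi> y = 0\<close>.
      Applying \<open>\<phi>\<close> to its equation gives
      \<open>\<phi> y * (1 + \<phi> p) = 0\<close>, and the second factor is nonzero.\<close>
    then have "\<phi> (y t - K0 (y t)) = \<phi> (p - cscale (\<phi> p) (h t))" by simp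
    then have "\<phi> (y t) = - (\<phi> p * \<phi> (y t))"
      by (simp add: K0_apply phi_simps phi_L0 phi_x0 h_def algebra_simps)
    then have "\<phi> (y t) + \<phi> p * \<phi> (y t) = 0" by (rule eq_neg_iff_add_eq_0[THEN iffD1])
    then have "\<phi> (y t) * (1 + \<phi> p) = 0" by (simp add: algebra_simps)
    then have phiy: "\<phi> (y t) = 0" using ne by simp
    then have "y t - L 0 (y t) = p - cscale (\<phi> p) (h t)" using eq by (simp add: K0_apply cscale_simps)
    moreover have "L t (h t) = x\<^sub>0 + L 0 (y t) + p"
      by (simp add: p_def \<Delta>_def blinfun.diff_left) (simp add: h_def blinfun.add_right L0_x0)
    ultimately have "L t (h t) = h t + cscale (\<phi> p) (h t)"
      by (simp add: h_def algebra_simps)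
    moreover have "\<phi> (h t) = 1" by (simp add: h_def phi_simps phiy phi_x0)
    ultimately show ?thesis by (simp add: p_def cscale_simps)
  qed
  have ev_d: "\<forall>\<^sub>F t in nhds 0. \<bar>t\<bar> \<le> d"
    using d(1) unfolding eventually_nhds_metric by (intro exI[of _ d]) (simp add: dist_norm)
  have "expands k y" if "k \<le> n" for k
    using that
  proof (induction k)
    case 0
    have "isCont y 0"
    proof (rule isCont_0_normI)
      have "((\<lambda>t. M * norm (L t - L 0)) \<longlongrightarrow> M * norm (L 0 - L 0)) (nhds 0)"
        by (intro tendsto_intros) (use contL in \<open>simp add: isCont_def tendsto_at_iff_tendsto_nhds\<close>)
      then show "((\<lambda>t. M * norm (L t - L 0)) \<longlongrightarrow> 0) (nhds 0)" by simp
      show "\<forall>\<^sub>F t in nhds 0. norm (y t - y 0) \<le> M * norm (L t - L 0)"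
        using ev_d by (rule eventually_mono) (metis F_le y y0 \<Delta>_def diff_zero)
    qed
    then show ?case by simp
  next
    \<comment> \<open>The bootstrap: \<open>\<Delta> t = t *\<^sub>R L1 t\<close> pulls a factor
      \<open>t\<close> out of the fixed point equation, so order \<open>k\<close> of
      \<open>y\<close> on the right gives order \<open>k + 1\<close> on the left.\<close>
    case (Suc k)
    then have yk: "expands k y" by simp
    have hk: "expands k h" unfolding h_def by (rule expands_add[OF expands_const yk])
    have "expands (Suc k) L" using expands_mono[OF exp_L Suc.prems] .
    then obtain L1 where L1: "expands k L1" "\<forall>\<^sub>F t in nhds 0. L t = L 0 + t *\<^sub>R L1 t" by auto
    have Lh: "expands k (\<lambda>t. L1 t (h t))" by (rule expands_blinfun_apply[OF L1(1) hk])
    have "expands k (\<lambda>t. J (L1 t (h t) - cscale (\<phi> (L1 t (h t))) (h t)))"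
      by (rule expands_bounded_linear[OF J(1) expands_diff[OF Lh expands_cscale[OF expands_bounded_linear[OF bl_phi Lh] hk]]])
    moreover have "\<forall>\<^sub>F t in nhds 0. y t = 0 + t *\<^sub>R J (L1 t (h t) - cscale (\<phi> (L1 t (h t))) (h t))"
    proof (rule eventually_mono[OF eventually_conj[OF ev_d L1(2)]])
      fix t assume t: "\<bar>t\<bar> \<le> d \<and> L t = L 0 + t *\<^sub>R L1 t"
      then have "\<Delta> t = t *\<^sub>R L1 t" by (simp add: \<Delta>_def)
      then show "y t = 0 + t *\<^sub>R J (L1 t (h t) - cscale (\<phi> (L1 t (h t))) (h t))"
        using y_h[of t] t by (simp add: blinfun.scaleR_left linear_scale[OF bounded_linear.linear[OF bl_phi]]
            linear_scale[OF bounded_linear.linear[OF J(1)], symmetric] scaleR_diff_right cscale.scaleR_left)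
    qed
    ultimately show ?case by (rule expands_SucI)
  qed
  then have "expands n h" unfolding h_def by (intro expands_add[OF expands_const]) simp
  moreover have "norm (h t) \<le> norm x\<^sub>0 + 1" if "\<bar>t\<bar> \<le> d" for t
    using hX[OF y(1)[OF that]] by (simp add: h_def X_def)
  ultimately show ?thesis
    using that[of d h] d(1) y0 eig by (simp add: h_def \<Delta>_def)
qed

text \<open>Writing \<open>T = K + \<phi> (T _) h\<close> with \<open>T h = lam h\<close>, the
  coefficient of \<open>h\<close> in \<open>T^N v\<close> obeys
  \<open>c_{N+1} = lam * c_N + \<phi> (T (K^N v))\<close>. Substituting
  \<open>v = lam x - K x\<close> makes this recursion telescope into a closed form.\<close>

lemma funpow_rank_one_correction:
  assumes Kd: "\<And>u. K u = T u - cscale (\<phi> (T u)) h"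
    and eig: "T h = cscale lam h" and lam: "\<phi> (T h) = lam"
    and x: "cscale lam x - K x = v"
    and T: "linear T" "\<And>c u. T (cscale c u) = cscale c (T u)"
  shows "(T ^^ N) v = (K ^^ N) v + cscale (lam ^ N * \<phi> (T x) - \<phi> (T ((K ^^ N) x))) h"
proof -
  have K: "linear K" "\<And>c u. K (cscale c u) = cscale c (K u)"
  proof -
    show "linear K"
    proof (rule linearI)
      show "K (a + b) = K a + K b" for a b
        by (simp add: Kd linear_add[OF T(1)] phi_simps cscale_simps)
      show "K (r *\<^sub>R a) = r *\<^sub>R K a" for r a
        by (simp add: Kd linear_scale[OF T(1)] linear_scale[OF bounded_linear.linear[OF bl_phi]] scaleR_diff_right cscale.scaleR_left)
    qed
    show "K (cscale c u) = cscale c (K u)" for c u by (simp add: Kd T(2) phi_simps cscale_simps)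
  qed
  have Kn: "(K ^^ N) (cscale c a - b) = cscale c ((K ^^ N) a) - (K ^^ N) b" for N c a b
    by (induction N) (simp_all add: K(2) linear_diff[OF K(1)])
  show ?thesis
  proof (induction N)
    case 0
    show ?case using x by (simp add: cscale_simps)
  next
    case (Suc N)
    define w where "w = (K ^^ N) x"
    have vN: "(K ^^ N) v = cscale lam w - K w"
      unfolding x[symmetric] Kn w_def by (simp add: funpow_swap1)
    have "(T ^^ Suc N) v = T ((K ^^ N) v) + cscale (lam ^ N * \<phi> (T x) - \<phi> (T w)) (cscale lam h)"
      by (simp add: Suc.IH linear_add[OF T(1)] T(2) eig w_def)
    also have "T ((K ^^ N) v) = (K ^^ Suc N) v + cscale (\<phi> (T ((K ^^ N) v))) h" by (simp add: Kd)
    also have "\<phi> (T ((K ^^ N) v)) = lam * \<phi> (T w) - \<phi> (T (K w))"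
      unfolding vN by (simp add: linear_diff[OF T(1)] T(2) phi_simps)
    finally show ?case by (simp add: w_def cscale_simps algebra_simps)
  qed
qed

text \<open>With \<open>x t\<close> solving \<open>lam x - K x = v\<close>, the closed form for the
  powers isolates \<open>lam t ^ N * z t\<close>, where
  \<open>z t = \<phi> (L t (x t)) * l (h t)\<close>. All other terms contain only powers of
  \<open>K t\<close>, whose generating function is regular on a disc of radius
  \<open>R > 1\<close>.\<close>

theorem spectral_expansion:
  assumes l: "cdual l"
  obtains lam z d R C where "expands n lam" "lam 0 = 1" "expands n z" "d > 0" "R > 1" "C \<ge> 0"
    "\<And>t N. \<bar>t\<bar> \<le> d \<Longrightarrow> cmod (l ((blinfun_apply (L t) ^^ N) v) - lam t ^ N * z t) \<le> C / R ^ N"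
proof -
  obtain h d1 where h: "d1 > 0" "h 0 = x\<^sub>0" "expands n h" "\<And>t. \<bar>t\<bar> \<le> d1 \<Longrightarrow> norm (h t) \<le> norm x\<^sub>0 + 1"
    "\<And>t. \<bar>t\<bar> \<le> d1 \<Longrightarrow> L t (h t) = cscale (1 + \<phi> ((L t - L 0) (h t))) (h t)" "\<And>t. \<bar>t\<bar> \<le> d1 \<Longrightarrow> \<phi> (h t) = 1"
    using ex_eigenvector by blast
  obtain J where J: "bounded_linear J" "\<And>u. J u - K0 (J u) = u" "\<And>u. J (u - K0 u) = u"
    using ex_solution_operator by blast
  obtain C where C: "C > 0" "\<And>z. cmod z \<le> 1 \<Longrightarrow> bounded_below_surj C (id_blinfun - (cscale_op z o\<^sub>L K0))"
    using ex_uniform by blast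
  obtain B where B: "B > 0" "\<And>x. cmod (\<phi> x) \<le> B * norm x" using cdual_boundE[OF phi] by blast
  obtain Bl where Bl: "Bl > 0" "\<And>x. cmod (l x) \<le> Bl * norm x" using cdual_boundE[OF l] by blast
  define lam where "lam t = 1 + \<phi> ((L t - L 0) (h t))" for t
  \<comment> \<open>\<open>L t\<close> followed by the projection along \<open>h t\<close> onto the
    kernel of \<open>\<phi>\<close>. It annihilates \<open>h t\<close>, and at \<open>t = 0\<close>
    it is \<open>K0\<close> because \<open>\<phi>\<close> is invariant under
    \<open>L 0\<close>.\<close>
  define K where "K t = L t - (rank_one \<phi> (h t) o\<^sub>L L t)" for t
  have K_apply: "K t u = L t u - cscale (\<phi> (L t u)) (h t)" for t u
    by (simp add: K_def blinfun.diff_left rank_one_apply[OF phi])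
  have lam_exp: "expands n lam"
    unfolding lam_def
    by (rule expands_add[OF expands_const expands_bounded_linear[OF bl_phi
        expands_blinfun_apply[OF expands_diff[OF exp_L expands_const] h(3)]]])
  have lam0: "lam 0 = 1" by (simp add: lam_def phi_simps)
  have K_exp: "expands n K"
    unfolding K_def
    by (rule expands_diff[OF exp_L expands_bounded_bilinear[OF bounded_bilinear_blinfun_compose
        expands_bounded_linear[OF bounded_linear_rank_one[OF phi] h(3)] exp_L]])
  have K_0: "K 0 = K0"
    by (rule blinfun_eqI) (simp add: K_apply K0_apply h(2) phi_L0)
  obtain d2 where d2: "d2 > 0" "\<And>t. \<bar>t\<bar> \<le> d2 \<Longrightarrow> norm (K t - K0) \<le> min 1 (1 / (2 * C))"
    using isCont_0_normD[OF expands_imp_isCont[OF K_exp], of "min 1 (1 / (2 * C))"] C(1) unfolding K_0 by auto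
  obtain d3 where d3: "d3 > 0" "\<And>t. \<bar>t\<bar> \<le> d3 \<Longrightarrow> norm (L t - L 0) \<le> 1"
    using isCont_0_normD[OF expands_imp_isCont[OF exp_L], of 1] by auto
  \<comment> \<open>Solves \<open>2 * (2 * C) * (R - 1) * (norm K0 + 1) = 1\<close>, the condition
    for enlarging the disc with constant \<open>2 * C\<close> and
    \<open>norm (K t) \<le> norm K0 + 1\<close>.\<close>
  define R where "R = 1 + 1 / (4 * C * (norm K0 + 1))"
  have R: "R > 1" using C(1) by (simp add: R_def add_nonneg_pos)
  \<comment> \<open>The modulus of \<open>1 / lam t\<close> may exceed 1, but for small
    \<open>t\<close> it stays below \<open>R\<close>; hence \<open>lam t - K t\<close> is still
    invertible.\<close>
  have "isCont (\<lambda>t. inverse (lam t)) 0"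
    using expands_imp_isCont[OF lam_exp] lam0 by (intro continuous_intros) auto
  from isCont_0_normD[OF this, of "R - 1"] R
  obtain d4 where d4: "d4 > 0" "\<And>t. \<bar>t\<bar> \<le> d4 \<Longrightarrow> cmod (inverse (lam t) - 1) \<le> R - 1"
    by (auto simp: lam0)
  obtain d5 where d5: "d5 > 0" "\<And>t. \<bar>t\<bar> \<le> d5 \<Longrightarrow> cmod (lam t - 1) \<le> 1/2"
    using isCont_0_normD[OF expands_imp_isCont[OF lam_exp], of "1/2"] by (auto simp: lam0)
  define d where "d = min d1 (min d2 (min d3 (min d4 d5)))"
  have d0: "d > 0" using h(1) d2 d3 d4 d5 by (simp add: d_def)
  have inv1: "bounded_below_surj (2 * C) (id_blinfun - (cscale_op z o\<^sub>L K t))" if t: "\<bar>t\<bar> \<le> d" and z: "cmod z \<le> 1" for t z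
  proof (rule bounded_below_surj_perturb[OF C(2)[OF z]])
    have "(id_blinfun - (cscale_op z o\<^sub>L K t)) - (id_blinfun - (cscale_op z o\<^sub>L K0)) = - (cscale_op z o\<^sub>L (K t - K0))"
      by (rule blinfun_eqI) (simp add: blinfun.diff_left blinfun.minus_left cscale_simps)
    then have "norm ((id_blinfun - (cscale_op z o\<^sub>L K t)) - (id_blinfun - (cscale_op z o\<^sub>L K0))) = norm (cscale_op z o\<^sub>L (K t - K0))"
      by (simp only: norm_minus_cancel)
    also have "\<dots> \<le> norm (cscale_op z :: 'a \<Rightarrow>\<^sub>L 'a) * norm (K t - K0)" by (rule norm_blinfun_compose)
    also have "\<dots> \<le> 1 * (1 / (2 * C))"
      using d2(2)[of t] t z by (intro mult_mono order_trans[OF norm_cscale_op_le]) (auto simp: d_def)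
    finally show "C * norm ((id_blinfun - (cscale_op z o\<^sub>L K t)) - (id_blinfun - (cscale_op z o\<^sub>L K0))) \<le> 1/2"
      using C(1) by (simp add: field_simps)
  qed (use C in simp)
  have inv2: "bounded_below_surj (4 * C) (id_blinfun - (cscale_op z o\<^sub>L K t))" if t: "\<bar>t\<bar> \<le> d" and z: "cmod z \<le> R" for t z
  proof -
    have "norm (K t) \<le> norm K0 + 1"
      using d2(2)[of t] t norm_triangle_ineq2[of "K t" K0] by (simp add: d_def)
    then have "4 * C * (R - 1) * norm (K t) \<le> 4 * C * (R - 1) * (norm K0 + 1)"
      using C(1) R by (intro mult_left_mono) auto
    also have "\<dots> = 1"
    proof -
      have "norm K0 + 1 \<noteq> 0" by (smt (verit) norm_ge_zero)
      then show ?thesis using C(1) by (simp add: R_def)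
    qed
    finally have "2 * (2 * C) * (R - 1) * norm (K t) \<le> 1" by (simp add: mult_ac)
    from bounded_below_surj_larger_disc[of "2 * C" "K t" R z, OF inv1[OF t] _ _ this z] show ?thesis
      using C(1) R by simp
  qed
  have ex_x: "\<exists>x. cscale (lam t) x - K t x = v \<and> norm x \<le> 4 * C * (R * norm v)" if t: "\<bar>t\<bar> \<le> d" for t
  proof -
    define w where "w = inverse (lam t)"
    have lne: "lam t \<noteq> 0"
    proof
      assume "lam t = 0"
      then show False using d5(2)[of t] t by (simp add: d_def)
    qed
    have w: "cmod w \<le> R" using d4(2)[of t] t norm_triangle_ineq2[of w 1] by (simp add: w_def d_def)
    obtain x where x: "(id_blinfun - (cscale_op w o\<^sub>L K t)) x = cscale w v"
      using inv2[OF t w] unfolding bounded_below_surj_def by (metis surj_def)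
    then have "cscale w v = x - cscale w (K t x)" by (simp add: blinfun.diff_left)
    then have "cscale (lam t) (cscale w v) = cscale (lam t) (x - cscale w (K t x))" by simp
    then have 1: "cscale (lam t) x - K t x = v" using lne by (simp add: w_def cscale_simps)
    have "norm x \<le> 4 * C * norm (cscale w v)"
      using inv2[OF t w] unfolding bounded_below_surj_def x[symmetric] by blast
    also have "\<dots> \<le> 4 * C * (R * norm v)"
      unfolding norm_cscale using C(1) w by (intro mult_left_mono mult_right_mono) auto
    finally show ?thesis using 1 by blast
  qed
  define X where "X = 4 * C * (R * norm v)"
  define x where "x t = (SOME x. cscale (lam t) x - K t x = v \<and> norm x \<le> X)" for t
  have x: "cscale (lam t) (x t) - K t (x t) = v" "norm (x t) \<le> X" if "\<bar>t\<bar> \<le> d" for t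
    using someI_ex[OF ex_x[OF that]] by (auto simp: x_def X_def)
  have X0: "X \<ge> 0" using C(1) R by (simp add: X_def)
  have ev_d: "\<forall>\<^sub>F t in nhds 0. \<bar>t\<bar> \<le> d"
    using d0 unfolding eventually_nhds_metric by (intro exI[of _ d]) (simp add: dist_norm)
  \<comment> \<open>The resolvent equation rearranged around \<open>t = 0\<close>. With the uniform
    bound \<open>X\<close> it gives continuity of \<open>x\<close>, and the small factors
    \<open>K t - K0\<close> and \<open>lam t - 1\<close> then drive the same bootstrap as for the
    eigenvector.\<close>
  have x_J: "x t = J v + J ((K t - K0) (x t) - cscale (lam t - 1) (x t))" if "\<bar>t\<bar> \<le> d" for t
  proof -
    have "x t - K0 (x t) = (cscale (lam t) (x t) - K t (x t)) + ((K t - K0) (x t) - cscale (lam t - 1) (x t))"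
      by (simp add: blinfun.diff_left cscale_simps)
    then have "x t = J (v + ((K t - K0) (x t) - cscale (lam t - 1) (x t)))"
      using J(3)[of "x t"] x(1)[OF that] by simp
    then show ?thesis by (simp only: linear_add[OF bounded_linear.linear[OF J(1)]])
  qed
  have Jlin: "linear J" by (rule bounded_linear.linear[OF J(1)])
  have "expands k x" if "k \<le> n" for k
    using that
  proof (induction k)
    case 0
    obtain CJ where CJ: "CJ > 0" "\<And>u. norm (J u) \<le> CJ * norm u"
      using bounded_linear.pos_bounded[OF J(1)] by (auto simp: mult.commute)
    have x0: "x 0 = J v" using x_J[of 0] d0 by (simp add: K_0 lam0 cscale_simps linear_0[OF Jlin])
    have "isCont x 0"
    proof (rule isCont_0_normI)
      have cK: "(K \<longlongrightarrow> K 0) (nhds 0)" and cl: "(lam \<longlongrightarrow> lam 0) (nhds 0)"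
        using expands_imp_isCont[OF K_exp] expands_imp_isCont[OF lam_exp]
        by (simp_all add: isCont_def tendsto_at_iff_tendsto_nhds)
      have "((\<lambda>t. CJ * (norm (K t - K0) * X + cmod (lam t - 1) * X)) \<longlongrightarrow> CJ * (norm (K 0 - K0) * X + cmod (lam 0 - 1) * X)) (nhds 0)"
        by (intro tendsto_intros cK cl)
      then show "((\<lambda>t. CJ * (norm (K t - K0) * X + cmod (lam t - 1) * X)) \<longlongrightarrow> 0) (nhds 0)" by (simp add: K_0 lam0)
      show "\<forall>\<^sub>F t in nhds 0. norm (x t - x 0) \<le> CJ * (norm (K t - K0) * X + cmod (lam t - 1) * X)"
        using ev_d
      proof (rule eventually_mono)
        fix t assume t: "\<bar>t\<bar> \<le> d"
        have "x t - x 0 = J ((K t - K0) (x t) - cscale (lam t - 1) (x t))" using x_J[OF t] x0 by (metis add_diff_cancel_left')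
        then have "norm (x t - x 0) \<le> CJ * norm ((K t - K0) (x t) - cscale (lam t - 1) (x t))" using CJ(2) by metis
        also have "\<dots> \<le> CJ * (norm ((K t - K0) (x t)) + norm (cscale (lam t - 1) (x t)))"
          using CJ(1) by (intro mult_left_mono norm_triangle_ineq4) auto
        also have "\<dots> \<le> CJ * (norm (K t - K0) * X + cmod (lam t - 1) * X)"
          unfolding norm_cscale using CJ(1)
          by (intro mult_left_mono add_mono order_trans[OF norm_blinfun] x(2)[OF t]) auto
        finally show "norm (x t - x 0) \<le> CJ * (norm (K t - K0) * X + cmod (lam t - 1) * X)" .
      qed
    qed
    then show ?case by simp
  next
    case (Suc k)
    then have xk: "expands k x" by simp
    obtain K1 where K1: "expands k K1" "\<forall>\<^sub>F t in nhds 0. K t = K 0 + t *\<^sub>R K1 t"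
      using expands_mono[OF K_exp Suc.prems] by auto
    obtain l1 where l1: "expands k l1" "\<forall>\<^sub>F t in nhds 0. lam t = lam 0 + t *\<^sub>R l1 t"
      using expands_mono[OF lam_exp Suc.prems] by auto
    have "expands k (\<lambda>t. J (K1 t (x t) - cscale (l1 t) (x t)))"
      by (rule expands_bounded_linear[OF J(1) expands_diff[OF expands_blinfun_apply[OF K1(1) xk] expands_cscale[OF l1(1) xk]]])
    moreover have "\<forall>\<^sub>F t in nhds 0. x t = J v + t *\<^sub>R J (K1 t (x t) - cscale (l1 t) (x t))"
    proof (rule eventually_mono[OF eventually_conj[OF ev_d eventually_conj[OF K1(2) l1(2)]]])
      fix t assume t: "\<bar>t\<bar> \<le> d \<and> K t = K 0 + t *\<^sub>R K1 t \<and> lam t = lam 0 + t *\<^sub>R l1 t"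
      then have "K t - K0 = t *\<^sub>R K1 t" "lam t - 1 = t *\<^sub>R l1 t" by (simp_all add: K_0 lam0)
      then have "(K t - K0) (x t) - cscale (lam t - 1) (x t) = t *\<^sub>R (K1 t (x t) - cscale (l1 t) (x t))"
        by (simp add: blinfun.scaleR_left scaleR_diff_right cscale.scaleR_left)
      then show "x t = J v + t *\<^sub>R J (K1 t (x t) - cscale (l1 t) (x t))"
        using x_J[of t] t by (simp add: linear_scale[OF Jlin])
    qed
    ultimately show ?case by (rule expands_SucI)
  qed
  then have x_exp: "expands n x" by simp
  have bl_l: "bounded_linear l" and l_c: "\<And>c u. l (cscale c u) = c * l u"
    using l by (auto simp: cdual_def)
  define z where "z t = \<phi> (L t (x t)) * l (h t)" for t
  have z_exp: "expands n z"
    unfolding z_def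
    by (rule expands_mult[OF expands_bounded_linear[OF bl_phi expands_blinfun_apply[OF exp_L x_exp]] expands_bounded_linear[OF bl_l h(3)]])
  define M where "M = norm (L 0) + 1"
  define Y where "Y = norm x\<^sub>0 + 1"
  define E where "E = Bl * (4 * C) * norm v + (B * M) * (4 * C) * X * (Bl * Y)"
  have E0: "E \<ge> 0" using C(1) B(1) Bl(1) X0 by (simp add: E_def M_def Y_def)
  have "cmod (l ((blinfun_apply (L t) ^^ N) v) - lam t ^ N * z t) \<le> E / R ^ N" if t: "\<bar>t\<bar> \<le> d" for t N
  proof -
    have clinK: "bounded_clinear_op (K t)"
      by (auto simp: bounded_clinear_op_def clinear_map_def K_apply L_cscale phi_simps cscale_simps)
    have eig: "L t (h t) = cscale (lam t) (h t)" using h(5)[of t] t by (simp add: lam_def d_def)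
    have lam: "\<phi> (L t (h t)) = lam t"
    proof -
      have "\<phi> (L t (h t)) = \<phi> (L 0 (h t)) + \<phi> ((L t - L 0) (h t))"
        by (simp add: blinfun.diff_left phi_simps)
      then show ?thesis using h(6)[of t] t by (simp add: phi_L0 lam_def d_def)
    qed
    have "(blinfun_apply (L t) ^^ N) v = (blinfun_apply (K t) ^^ N) v
        + cscale (lam t ^ N * \<phi> (L t (x t)) - \<phi> (L t ((blinfun_apply (K t) ^^ N) (x t)))) (h t)"
      by (rule funpow_rank_one_correction[OF K_apply eig lam x(1)[OF t]])
        (auto intro: bounded_linear.linear blinfun.bounded_linear_right simp: L_cscale)
    then have "l ((blinfun_apply (L t) ^^ N) v) - lam t ^ N * z t
        = l ((blinfun_apply (K t) ^^ N) v) - \<phi> (L t ((blinfun_apply (K t) ^^ N) (x t))) * l (h t)"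
      by (simp add: linear_add[OF bounded_linear.linear[OF bl_l]] l_c z_def algebra_simps)
    then have "cmod (l ((blinfun_apply (L t) ^^ N) v) - lam t ^ N * z t)
        \<le> cmod (l ((blinfun_apply (K t) ^^ N) v)) + cmod (\<phi> (L t ((blinfun_apply (K t) ^^ N) (x t)))) * cmod (l (h t))"
      by (metis norm_triangle_ineq4 norm_mult)
    also have "\<dots> \<le> Bl * (4 * C) * norm v / R ^ N + (B * M) * (4 * C) * X / R ^ N * (Bl * Y)"
    proof (intro add_mono mult_mono)
      show "cmod (l ((blinfun_apply (K t) ^^ N) v)) \<le> Bl * (4 * C) * norm v / R ^ N"
        using power_bound_off_spectrum[OF clinK l Bl(2) _ inv2[OF t]] Bl(1) C(1) R by simp
      have "cmod (\<phi> (L t ((blinfun_apply (K t) ^^ N) (x t)))) \<le> (B * M) * (4 * C) * norm (x t) / R ^ N"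
      proof (rule power_bound_off_spectrum[OF clinK _ _ _ inv2[OF t]])
        show "cdual (\<lambda>u. \<phi> (L t u))"
          using bounded_linear_compose[OF bl_phi blinfun.bounded_linear_right] by (simp add: cdual_def L_cscale phi_simps)
        have LM: "norm (L t) \<le> M" using d3(2)[of t] t norm_triangle_ineq2[of "L t" "L 0"] by (simp add: M_def d_def)
        show "cmod (\<phi> (L t u)) \<le> B * M * norm u" for u
        proof -
          have "norm (L t u) \<le> M * norm u" by (rule order_trans[OF norm_blinfun mult_right_mono[OF LM]]) simp
          then have "B * norm (L t u) \<le> B * (M * norm u)" using B(1) by (intro mult_left_mono) auto
          then show ?thesis using B(2)[of "L t u"] by simp
        qed
      qed (use B(1) C(1) R in \<open>auto simp: M_def\<close>)
      also have "\<dots> \<le> (B * M) * (4 * C) * X / R ^ N"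
        using x(2)[OF t] B(1) C(1) R by (intro divide_right_mono mult_left_mono) (auto simp: M_def)
      finally show "cmod (\<phi> (L t ((blinfun_apply (K t) ^^ N) (x t)))) \<le> (B * M) * (4 * C) * X / R ^ N" .
      have "Bl * norm (h t) \<le> Bl * Y" using h(4)[of t] t Bl(1) by (intro mult_left_mono) (auto simp: Y_def d_def)
      then show "cmod (l (h t)) \<le> Bl * Y" using Bl(2)[of "h t"] by simp
    qed (use B(1) C(1) R X0 in \<open>auto simp: M_def\<close>)
    also have "\<dots> = E / R ^ N" by (simp add: E_def add_divide_distrib)
    finally show ?thesis .
  qed
  then show ?thesis using that[OF lam_exp lam0 z_exp d0 R E0] by blast
qed

end

section \<open>Identification of the eigenvalue and expansion of the integrand\<close>

text \<open>The value \<open>s = 1\<close> makes \<open>w\<close> purely imaginary, and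
  \<open>s = pi / |Im w|\<close> would then give the exponential the value -1.\<close>

lemma exp_real_multiples_eq_1_imp_0:
  fixes w :: complex
  assumes "\<And>s::real. s \<ge> 0 \<Longrightarrow> exp (of_real s * w) = 1"
  shows "w = 0"
proof -
  have Re: "Re w = 0" using assms[of 1] by (simp add: exp_eq_1)
  have "Im w = 0"
  proof (rule ccontr)
    assume ne: "Im w \<noteq> 0"
    then obtain n :: int where n: "pi / \<bar>Im w\<bar> * Im w = of_int (2 * n) * pi"
      using assms[of "pi / \<bar>Im w\<bar>"] by (auto simp: exp_eq_1)
    then have "of_int (2 * n) * pi = pi \<or> of_int (2 * n) * pi = - pi"
      using ne by (auto simp: abs_if split: if_splits)
    then have "of_int (2 * n) = (1::real) \<or> of_int (2 * n) = (-1::real)"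
      by (metis mult_1 mult_cancel_right mult_minus_left pi_neq_zero)
    then have "2 * n = 1 \<or> 2 * n = -1" by linarith
    then show False by presburger
  qed
  then show ?thesis using Re by (simp add: complex_eq_iff)
qed

text \<open>A limit \<open>E\<close> of \<open>exp (b u \<surd>N)\<close> along the squares \<open>N = m\<^sup>2\<close> satisfies
  \<open>E * exp (b u) = E\<close>, which forces \<open>b = 0\<close>.\<close>

lemma limit_exp_sqrt_imp_0:
  fixes b :: complex and E :: "real \<Rightarrow> complex"
  assumes lim: "\<And>u. (\<lambda>N. exp (of_real (u * sqrt (real N)) * b)) \<longlonglongrightarrow> E u" and ne: "\<And>u. E u \<noteq> 0"
  shows "b = 0"
proof (rule exp_real_multiples_eq_1_imp_0)
  fix s :: real
  have sq: "strict_mono (\<lambda>m::nat. m ^ 2)" by (simp add: strict_mono_def power_strict_mono)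
  have 1: "(\<lambda>m. exp (of_real (s * real m) * b)) \<longlonglongrightarrow> E s"
    using LIMSEQ_subseq_LIMSEQ[OF lim[of s] sq] by (simp add: o_def)
  have "(\<lambda>m. exp (of_real (s * real (Suc m)) * b) / exp (of_real (s * real m) * b)) \<longlonglongrightarrow> E s / E s"
    by (intro tendsto_divide LIMSEQ_Suc[OF 1] 1 ne)
  moreover have "exp (of_real (s * real (Suc m)) * b) / exp (of_real (s * real m) * b) = exp (of_real s * b)" for m
    by (simp add: exp_diff[symmetric] algebra_simps)
  ultimately have "(\<lambda>m::nat. exp (of_real s * b)) \<longlonglongrightarrow> 1" using ne by simp
  then show "exp (of_real s * b) = 1" by (simp add: LIMSEQ_const_iff)
qed

lemma tendsto_div_sqrt_0: "(\<lambda>N. u / sqrt (real N)) \<longlonglongrightarrow> 0"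
  by real_asymp

lemma filterlim_expands_at_div_sqrt:
  assumes "expands n f"
  shows "(\<lambda>N. f (u / sqrt (real N))) \<longlonglongrightarrow> f 0"
  by (rule isCont_tendsto_compose[OF expands_imp_isCont[OF assms] tendsto_div_sqrt_0])

lemma eventually_at_div_sqrt:
  assumes "\<forall>\<^sub>F t in nhds 0. P t"
  shows "\<forall>\<^sub>F N in sequentially. P (u / sqrt (real N))"
  using eventually_compose_filterlim[OF assms tendsto_div_sqrt_0] .

text \<open>The central limit theorem determines the first two terms in the expansion of the
  logarithm of the leading eigenvalue.\<close>

lemma clt_imp_log_expansion:
  fixes \<kappa> z :: "real \<Rightarrow> complex" and \<Phi> :: "nat \<Rightarrow> real \<Rightarrow> complex"
  assumes kexp: "expands (r + 2) \<kappa>" and k0: "\<kappa> 0 = 1" and zexp: "expands r z"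
    and d: "d > 0" and R: "R > 1"
    and approx: "\<And>t N. \<bar>t\<bar> \<le> d \<Longrightarrow> N \<ge> 1 \<Longrightarrow> cmod (\<Phi> N t - \<kappa> t ^ N * z t) \<le> C / R ^ N"
    and clt: "\<And>u. (\<lambda>N. exp (- \<i> * of_real (u * A * sqrt (real N))) * \<Phi> N (u / sqrt (real N)))
      \<longlonglongrightarrow> of_real (exp (- s * u\<^sup>2 / 2))"
  obtains g d' where "expands r g" "g 0 = 0" "d' > 0"
    "\<And>t. \<bar>t\<bar> \<le> d' \<Longrightarrow> \<kappa> t = exp (\<i> * of_real (A * t) - of_real (s * t\<^sup>2 / 2) + of_real (t\<^sup>2) * g t)"
proof -
  define \<mu> where "\<mu> t = \<kappa> t * exp (- \<i> * of_real (A * t))" for t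
  have "expands (r + 2) (\<lambda>t. exp (- \<i> * of_real (A * t)))"
    using expands_of_real_exp[of "r + 2" "- \<i> * of_real A"] by (simp add: mult.assoc)
  then have mexp: "expands (r + 2) \<mu>" unfolding \<mu>_def by (rule expands_mult[OF kexp])
  have m0: "\<mu> 0 = 1" by (simp add: \<mu>_def k0)
  define Q where "Q t = Ln (\<mu> t)" for t
  \<comment> \<open>The principal logarithm is holomorphic near \<open>\<mu> 0 = 1\<close>. The two
    divisions by \<open>t\<close> that follow reduce the order from \<open>r + 2\<close> to
    \<open>r\<close>.\<close>
  have "expands (Suc (Suc r)) Q"
    unfolding Q_def
    by (rule expands_holomorphic_compose[of "- \<real>\<^sub>\<le>\<^sub>0"]) (use mexp m0 in \<open>auto intro!: holomorphic_intros simp: open_Compl\<close>)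
  then obtain Q1 where Q1: "expands (Suc r) Q1" "\<forall>\<^sub>F t in nhds 0. Q t = Q 0 + t *\<^sub>R Q1 t"
    by auto
  define b where "b = Q1 0"
  obtain Q2 where Q2: "expands r Q2" "\<forall>\<^sub>F t in nhds 0. Q1 t = b + t *\<^sub>R Q2 t"
    using Q1(1) unfolding b_def by auto
  have Q0: "Q 0 = 0" by (simp add: Q_def m0)
  have "isCont \<mu> 0" using mexp by (rule expands_imp_isCont)
  then have "(\<mu> \<longlongrightarrow> \<mu> 0) (nhds 0)" by (simp add: isCont_def tendsto_at_iff_tendsto_nhds)
  then have "\<forall>\<^sub>F t in nhds 0. \<mu> t \<noteq> 0" using m0 tendsto_imp_eventually_ne by (metis zero_neq_one)
  with Q1(2) Q2(2) have ev: "\<forall>\<^sub>F t in nhds 0. \<mu> t = exp (of_real t * b + of_real (t\<^sup>2) * Q2 t)"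
  proof eventually_elim
    case (elim t)
    have "Q t = of_real t * b + of_real (t\<^sup>2) * Q2 t"
      by (simp only: elim(1,2) Q0) (simp add: scaleR_conv_of_real power2_eq_square algebra_simps)
    then show ?case using elim(3) by (metis Q_def exp_Ln)
  qed
  define c where "c = Q2 0"
  \<comment> \<open>The central limit theorem for the leading term alone: the error
    \<open>C / R ^ N\<close> vanishes, and at \<open>t = u / sqrt N\<close> the exponent of the
    \<open>N\<close>-th power is \<open>u * sqrt N * b + u^2 * Q2 t\<close>.\<close>
  have lim: "(\<lambda>N. exp (of_real (u * sqrt (real N)) * b) * (exp (of_real (u\<^sup>2) * Q2 (u / sqrt (real N))) * z (u / sqrt (real N))))
      \<longlonglongrightarrow> of_real (exp (- s * u\<^sup>2 / 2))" for u
  proof -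
    have evd: "\<forall>\<^sub>F t in nhds (0::real). \<bar>t\<bar> \<le> d"
      using d unfolding eventually_nhds_metric by (intro exI[of _ d]) (simp add: dist_norm)
    have CR: "(\<lambda>N. C / R ^ N) \<longlonglongrightarrow> 0" using R by real_asymp
    have "(\<lambda>N. exp (- \<i> * of_real (u * A * sqrt (real N))) * \<Phi> N (u / sqrt (real N))
        - exp (- \<i> * of_real (u * A * sqrt (real N))) * (\<kappa> (u / sqrt (real N)) ^ N * z (u / sqrt (real N)))) \<longlonglongrightarrow> 0"
    proof (rule Lim_null_comparison[OF _ CR])
      show "\<forall>\<^sub>F N in sequentially. norm (exp (- \<i> * of_real (u * A * sqrt (real N))) * \<Phi> N (u / sqrt (real N))
        - exp (- \<i> * of_real (u * A * sqrt (real N))) * (\<kappa> (u / sqrt (real N)) ^ N * z (u / sqrt (real N)))) \<le> C / R ^ N"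
        using eventually_at_div_sqrt[OF evd, of u] eventually_ge_at_top[of 1]
      proof eventually_elim
        case (elim N)
        have "norm (exp (- \<i> * of_real (u * A * sqrt (real N)))) = 1" by simp
        then show ?case using approx[OF elim] by (simp only: right_diff_distrib[symmetric] norm_mult)
      qed
    qed
    from tendsto_diff[OF clt[of u] this]
    have *: "(\<lambda>N. exp (- \<i> * of_real (u * A * sqrt (real N))) * (\<kappa> (u / sqrt (real N)) ^ N * z (u / sqrt (real N))))
      \<longlonglongrightarrow> of_real (exp (- s * u\<^sup>2 / 2))" by simp
    show ?thesis
    proof (rule Lim_transform_eventually[OF *])
      show "\<forall>\<^sub>F N in sequentially. exp (- \<i> * of_real (u * A * sqrt (real N))) * (\<kappa> (u / sqrt (real N)) ^ N * z (u / sqrt (real N)))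
        = exp (of_real (u * sqrt (real N)) * b) * (exp (of_real (u\<^sup>2) * Q2 (u / sqrt (real N))) * z (u / sqrt (real N)))"
        using eventually_at_div_sqrt[OF ev, of u] eventually_gt_at_top[of 0]
      proof eventually_elim
        case (elim N)
        define t where "t = u / sqrt (real N)"
        have t: "real N * t = u * sqrt (real N)" "real N * t\<^sup>2 = u\<^sup>2"
          using elim(2) by (simp_all add: t_def field_simps power2_eq_square real_sqrt_mult_self flip: real_sqrt_mult)
        have "exp (- \<i> * of_real (u * A * sqrt (real N))) * \<kappa> t ^ N = (exp (- \<i> * of_real (A * t)) * \<kappa> t) ^ N"
          unfolding power_mult_distrib exp_of_nat_mult[symmetric] using t(1)
          by (simp add: mult_ac) (metis (no_types, lifting) mult.commute mult.left_commute of_real_mult of_real_of_nat_eq t(1))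
        also have "\<dots> = exp (of_real t * b + of_real (t\<^sup>2) * Q2 t) ^ N"
          using elim(1) by (simp add: \<mu>_def t_def mult.commute)
        also have "\<dots> = exp (of_real (real N * t) * b + of_real (real N * t\<^sup>2) * Q2 t)"
          unfolding exp_of_nat_mult[symmetric] by (simp add: algebra_simps)
        finally show ?case unfolding t by (simp add: exp_add t_def mult.assoc[symmetric])
      qed
    qed
  qed
  have limQ2: "(\<lambda>N. exp (of_real (u\<^sup>2) * Q2 (u / sqrt (real N)))) \<longlonglongrightarrow> exp (of_real (u\<^sup>2) * c)" for u
    unfolding c_def by (intro tendsto_intros filterlim_expands_at_div_sqrt[OF Q2(1)])
  have limz: "(\<lambda>N. z (u / sqrt (real N))) \<longlonglongrightarrow> z 0" for u
    by (rule filterlim_expands_at_div_sqrt[OF zexp])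
  \<comment> \<open>At \<open>u = 0\<close> all exponential factors are 1, so the limit statement
    reduces to the constant sequence \<open>z 0\<close>.\<close>
  have z0: "z 0 = 1"
    using lim[of 0] LIMSEQ_unique[of "\<lambda>_. z 0" "z 0" 1] by simp
  \<comment> \<open>Dividing the limit by the convergent factors leaves a nonzero limit for
    \<open>exp (u * sqrt N * b)\<close>, which is impossible unless \<open>b = 0\<close>.\<close>
  define E where "E u = of_real (exp (- s * u\<^sup>2 / 2)) / (exp (of_real (u\<^sup>2) * c) * z 0)" for u
  have E: "(\<lambda>N. exp (of_real (u * sqrt (real N)) * b)) \<longlonglongrightarrow> E u" for u
  proof -
    have "(\<lambda>N. (exp (of_real (u * sqrt (real N)) * b) * (exp (of_real (u\<^sup>2) * Q2 (u / sqrt (real N))) * z (u / sqrt (real N))))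
       / (exp (of_real (u\<^sup>2) * Q2 (u / sqrt (real N))) * z (u / sqrt (real N)))) \<longlonglongrightarrow> E u"
      unfolding E_def by (intro tendsto_divide lim tendsto_mult limQ2 limz) (simp add: z0)
    moreover have "\<forall>\<^sub>F N in sequentially. (exp (of_real (u * sqrt (real N)) * b) * (exp (of_real (u\<^sup>2) * Q2 (u / sqrt (real N))) * z (u / sqrt (real N))))
       / (exp (of_real (u\<^sup>2) * Q2 (u / sqrt (real N))) * z (u / sqrt (real N))) = exp (of_real (u * sqrt (real N)) * b)"
      using tendsto_imp_eventually_ne[OF limz[of u], of 0] z0 by (auto elim: eventually_mono)
    ultimately show ?thesis by (rule Lim_transform_eventually)
  qed
  have b0: "b = 0" by (rule limit_exp_sqrt_imp_0[OF E]) (simp add: E_def z0)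
  \<comment> \<open>With \<open>b = 0\<close> the limit \<open>E\<close> is constantly 1, so
    \<open>exp (- s x / 2) = exp (x c)\<close> for all \<open>x = u^2\<close>. Using all
    \<open>x\<close> removes the ambiguity by multiples of \<open>2 pi i\<close>.\<close>
  have "of_real (s / 2) + c = 0"
  proof (rule exp_real_multiples_eq_1_imp_0)
    fix x :: real assume "x \<ge> 0"
    have "E (sqrt x) = 1" using E[of "sqrt x"] by (simp add: b0 LIMSEQ_const_iff)
    then have "of_real (exp (- s * x / 2)) = exp (of_real x * c)" using \<open>x \<ge> 0\<close> by (simp add: E_def z0)
    then have "exp (of_real (s * x / 2)) * exp (of_real x * c) = exp (of_real (s * x / 2)) * of_real (exp (- s * x / 2))"
      by (simp only:)
    also have "\<dots> = of_real (exp (s * x / 2) * exp (- s * x / 2))" by (simp only: of_real_mult exp_of_real)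
    also have "exp (s * x / 2) * exp (- s * x / 2) = 1" by (simp add: exp_add[symmetric])
    finally have "exp (of_real (s * x / 2) + of_real x * c) = 1" by (simp add: exp_add)
    then show "exp (of_real x * (of_real (s / 2) + c)) = 1"
      by (simp add: algebra_simps)
  qed
  then have c: "c = - of_real (s / 2)" by (simp add: add_eq_0_iff2)
  define g where "g t = Q2 t + of_real (s / 2)" for t
  have "expands r g" unfolding g_def by (rule expands_add[OF Q2(1) expands_const])
  moreover have "g 0 = 0" using c by (simp add: g_def c_def)
  moreover obtain d' where d': "d' > 0" "\<And>t. \<bar>t\<bar> < d' \<Longrightarrow> \<mu> t = exp (of_real t * b + of_real (t\<^sup>2) * Q2 t)"
    using ev by (auto simp: eventually_nhds_metric dist_norm)
  have "\<kappa> t = exp (\<i> * of_real (A * t) - of_real (s * t\<^sup>2 / 2) + of_real (t\<^sup>2) * g t)" if "\<bar>t\<bar> \<le> d' / 2" for t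
  proof -
    have "\<kappa> t = exp (\<i> * of_real (A * t)) * \<mu> t" by (simp add: \<mu>_def exp_minus)
    also have "\<mu> t = exp (of_real (t\<^sup>2) * Q2 t)" using d'(2)[of t] that d'(1) b0 by simp
    also have "exp (\<i> * of_real (A * t)) * exp (of_real (t\<^sup>2) * Q2 t) = exp (\<i> * of_real (A * t) + of_real (t\<^sup>2) * Q2 t)"
      by (rule exp_add[symmetric])
    finally show ?thesis by (simp add: g_def algebra_simps)
  qed
  ultimately show ?thesis using that[of g "d' / 2"] d'(1) by simp
qed

text \<open>Expanding the exponential to order \<open>r\<close> in \<open>u\<^sup>2 g \<tau>\<close> suffices because \<open>g \<tau> = O(\<tau>)\<close>.\<close>

lemma pointwise_edgeworth_expansion:
  fixes g z :: "real \<Rightarrow> complex"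
  assumes g: "expands r g" "g 0 = 0" and z: "expands r z" and s: "s > 0"
  obtains a :: "nat \<Rightarrow> nat \<Rightarrow> complex" where
    "\<And>\<epsilon>. \<epsilon> > 0 \<Longrightarrow> \<exists>d>0. \<forall>\<tau> u. \<bar>\<tau>\<bar> < d \<longrightarrow>
      cmod (exp (of_real (u\<^sup>2) * g \<tau>) * z \<tau> - (\<Sum>k\<le>r. \<Sum>p\<le>r. a k p * of_real (u ^ (2 * k) * \<tau> ^ p)))
        \<le> \<epsilon> * \<bar>\<tau>\<bar> ^ r * (1 + u\<^sup>2) ^ (r + 1) * exp (s * u\<^sup>2 / 4)"
proof -
  have "\<exists>c. peano_expansion r (\<lambda>\<tau>. g \<tau> ^ k * z \<tau> / fact k) c" for k
    by (rule expands_imp_peano) (use expands_mult[OF expands_mult[OF expands_power[OF g(1)] z] expands_const, of k "1 / fact k"] in simp)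
  then obtain a where a: "\<And>k. peano_expansion r (\<lambda>\<tau>. g \<tau> ^ k * z \<tau> / fact k) (a k)" by metis
  have contg: "isCont g 0" and contz: "isCont z 0" using g z by (auto intro: expands_imp_isCont)
  \<comment> \<open>For \<open>r > 0\<close> one has \<open>g \<tau> = O(\<tau>)\<close>, so the
    power \<open>r + 1\<close> is \<open>O(\<tau>^(r+1))\<close>; for \<open>r = 0\<close> only
    continuity and \<open>g 0 = 0\<close> are available, and they suffice.\<close>
  have gsmall: "\<exists>d>0. \<forall>\<tau>. \<bar>\<tau>\<bar> < d \<longrightarrow> cmod (g \<tau>) ^ Suc r \<le> \<epsilon> * \<bar>\<tau>\<bar> ^ r" if "\<epsilon> > 0" for \<epsilon>
  proof (cases r)
    case 0
    then show ?thesis using contg that g(2) unfolding continuous_at_eps_delta dist_norm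
      by (metis diff_zero less_imp_le mult.right_neutral power_0 power_one_right One_nat_def real_norm_def)
  next
    case (Suc m)
    then obtain g1 where g1: "expands m g1" "\<forall>\<^sub>F t in nhds 0. g t = t *\<^sub>R g1 t" using g by auto
    define K where "K = cmod (g1 0) + 1"
    have K: "K > 0" by (simp add: K_def add_nonneg_pos)
    obtain d1 where d1: "d1 > 0" "\<And>t. \<bar>t\<bar> < d1 \<Longrightarrow> g t = t *\<^sub>R g1 t"
      using g1(2) by (auto simp: eventually_nhds_metric dist_norm)
    obtain d2 where d2: "d2 > 0" "\<And>t. \<bar>t\<bar> < d2 \<Longrightarrow> cmod (g1 t - g1 0) < 1"
      using expands_imp_isCont[OF g1(1)] unfolding continuous_at_eps_delta dist_norm
      by (metis diff_zero real_norm_def zero_less_one)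
    define d where "d = min (min d1 d2) (\<epsilon> / K ^ Suc r)"
    have "d > 0" using d1 d2 K that by (simp add: d_def)
    moreover have "cmod (g \<tau>) ^ Suc r \<le> \<epsilon> * \<bar>\<tau>\<bar> ^ r" if t: "\<bar>\<tau>\<bar> < d" for \<tau>
    proof -
      have "cmod (g1 \<tau>) \<le> K" using d2(2)[of \<tau>] t norm_triangle_ineq2[of "g1 \<tau>" "g1 0"] by (simp add: K_def d_def)
      then have "cmod (g \<tau>) \<le> \<bar>\<tau>\<bar> * K" using d1(2)[of \<tau>] t by (simp add: d_def mult_left_mono)
      then have "cmod (g \<tau>) ^ Suc r \<le> (\<bar>\<tau>\<bar> * K) ^ Suc r" by (intro power_mono) auto
      also have "\<dots> = (\<bar>\<tau>\<bar> * K ^ Suc r) * \<bar>\<tau>\<bar> ^ r" by (simp add: power_mult_distrib)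
      also have "\<dots> \<le> \<epsilon> * \<bar>\<tau>\<bar> ^ r"
      proof (intro mult_right_mono)
        have "\<bar>\<tau>\<bar> \<le> \<epsilon> / K ^ Suc r" using t by (simp add: d_def)
        then show "\<bar>\<tau>\<bar> * K ^ Suc r \<le> \<epsilon>" using K by (simp add: pos_le_divide_eq del: power_Suc)
      qed simp
      finally show ?thesis .
    qed
    ultimately show ?thesis by blast
  qed
  show ?thesis
  proof (rule that)
    fix \<epsilon> :: real assume "\<epsilon> > 0"
    define Z where "Z = cmod (z 0) + 1"
    have Z: "Z > 0" by (simp add: Z_def add_nonneg_pos)
    \<comment> \<open>The error consists of \<open>r + 1\<close> Taylor remainders and one
      exponential remainder, the latter multiplied by \<open>z\<close> of modulus at most
      \<open>Z\<close>.\<close>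
    define e where "e = \<epsilon> / (real r + 1 + Z)"
    have e: "e > 0" using \<open>\<epsilon> > 0\<close> Z by (simp add: e_def)
    have "\<exists>d>0. \<forall>\<tau>. \<bar>\<tau>\<bar> < d \<longrightarrow> cmod (g \<tau> ^ k * z \<tau> / fact k - (\<Sum>p\<le>r. \<tau> ^ p *\<^sub>R a k p)) \<le> e * \<bar>\<tau>\<bar> ^ r" for k
      using a e unfolding peano_expansion_def by blast
    then obtain dk where dk: "\<And>k. dk k > 0" "\<And>k \<tau>. \<bar>\<tau>\<bar> < dk k \<Longrightarrow> cmod (g \<tau> ^ k * z \<tau> / fact k - (\<Sum>p\<le>r. \<tau> ^ p *\<^sub>R a k p)) \<le> e * \<bar>\<tau>\<bar> ^ r"
      by metis
    obtain d1 where d1: "d1 > 0" "\<And>\<tau>. \<bar>\<tau>\<bar> < d1 \<Longrightarrow> cmod (g \<tau>) ^ Suc r \<le> e * \<bar>\<tau>\<bar> ^ r"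
      using gsmall[OF e] by blast
    obtain d2 where d2: "d2 > 0" "\<And>\<tau>. \<bar>\<tau>\<bar> < d2 \<Longrightarrow> cmod (z \<tau> - z 0) < 1"
      using contz unfolding continuous_at_eps_delta dist_norm
      by (metis diff_zero real_norm_def zero_less_one)
    \<comment> \<open>The bound \<open>s / 4\<close> limits the growth of \<open>exp (u^2 g)\<close>
      to \<open>exp (s u^2 / 4)\<close>, so half of the decay \<open>exp (- s u^2 / 2)\<close>
      remains for integration.\<close>
    obtain d3 where d3: "d3 > 0" "\<And>\<tau>. \<bar>\<tau>\<bar> < d3 \<Longrightarrow> cmod (g \<tau>) < s / 4"
      using contg s g(2) unfolding continuous_at_eps_delta dist_norm
      by (metis diff_zero real_norm_def zero_less_divide_iff zero_less_numeral)
    define d where "d = min (min d1 (min d2 d3)) (Min (dk ` {..r}))"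
    have d0: "d > 0" using d1 d2 d3 dk by (simp add: d_def)
    have "cmod (exp (of_real (u\<^sup>2) * g \<tau>) * z \<tau> - (\<Sum>k\<le>r. \<Sum>p\<le>r. a k p * of_real (u ^ (2 * k) * \<tau> ^ p)))
        \<le> \<epsilon> * \<bar>\<tau>\<bar> ^ r * (1 + u\<^sup>2) ^ (r + 1) * exp (s * u\<^sup>2 / 4)" if t: "\<bar>\<tau>\<bar> < d" for \<tau> u
    proof -
      define w where "w = of_real (u\<^sup>2) * g \<tau>"
      define B where "B = (1 + u\<^sup>2) ^ (r + 1) * exp (s * u\<^sup>2 / 4)"
      have td: "\<bar>\<tau>\<bar> < d1" "\<bar>\<tau>\<bar> < d2" "\<bar>\<tau>\<bar> < d3" using t by (auto simp: d_def)
      have tk: "\<bar>\<tau>\<bar> < dk k" if "k \<le> r" for k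
        using t that by (auto simp: d_def)
      have zb: "cmod (z \<tau>) \<le> Z" using d2(2)[OF td(2)] norm_triangle_ineq2[of "z \<tau>" "z 0"] by (simp add: Z_def)
      have u1: "u ^ (2 * k) \<le> (1 + u\<^sup>2) ^ (r + 1)" if "k \<le> r + 1" for k
      proof -
        have "u ^ (2 * k) = (u\<^sup>2) ^ k" by (simp add: power_mult)
        also have "\<dots> \<le> (1 + u\<^sup>2) ^ k" by (intro power_mono) auto
        also have "\<dots> \<le> (1 + u\<^sup>2) ^ (r + 1)" by (intro power_increasing that) auto
        finally show ?thesis .
      qed
      have ex1: "1 \<le> exp (s * u\<^sup>2 / 4)" using s by simp
      have uB: "u ^ (2 * k) \<le> B" if "k \<le> r" for k
      proof -
        have "u ^ (2 * k) * 1 \<le> B" unfolding B_def by (intro mult_mono u1 ex1) (use that in auto)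
        then show ?thesis by simp
      qed
      have wn: "cmod w = u\<^sup>2 * cmod (g \<tau>)" by (simp add: w_def norm_mult norm_power)
      have "cmod (exp w - (\<Sum>k\<le>r. w ^ k / fact k)) \<le> exp \<bar>Re w\<bar> * cmod w ^ Suc r / fact r"
        by (rule Taylor_exp)
      also have "\<dots> \<le> exp \<bar>Re w\<bar> * cmod w ^ Suc r / 1"
        by (intro divide_left_mono) (auto simp: fact_ge_1)
      also have "\<dots> \<le> exp (s * u\<^sup>2 / 4) * (u ^ (2 * (r + 1)) * (e * \<bar>\<tau>\<bar> ^ r))"
      proof (simp only: div_by_1, intro mult_mono)
        have "\<bar>Re w\<bar> \<le> u\<^sup>2 * cmod (g \<tau>)" using abs_Re_le_cmod[of w] by (simp only: wn)
        also have "\<dots> \<le> u\<^sup>2 * (s / 4)" using d3(2)[OF td(3)] by (intro mult_left_mono) auto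
        finally show "exp \<bar>Re w\<bar> \<le> exp (s * u\<^sup>2 / 4)" by (simp add: mult.commute)
        have "cmod w ^ Suc r = u ^ (2 * (r + 1)) * cmod (g \<tau>) ^ Suc r"
          by (simp only: wn power_mult_distrib power_mult Suc_eq_plus1)
        also have "\<dots> \<le> u ^ (2 * (r + 1)) * (e * \<bar>\<tau>\<bar> ^ r)"
          using d1(2)[OF td(1)] by (rule mult_left_mono) (rule zero_le_even_power, simp)
        finally show "cmod w ^ Suc r \<le> u ^ (2 * (r + 1)) * (e * \<bar>\<tau>\<bar> ^ r)" .
      qed auto
      also have "\<dots> \<le> exp (s * u\<^sup>2 / 4) * ((1 + u\<^sup>2) ^ (r + 1) * (e * \<bar>\<tau>\<bar> ^ r))"
        using e by (intro mult_left_mono mult_right_mono u1) auto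
      also have "\<dots> = e * \<bar>\<tau>\<bar> ^ r * B" by (simp only: B_def mult_ac)
      finally have rem: "cmod (exp w - (\<Sum>k\<le>r. w ^ k / fact k)) \<le> e * \<bar>\<tau>\<bar> ^ r * B" .
      have eq: "exp w * z \<tau> - (\<Sum>k\<le>r. \<Sum>p\<le>r. a k p * of_real (u ^ (2 * k) * \<tau> ^ p))
        = (exp w - (\<Sum>k\<le>r. w ^ k / fact k)) * z \<tau> + (\<Sum>k\<le>r. of_real (u ^ (2 * k)) * (g \<tau> ^ k * z \<tau> / fact k - (\<Sum>p\<le>r. \<tau> ^ p *\<^sub>R a k p)))"
        by (simp add: w_def power_mult_distrib power_mult[symmetric] algebra_simps sum_distrib_left sum_distrib_right sum_subtractf scaleR_conv_of_real)
      have "cmod (exp w * z \<tau> - (\<Sum>k\<le>r. \<Sum>p\<le>r. a k p * of_real (u ^ (2 * k) * \<tau> ^ p)))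
        \<le> cmod ((exp w - (\<Sum>k\<le>r. w ^ k / fact k)) * z \<tau>) + cmod (\<Sum>k\<le>r. of_real (u ^ (2 * k)) * (g \<tau> ^ k * z \<tau> / fact k - (\<Sum>p\<le>r. \<tau> ^ p *\<^sub>R a k p)))"
        unfolding eq by (rule norm_triangle_ineq)
      also have "\<dots> \<le> e * \<bar>\<tau>\<bar> ^ r * B * Z + (\<Sum>k\<le>r. B * (e * \<bar>\<tau>\<bar> ^ r))"
      proof (intro add_mono order_trans[OF norm_sum] sum_mono)
        show "cmod ((exp w - (\<Sum>k\<le>r. w ^ k / fact k)) * z \<tau>) \<le> e * \<bar>\<tau>\<bar> ^ r * B * Z"
          unfolding norm_mult using e by (intro mult_mono rem zb) (auto simp: B_def)
        fix k assume "k \<in> {..r}"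
        then have k: "k \<le> r" by simp
        have "\<bar>u ^ (2 * k)\<bar> = u ^ (2 * k)" by (simp add: power_mult)
        then show "cmod (of_real (u ^ (2 * k)) * (g \<tau> ^ k * z \<tau> / fact k - (\<Sum>p\<le>r. \<tau> ^ p *\<^sub>R a k p))) \<le> B * (e * \<bar>\<tau>\<bar> ^ r)"
          unfolding norm_mult norm_of_real using uB[OF k] dk(2)[OF tk[OF k]]
          by (intro mult_mono) (auto simp: B_def)
      qed
      also have "\<dots> = (e * (real r + 1 + Z)) * \<bar>\<tau>\<bar> ^ r * B" by (simp add: algebra_simps)
      also have "e * (real r + 1 + Z) = \<epsilon>" using Z by (simp add: e_def)
      finally show ?thesis by (simp add: w_def B_def mult.assoc)
    qed
    then show "\<exists>d>0. \<forall>\<tau> u. \<bar>\<tau>\<bar> < d \<longrightarrow>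
      cmod (exp (of_real (u\<^sup>2) * g \<tau>) * z \<tau> - (\<Sum>k\<le>r. \<Sum>p\<le>r. a k p * of_real (u ^ (2 * k) * \<tau> ^ p)))
        \<le> \<epsilon> * \<bar>\<tau>\<bar> ^ r * (1 + u\<^sup>2) ^ (r + 1) * exp (s * u\<^sup>2 / 4)"
      using d0 by blast
  qed
qed

section \<open>Fourier transforms of powers times Gaussians\<close>

text \<open>Up to normalisation the integrand is that of a moment of the centred normal law with
  variance \<open>1 / (2 * c)\<close>.\<close>

lemma integrable_power_gauss:
  assumes "c > 0"
  shows "integrable lborel (\<lambda>u::real. u ^ m * exp (- c * u\<^sup>2))"
proof -
  define \<sigma> where "\<sigma> = 1 / sqrt (2 * c)"
  have s: "\<sigma> > 0" using assms by (simp add: \<sigma>_def)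
  have s2: "2 * \<sigma>\<^sup>2 = 1 / c" using assms by (simp add: \<sigma>_def power_divide)
  have "integrable lborel (\<lambda>x. sqrt (2 * pi * \<sigma>\<^sup>2) * (normal_density 0 \<sigma> x * (x - 0) ^ m))"
    by (intro integrable_mult_right integrable_normal_moment s)
  moreover have "sqrt (2 * pi * \<sigma>\<^sup>2) * (normal_density 0 \<sigma> x * (x - 0) ^ m) = x ^ m * exp (- c * x\<^sup>2)" for x
    using s s2 by (simp add: normal_density_def mult.commute)
  ultimately show ?thesis by (simp only:)
qed

lemma integrable_abs_power_gauss:
  assumes "c > 0"
  shows "integrable lborel (\<lambda>u::real. \<bar>u\<bar> ^ m * exp (- c * u\<^sup>2))"
  using integrable_abs[OF integrable_power_gauss[OF assms, of m]] by (simp add: abs_mult power_abs)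

lemma integrable_abs_power_gauss':
  assumes "c > 0"
  shows "integrable lborel (\<lambda>u::real. \<bar>u\<bar> ^ m * (1 + u\<^sup>2) ^ k * exp (- c * u\<^sup>2))"
proof (induction k arbitrary: m)
  case 0
  show ?case using integrable_abs_power_gauss[OF assms] by simp
next
  case (Suc k)
  have "integrable lborel (\<lambda>u::real. \<bar>u\<bar> ^ m * (1 + u\<^sup>2) ^ k * exp (- c * u\<^sup>2) + \<bar>u\<bar> ^ (m + 2) * (1 + u\<^sup>2) ^ k * exp (- c * u\<^sup>2))"
    by (intro Bochner_Integration.integrable_add Suc.IH)
  moreover have "\<bar>u\<bar> ^ m * (1 + u\<^sup>2) ^ k * exp (- c * u\<^sup>2) + \<bar>u\<bar> ^ (m + 2) * (1 + u\<^sup>2) ^ k * exp (- c * u\<^sup>2)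
      = \<bar>u\<bar> ^ m * (1 + u\<^sup>2) ^ Suc k * exp (- c * u\<^sup>2)" for u
    by (simp only: power_add power2_abs power_Suc) (simp only: algebra_simps)
  ultimately show ?case by (simp only:)
qed

lemma norm_iexp [simp]: "cmod (iexp x) = 1"
  by (simp add: norm_exp_eq_Re)

lemma integrable_gauss_iexp:
  assumes "c > 0"
  shows "integrable lborel (\<lambda>u::real. of_real (u ^ m * exp (- c * u\<^sup>2)) * iexp (- (u * y)))"
proof (rule Bochner_Integration.integrable_bound[OF integrable_power_gauss[OF assms, of m]])
  show "AE u in lborel. norm (of_real (u ^ m * exp (- c * u\<^sup>2)) * iexp (- (u * y))) \<le> norm (u ^ m * exp (- c * u\<^sup>2))"
    unfolding norm_mult norm_iexp norm_of_real by (simp add: abs_mult)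
qed simp

text \<open>Up to constants a Hermite function: a polynomial in \<open>y\<close> of Hermite type
  times the Gaussian density.\<close>

definition gauss_fourier :: "real \<Rightarrow> nat \<Rightarrow> real \<Rightarrow> complex" where
  "gauss_fourier s m y = (LINT u|lborel. of_real (u ^ m * exp (- (s / 2) * u\<^sup>2)) * iexp (- (u * y)))"

text \<open>The characteristic function of the standard normal law after the substitution
  \<open>x = sqrt s * u\<close>; \<open>t\<close> is chosen so that the phase becomes
  \<open>- (u * y)\<close>.\<close>

lemma gauss_fourier_0:
  assumes s: "s > 0"
  shows "gauss_fourier s 0 y = of_real (2 * pi * gauss_n s y)"
proof -
  define t where "t = - y / sqrt s"
  have t: "t * (sqrt s * u) = - (u * y)" for u using s by (simp add: t_def)
  have "of_real (exp (- (t\<^sup>2) / 2)) = char std_normal_distribution t"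
    by (simp add: char_std_normal_distribution)
  also have "\<dots> = (LINT x|lborel. std_normal_density x *\<^sub>R iexp (t * x))"
    unfolding char_def by (subst integral_density) auto
  also have "\<dots> = \<bar>sqrt s\<bar> *\<^sub>R (LINT x|lborel. std_normal_density (0 + sqrt s * x) *\<^sub>R iexp (t * (0 + sqrt s * x)))"
    using s by (intro lborel_integral_real_affine) auto
  also have "(\<lambda>x. std_normal_density (0 + sqrt s * x) *\<^sub>R iexp (t * (0 + sqrt s * x)))
    = (\<lambda>u. of_real (1 / sqrt (2 * pi)) * (of_real (u ^ 0 * exp (- (s / 2) * u\<^sup>2)) * iexp (- (u * y))))"
    using s by (auto simp: fun_eq_iff t std_normal_density_def power_mult_distrib scaleR_conv_of_real)
  also have "(LINT u|lborel. of_real (1 / sqrt (2 * pi)) * (of_real (u ^ 0 * exp (- (s / 2) * u\<^sup>2)) * iexp (- (u * y))))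
    = of_real (1 / sqrt (2 * pi)) * gauss_fourier s 0 y"
    unfolding gauss_fourier_def by (rule integral_mult_right_zero)
  finally have "of_real (sqrt (2 * pi) / sqrt s) * of_real (exp (- (t\<^sup>2) / 2)) = (of_real (sqrt (2 * pi) / sqrt s) * of_real (\<bar>sqrt s\<bar> * (1 / sqrt (2 * pi)))) * gauss_fourier s 0 y"
    by (simp add: scaleR_conv_of_real mult.assoc)
  also have "of_real (sqrt (2 * pi) / sqrt s) * of_real (\<bar>sqrt s\<bar> * (1 / sqrt (2 * pi))) = (1::complex)"
    unfolding of_real_mult[symmetric] using s by simp
  finally have "gauss_fourier s 0 y = of_real (sqrt (2 * pi) / sqrt s * exp (- (t\<^sup>2) / 2))" by simp
  also have "sqrt (2 * pi) / sqrt s * exp (- (t\<^sup>2) / 2) = 2 * pi * gauss_n s y"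
  proof -
    have "sqrt (2 * pi) / sqrt s = 2 * pi / (sqrt (2 * pi) * sqrt s)"
      using s by (simp add: field_simps)
    then show ?thesis using s by (simp add: gauss_n_def t_def power_divide real_sqrt_mult mult_ac)
  qed
  finally show ?thesis .
qed

lemma tendsto_power_gauss_at_top:
  assumes "c > 0"
  shows "((\<lambda>u::real. u ^ m * exp (- c * u\<^sup>2)) \<longlongrightarrow> 0) at_top"
  using assms by real_asymp

text \<open>Integration by parts: the derivative of \<open>F\<close> has integral 0 because
  \<open>F\<close> vanishes at both ends. At \<open>m = 0\<close> the truncated index
  \<open>m - 1\<close> is harmless, as its factor \<open>m\<close> is 0.\<close>

lemma gauss_fourier_rec:
  assumes s: "s > 0"
  shows "of_real s * gauss_fourier s (Suc m) y = of_nat m * gauss_fourier s (m - 1) y - \<i> * of_real y * gauss_fourier s m y"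
proof -
  define F where "F u = of_real (u ^ m * exp (- (s / 2) * u\<^sup>2)) * iexp (- (u * y))" for u
  define f1 where "f1 u = of_nat m * (of_real (u ^ (m - 1) * exp (- (s / 2) * u\<^sup>2)) * iexp (- (u * y)))" for u
  define f2 where "f2 u = of_real s * (of_real (u ^ Suc m * exp (- (s / 2) * u\<^sup>2)) * iexp (- (u * y)))" for u
  define f3 where "f3 u = (\<i> * of_real y) * (of_real (u ^ m * exp (- (s / 2) * u\<^sup>2)) * iexp (- (u * y)))" for u
  define f where "f u = f1 u - f2 u - f3 u" for u
  have int: "integrable lborel f1" "integrable lborel f2" "integrable lborel f3"
    unfolding f1_def f2_def f3_def using s by (intro integrable_mult_right integrable_gauss_iexp; simp)+
  have "(LBINT x=-\<infinity>..\<infinity>. f x) = 0 - 0"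
  proof (rule interval_integral_FTC_integrable[where F=F])
    show "(F has_vector_derivative f x) (at x)" for x
    proof -
      have 1: "((\<lambda>u. u ^ m * exp (- (s / 2) * u\<^sup>2)) has_real_derivative
          (real m * x ^ (m - 1) * exp (- (s / 2) * x\<^sup>2) - s * x ^ Suc m * exp (- (s / 2) * x\<^sup>2))) (at x)"
        by (rule derivative_eq_intros refl | simp)+
      have 2: "((\<lambda>u. iexp (- (u * y))) has_vector_derivative (- y) *\<^sub>R (\<i> * iexp (- (x * y)))) (at x)"
      proof -
        have "((\<lambda>u. - (u * y)) has_vector_derivative (- y)) (at x)"
          unfolding has_real_derivative_iff_has_vector_derivative[symmetric]
          by (rule derivative_eq_intros refl | simp)+
        from vector_diff_chain_at[OF this has_vector_derivative_iexp] show ?thesis by (simp add: o_def)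
      qed
      have "((\<lambda>u. (u ^ m * exp (- (s / 2) * u\<^sup>2)) *\<^sub>R iexp (- (u * y))) has_vector_derivative
        (x ^ m * exp (- (s / 2) * x\<^sup>2)) *\<^sub>R ((- y) *\<^sub>R (\<i> * iexp (- (x * y)))) +
        (real m * x ^ (m - 1) * exp (- (s / 2) * x\<^sup>2) - s * x ^ Suc m * exp (- (s / 2) * x\<^sup>2)) *\<^sub>R iexp (- (x * y))) (at x)"
        by (rule has_vector_derivative_scaleR[OF 1 2])
      then show ?thesis
        unfolding F_def f_def f1_def f2_def f3_def by (simp add: scaleR_conv_of_real algebra_simps)
    qed
    show "isCont f x" for x unfolding f_def f1_def f2_def f3_def by (intro continuous_intros) auto
    show "set_integrable lborel (einterval (-\<infinity>) \<infinity>) f"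
      using int by (simp add: set_integrable_def f_def)
    have norm_F: "norm (F u) = norm (u ^ m * exp (- (s / 2) * u\<^sup>2))" for u
      unfolding F_def norm_mult norm_iexp norm_of_real by (simp add: norm_mult abs_mult)
    have "((\<lambda>u. u ^ m * exp (- (s / 2) * u\<^sup>2)) \<longlongrightarrow> 0) at_top"
      by (rule tendsto_power_gauss_at_top) (use s in simp)
    then have top: "((\<lambda>u. norm (F u)) \<longlongrightarrow> 0) at_top" unfolding norm_F by (rule tendsto_norm_zero)
    then have "(F \<longlongrightarrow> 0) at_top" by (rule tendsto_norm_zero_cancel)
    then show "((F \<circ> real_of_ereal) \<longlongrightarrow> 0) (at_left \<infinity>)"
      by (simp add: ereal_tendsto_simps1)
    have "norm (F (- u)) = norm (F u)" for u by (simp add: norm_F abs_mult power_abs)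
    then have "((\<lambda>u. norm (F (- u))) \<longlongrightarrow> 0) at_top" using top by simp
    then have "((\<lambda>u. norm (F u)) \<longlongrightarrow> 0) at_bot" by (simp add: filterlim_at_bot_mirror)
    then have "(F \<longlongrightarrow> 0) at_bot" by (rule tendsto_norm_zero_cancel)
    then show "((F \<circ> real_of_ereal) \<longlongrightarrow> 0) (at_right (-\<infinity>))"
      by (simp add: ereal_tendsto_simps1)
  qed simp
  then have "(LINT u|lborel. f1 u - f2 u - f3 u) = 0"
    by (simp add: interval_lebesgue_integral_def set_lebesgue_integral_def f_def)
  then have "(LINT u|lborel. f1 u) - (LINT u|lborel. f2 u) - (LINT u|lborel. f3 u) = 0"
    using int by simp
  moreover have "(LINT u|lborel. f1 u) = of_nat m * gauss_fourier s (m - 1) y"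
    unfolding f1_def gauss_fourier_def by (rule integral_mult_right_zero)
  moreover have "(LINT u|lborel. f2 u) = of_real s * gauss_fourier s (Suc m) y"
    unfolding f2_def gauss_fourier_def by (rule integral_mult_right_zero)
  moreover have "(LINT u|lborel. f3 u) = (\<i> * of_real y) * gauss_fourier s m y"
    unfolding f3_def gauss_fourier_def by (rule integral_mult_right_zero)
  ultimately show ?thesis by (simp add: algebra_simps)
qed

text \<open>The recursion reaches back two steps, hence the strong induction. Its factor \<i> makes
  the polynomials complex.\<close>

lemma gauss_fourier_poly:
  assumes s: "s > 0"
  shows "\<exists>P. \<forall>y. gauss_fourier s m y = of_real (2 * pi * gauss_n s y) * poly P (of_real y)"
proof (induction m rule: less_induct)
  case (less m)
  show ?case
  proof (cases m)
    case 0
    then show ?thesis using gauss_fourier_0[OF s] by (intro exI[of _ 1]) simp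
  next
    case (Suc n)
    obtain P where P: "\<And>y. gauss_fourier s n y = of_real (2 * pi * gauss_n s y) * poly P (of_real y)"
      using less Suc by blast
    obtain Q where Q: "\<And>y. of_nat n * gauss_fourier s (n - 1) y = of_real (2 * pi * gauss_n s y) * poly Q (of_real y)"
    proof (cases n)
      case 0
      then show ?thesis by (intro that[of 0]) simp
    next
      case (Suc k)
      then obtain Q where "\<And>y. gauss_fourier s (n - 1) y = of_real (2 * pi * gauss_n s y) * poly Q (of_real y)"
        using less[of "n - 1"] \<open>m = Suc n\<close> by auto
      then show ?thesis by (intro that[of "smult (of_nat n) Q"]) (simp add: mult_ac)
    qed
    have "gauss_fourier s m y = of_real (2 * pi * gauss_n s y) * poly (smult (1 / of_real s) (Q - smult \<i> ([:0, 1:] * P))) (of_real y)" for y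
    proof -
      have "gauss_fourier s m y = 1 / of_real s * (of_real s * gauss_fourier s (Suc n) y)"
        using s Suc by simp
      also have "\<dots> = of_real (2 * pi * gauss_n s y) * poly (smult (1 / of_real s) (Q - smult \<i> ([:0, 1:] * P))) (of_real y)"
        unfolding gauss_fourier_rec[OF s] P Q by (simp add: algebra_simps diff_divide_distrib)
      finally show ?thesis .
    qed
    then show ?thesis by blast
  qed
qed

section \<open>Fourier inversion on the integers\<close>

text \<open>Orthogonality of characters: the integral of \<open>exp (i t (S - k))\<close> over
  \<open>[-pi, pi]\<close> is \<open>2 pi\<close> if \<open>S = k\<close> and 0 otherwise; Fubini
  exchanges it with the expectation.\<close>

lemma lattice_fourier_inversion:
  assumes "prob_space M" and S: "S \<in> measurable M (count_space UNIV)"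
  shows "(LINT t|lborel. indicator {-pi..pi} t *\<^sub>R (iexp (- (t * of_int k)) * (LINT \<omega>|M. cis (t * real_of_int (S \<omega>)))))
    = of_real (2 * pi * measure M {\<omega>\<in>space M. S \<omega> = k})"
proof -
  interpret prob_space M by fact
  interpret pair_sigma_finite lborel M ..
  have S': "(\<lambda>\<omega>. real_of_int (S \<omega>)) \<in> borel_measurable M"
    using S by (rule measurable_compose) simp
  define f where "f t \<omega> = indicator {-pi..pi} t *\<^sub>R cis (t * (real_of_int (S \<omega>) - of_int k))" for t :: real and \<omega>
  have cis_meas: "cis \<in> borel_measurable borel" by (intro borel_measurable_continuous_onI continuous_intros)
  have meas: "(\<lambda>(t, \<omega>). f t \<omega>) \<in> borel_measurable (lborel \<Otimes>\<^sub>M M)"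
    unfolding f_def using S' cis_meas by measurable
  have int: "integrable (lborel \<Otimes>\<^sub>M M) (\<lambda>(t, \<omega>). f t \<omega>)"
  proof (rule Bochner_Integration.integrable_bound[OF _ meas])
    show "integrable (lborel \<Otimes>\<^sub>M M) (indicator ({-pi..pi} \<times> space M) :: _ \<Rightarrow> real)"
    proof (rule integrable_real_indicator)
      have "emeasure (lborel \<Otimes>\<^sub>M M) ({-pi..pi} \<times> space M) = emeasure lborel {-pi..pi} * emeasure M (space M)"
        by (rule sigma_finite_measure.emeasure_pair_measure_Times[OF prob_space_imp_sigma_finite[OF assms(1)]]) auto
      then show "emeasure (lborel \<Otimes>\<^sub>M M) ({-pi..pi} \<times> space M) < \<infinity>" by (simp add: emeasure_space_1)
    qed (intro pair_measureI; simp)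
    show "AE x in lborel \<Otimes>\<^sub>M M. norm (case x of (t, \<omega>) \<Rightarrow> f t \<omega>) \<le> norm (indicator ({-pi..pi} \<times> space M) x :: real)"
      by (rule AE_I2) (auto simp: f_def space_pair_measure indicator_def)
  qed
  have one: "(LINT t|lborel. f t \<omega>) = of_real (2 * pi) * indicator {\<omega>. S \<omega> = k} \<omega>" for \<omega>
  proof (cases "S \<omega> = k")
    case True
    then have "(\<lambda>t. f t \<omega>) = (\<lambda>t. indicator {-pi..pi} t *\<^sub>R 1)" by (auto simp: f_def fun_eq_iff)
    then show ?thesis using True by (simp add: scaleR_conv_of_real)
  next
    case False
    define a where "a = real_of_int (S \<omega> - k)"
    have a: "a \<noteq> 0" using False by (simp add: a_def)
    have "(LBINT t=ereal (-pi)..ereal pi. iexp (t * a)) = (- \<i> / of_real a) * iexp (pi * a) - (- \<i> / of_real a) * iexp (- pi * a)"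
    proof (rule interval_integral_FTC_finite)
      show "continuous_on {min (- pi) pi..max (- pi) pi} (\<lambda>t. iexp (t * a))" by (intro continuous_intros)
      show "((\<lambda>t. (- \<i> / of_real a) * iexp (t * a)) has_vector_derivative iexp (t * a)) (at t within {min (- pi) pi..max (- pi) pi})" for t
      proof -
        have "((\<lambda>t. t * a) has_vector_derivative a) (at t within {min (- pi) pi..max (- pi) pi})"
          unfolding has_real_derivative_iff_has_vector_derivative[symmetric]
          by (rule derivative_eq_intros refl | simp)+
        from vector_diff_chain_within[OF this has_vector_derivative_iexp]
        have "((\<lambda>t. iexp (t * a)) has_vector_derivative a *\<^sub>R (\<i> * iexp (t * a))) (at t within {min (- pi) pi..max (- pi) pi})"
          by (simp add: o_def)
        from has_vector_derivative_mult_right[OF this, of "- \<i> / of_real a"]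
        show ?thesis using a by (simp add: scaleR_conv_of_real)
      qed
    qed
    \<comment> \<open>The two exponents differ by \<open>2 pi i (S \<omega> - k)\<close>;
      integrality of \<open>S\<close> makes the boundary terms cancel.\<close>
    also have "iexp (pi * a) = iexp (- pi * a)"
      unfolding exp_eq by (intro exI[of _ "S \<omega> - k"]) (simp add: a_def algebra_simps)
    finally have "(LBINT t=ereal (-pi)..ereal pi. iexp (t * a)) = 0" by simp
    moreover have "(LBINT t=ereal (-pi)..ereal pi. iexp (t * a)) = (LBINT t:{-pi..pi}. iexp (t * a))"
      by (rule interval_integral_Icc) simp
    moreover have "(LBINT t:{-pi..pi}. iexp (t * a)) = (LINT t|lborel. f t \<omega>)"
      unfolding set_lebesgue_integral_def f_def by (simp add: cis_conv_exp a_def)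
    ultimately show ?thesis using False by simp
  qed
  have "(LINT t|lborel. indicator {-pi..pi} t *\<^sub>R (iexp (- (t * of_int k)) * (LINT \<omega>|M. cis (t * real_of_int (S \<omega>)))))
    = (LINT t|lborel. (LINT \<omega>|M. f t \<omega>))"
  proof (rule Bochner_Integration.integral_cong[OF refl])
    fix t
    have "iexp (- (t * of_int k)) * (LINT \<omega>|M. cis (t * real_of_int (S \<omega>))) = (LINT \<omega>|M. cis (t * (real_of_int (S \<omega>) - of_int k)))"
      unfolding integral_mult_right_zero[symmetric]
      by (rule Bochner_Integration.integral_cong[OF refl]) (simp add: cis_conv_exp exp_add[symmetric] algebra_simps)
    then show "indicator {-pi..pi} t *\<^sub>R (iexp (- (t * of_int k)) * (LINT \<omega>|M. cis (t * real_of_int (S \<omega>)))) = (LINT \<omega>|M. f t \<omega>)"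
      by (simp add: f_def)
  qed
  also have "\<dots> = (LINT \<omega>|M. (LINT t|lborel. f t \<omega>))"
    using Fubini_integral[OF int] by simp
  also have "\<dots> = of_real (2 * pi) * (LINT \<omega>|M. indicator {\<omega>. S \<omega> = k} \<omega>)"
    unfolding one by (rule integral_mult_right_zero)
  also have "(LINT \<omega>|M. (indicator {\<omega>. S \<omega> = k} \<omega> :: complex)) = of_real (measure M {\<omega>\<in>space M. S \<omega> = k})"
  proof -
    have "(LINT \<omega>|M. (indicator {\<omega>. S \<omega> = k} \<omega> :: complex)) = (LINT \<omega>|M. of_real (indicator {\<omega>. S \<omega> = k} \<omega>))"
      by (rule Bochner_Integration.integral_cong) (auto simp: indicator_def)
    also have "\<dots> = of_real (LINT \<omega>|M. indicator {\<omega>. S \<omega> = k} \<omega>)" by (rule integral_complex_of_real)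
    also have "(LINT \<omega>|M. indicator {\<omega>. S \<omega> = k} \<omega>) = measure M ({\<omega>. S \<omega> = k} \<inter> space M)" by simp
    also have "{\<omega>. S \<omega> = k} \<inter> space M = {\<omega>\<in>space M. S \<omega> = k}" by blast
    finally show ?thesis .
  qed
  finally show ?thesis by simp
qed

text \<open>The three terms bound the error of the expansion near \<open>0\<close>, the characteristic function
  away from \<open>0\<close>, and the tail of the Gaussian integral; none of them depends on \<open>y\<close>, which
  makes the final estimate uniform in \<open>k\<close>.\<close>

lemma lattice_edgeworth_integral:
  fixes \<Phi> :: "nat \<Rightarrow> real \<Rightarrow> complex" and \<kappa> g z :: "real \<Rightarrow> complex" and a :: "nat \<Rightarrow> nat \<Rightarrow> complex"
  assumes meas: "\<And>N. \<Phi> N \<in> borel_measurable borel" and le1: "\<And>N t. cmod (\<Phi> N t) \<le> 1"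
    and s: "s > 0" and d0: "d0 > 0" and R0: "R0 > 1" and C0: "C0 \<ge> 0"
    and near: "\<And>t N. \<bar>t\<bar> \<le> d0 \<Longrightarrow> N \<ge> 1 \<Longrightarrow> cmod (\<Phi> N t - \<kappa> t ^ N * z t) \<le> C0 / R0 ^ N"
    and kappa: "\<And>t. \<bar>t\<bar> \<le> d0 \<Longrightarrow> \<kappa> t = exp (\<i> * of_real (A * t) - of_real (s * t\<^sup>2 / 2) + of_real (t\<^sup>2) * g t)"
    and far: "\<And>e. e > 0 \<Longrightarrow> \<exists>C R. C \<ge> 0 \<and> R > 1 \<and> (\<forall>N\<ge>1. \<forall>t. e \<le> \<bar>t\<bar> \<and> \<bar>t\<bar> \<le> pi \<longrightarrow> cmod (\<Phi> N t) \<le> C / R ^ N)"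
    and pw: "\<And>\<epsilon>. \<epsilon> > 0 \<Longrightarrow> \<exists>d>0. \<forall>\<tau> u. \<bar>\<tau>\<bar> < d \<longrightarrow>
      cmod (exp (of_real (u\<^sup>2) * g \<tau>) * z \<tau> - (\<Sum>k\<le>r. \<Sum>p\<le>r. a k p * of_real (u ^ (2 * k) * \<tau> ^ p)))
        \<le> \<epsilon> * \<bar>\<tau>\<bar> ^ r * (1 + u\<^sup>2) ^ (r + 1) * exp (s * u\<^sup>2 / 4)"
    and \<epsilon>: "\<epsilon> > 0"
  shows "\<forall>\<^sub>F N in sequentially. \<forall>y.
    cmod ((LINT u|lborel. indicator {-(pi * sqrt (real N))..pi * sqrt (real N)} u *\<^sub>R
            (iexp (- (u * y)) * (iexp (- (u * A * sqrt (real N))) * \<Phi> N (u / sqrt (real N)))))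
        - (\<Sum>k\<le>r. \<Sum>p\<le>r. a k p / of_real (sqrt (real N) ^ p) * gauss_fourier s (2 * k + p) y))
    \<le> \<epsilon> / sqrt (real N) ^ r"
proof -
  \<comment> \<open>The approximating integrand, defined on the whole line so that its transform is
    an exact combination of \<open>gauss_fourier\<close> terms.\<close>
  define G where "G N u = of_real (exp (- (s / 2) * u\<^sup>2)) * (\<Sum>k\<le>r. \<Sum>p\<le>r. a k p * of_real (u ^ (2 * k) * (u / sqrt (real N)) ^ p))" for N and u :: real
  define \<Psi> where "\<Psi> N u = iexp (- (u * A * sqrt (real N))) * \<Phi> N (u / sqrt (real N))" for N and u :: real
  define I where "I N = {-(pi * sqrt (real N))..pi * sqrt (real N)}" for N
  define w1 where "w1 u = \<bar>u\<bar> ^ r * (1 + u\<^sup>2) ^ (r + 1) * exp (- (s / 4) * u\<^sup>2)" for u :: real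
  have w1: "integrable lborel w1"
    unfolding w1_def using s by (intro integrable_abs_power_gauss') simp
  \<comment> \<open>Reserves a third of \<open>\<epsilon>\<close> for the expansion error integrated
    against \<open>w1\<close>; the 1 keeps the denominator positive.\<close>
  define e1 where "e1 = \<epsilon> / (3 * ((LINT u|lborel. w1 u) + 1))"
  have W1: "(LINT u|lborel. w1 u) \<ge> 0" by (intro Bochner_Integration.integral_nonneg) (simp add: w1_def)
  have e1: "e1 > 0" using \<epsilon> W1 by (simp add: e1_def add_nonneg_pos)
  obtain d1 where d1: "d1 > 0" "\<And>\<tau> u. \<bar>\<tau>\<bar> < d1 \<Longrightarrow>
      cmod (exp (of_real (u\<^sup>2) * g \<tau>) * z \<tau> - (\<Sum>k\<le>r. \<Sum>p\<le>r. a k p * of_real (u ^ (2 * k) * \<tau> ^ p)))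
        \<le> e1 * \<bar>\<tau>\<bar> ^ r * (1 + u\<^sup>2) ^ (r + 1) * exp (s * u\<^sup>2 / 4)"
    using pw[OF e1] by blast
  \<comment> \<open>Halving \<open>d1\<close> gives the strict inequality needed for
    \<open>|t| \<le> d\<close>; the bound \<open>pi\<close> keeps
    \<open>|u| \<le> d * sqrt N\<close> inside the range of integration.\<close>
  define d where "d = min (min d0 (d1 / 2)) pi"
  have d: "d > 0" "d \<le> d0" "d < d1" "d \<le> pi" using d0 d1(1) by (auto simp: d_def min_def)
  obtain C1 R1 where C1: "C1 \<ge> 0" "R1 > 1" "\<And>N t. N \<ge> 1 \<Longrightarrow> d \<le> \<bar>t\<bar> \<Longrightarrow> \<bar>t\<bar> \<le> pi \<Longrightarrow> cmod (\<Phi> N t) \<le> C1 / R1 ^ N"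
    using far[OF d(1)] by blast
  define \<rho> where "\<rho> = min R0 R1"
  define D where "D = C0 + C1"
  have \<rho>: "\<rho> > 1" using R0 C1 by (simp add: \<rho>_def)
  have D: "D \<ge> 0" using C0 C1 by (simp add: D_def)
  have D_le: "C / R ^ N \<le> D / \<rho> ^ N" if "0 \<le> C" "C \<le> D" "\<rho> \<le> R" for C R N
    using that \<rho> by (intro frac_le power_mono) auto
  \<comment> \<open>\<open>V\<close> dominates \<open>G\<close> for all \<open>N \<ge> 1\<close>. On
    the tail \<open>|u| > d * sqrt N\<close> the factor \<open>(|u| / (d * sqrt N))^(r+1)\<close> is
    at least 1; inserting it yields \<open>w2\<close> with a gain of
    \<open>sqrt N ^ (r + 1)\<close>, one power more than required.\<close>
  define V where "V u = (\<Sum>k\<le>r. \<Sum>p\<le>r. cmod (a k p) * (\<bar>u\<bar> ^ (2 * k + p) * exp (- (s / 2) * u\<^sup>2)))" for u :: real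
  define w2 where "w2 u = (\<Sum>k\<le>r. \<Sum>p\<le>r. cmod (a k p) / d ^ (r + 1) * (\<bar>u\<bar> ^ (2 * k + p + (r + 1)) * exp (- (s / 2) * u\<^sup>2)))" for u :: real
  have w2: "integrable lborel w2"
    unfolding w2_def using s by (intro Bochner_Integration.integrable_sum integrable_mult_right integrable_abs_power_gauss) simp
  have w2_V: "w2 u = V u * (\<bar>u\<bar> / d) ^ (r + 1)" for u
    unfolding w2_def V_def sum_distrib_right
    by (intro sum.cong refl) (simp only: power_add power_divide times_divide_eq_left times_divide_eq_right divide_divide_eq_left mult_ac)
  have V0: "V u \<ge> 0" for u unfolding V_def by (intro sum_nonneg) simp
  have w20: "w2 u \<ge> 0" for u unfolding w2_V using V0 d(1) by simp
  have G_term: "of_real (exp (- (s / 2) * u\<^sup>2)) * (a k p * of_real (u ^ (2 * k) * (u / sqrt (real N)) ^ p)) * iexp (- (u * y))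
      = a k p / of_real (sqrt (real N) ^ p) * (of_real (u ^ (2 * k + p) * exp (- (s / 2) * u\<^sup>2)) * iexp (- (u * y)))" for u N k p y
    by (simp add: power_add power_divide mult_ac)
  have G_eq: "iexp (- (u * y)) * G N u = (\<Sum>k\<le>r. \<Sum>p\<le>r. a k p / of_real (sqrt (real N) ^ p) *
      (of_real (u ^ (2 * k + p) * exp (- (s / 2) * u\<^sup>2)) * iexp (- (u * y))))" for u N y
    unfolding G_term[symmetric] G_def sum_distrib_left sum_distrib_right
    by (intro sum.cong refl) (simp only: mult_ac)
  have G_int: "integrable lborel (\<lambda>u. iexp (- (u * y)) * G N u)" for N y
    unfolding G_eq using s
    by (intro Bochner_Integration.integrable_sum integrable_mult_right integrable_gauss_iexp) simp
  have G_integral: "(LINT u|lborel. iexp (- (u * y)) * G N u)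
      = (\<Sum>k\<le>r. \<Sum>p\<le>r. a k p / of_real (sqrt (real N) ^ p) * gauss_fourier s (2 * k + p) y)" for N y
  proof -
    have i: "integrable lborel (\<lambda>u. a k p / of_real (sqrt (real N) ^ p) *
      (of_real (u ^ (2 * k + p) * exp (- (s / 2) * u\<^sup>2)) * iexp (- (u * y))))" for k p
      using s by (intro integrable_mult_right integrable_gauss_iexp) simp
    show ?thesis
      unfolding G_eq gauss_fourier_def integral_mult_right_zero[symmetric]
      by (subst Bochner_Integration.integral_sum; intro Bochner_Integration.integrable_sum i sum.cong refl
          Bochner_Integration.integral_sum)
  qed
  have q_int: "integrable lborel (\<lambda>u. indicator (I N) u *\<^sub>R (iexp (- (u * y)) * \<Psi> N u))" for N y
  proof (rule Bochner_Integration.integrable_bound)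
    show "integrable lborel (indicator (I N) :: real \<Rightarrow> real)" by (simp add: I_def)
    have [measurable]: "\<Phi> N \<in> borel_measurable borel" by (rule meas)
    show "(\<lambda>u. indicator (I N) u *\<^sub>R (iexp (- (u * y)) * \<Psi> N u)) \<in> borel_measurable lborel"
      unfolding \<Psi>_def I_def by measurable
    show "AE u in lborel. norm (indicator (I N) u *\<^sub>R (iexp (- (u * y)) * \<Psi> N u)) \<le> norm (indicator (I N) u :: real)"
      by (rule AE_I2) (simp only: norm_scaleR norm_mult norm_iexp \<Psi>_def, simp add: indicator_def le1)
  qed
  define W where "W N u = e1 / sqrt (real N) ^ r * w1 u + D / \<rho> ^ N * indicator (I N) u + 1 / sqrt (real N) ^ (r + 1) * w2 u" for N u
  have W_int: "integrable lborel (W N)" for N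
    unfolding W_def using w1 w2 by (intro Bochner_Integration.integrable_add integrable_mult_right) (auto simp: I_def)
  have W_integral: "(LINT u|lborel. W N u) = e1 / sqrt (real N) ^ r * (LINT u|lborel. w1 u) + D / \<rho> ^ N * (2 * pi * sqrt (real N))
      + 1 / sqrt (real N) ^ (r + 1) * (LINT u|lborel. w2 u)" for N
  proof -
    have "(LINT u|lborel. indicator (I N) u :: real) = 2 * pi * sqrt (real N)" by (simp add: I_def)
    moreover have "integrable lborel (indicator (I N) :: real \<Rightarrow> real)" by (simp add: I_def)
    ultimately show ?thesis unfolding W_def using w1 w2 by simp
  qed
  have bound: "cmod (indicator (I N) u *\<^sub>R \<Psi> N u - G N u) \<le> W N u" if N: "N \<ge> 1" for N u
  proof -
    define t where "t = u / sqrt (real N)"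
    have sN: "sqrt (real N) \<ge> 1" using N by simp
    have w1_0: "w1 u \<ge> 0" by (simp add: w1_def)
    show ?thesis
    proof (cases "\<bar>u\<bar> \<le> d * sqrt (real N)")
      case True
      have t: "\<bar>t\<bar> \<le> d" using True sN by (simp add: t_def abs_div_pos[symmetric] pos_divide_le_eq)
      have tt: "real N * t = u * sqrt (real N)" "real N * t\<^sup>2 = u\<^sup>2"
        using sN N by (simp_all add: t_def field_simps power2_eq_square real_sqrt_mult_self flip: real_sqrt_mult)
      have "\<bar>u\<bar> \<le> pi * sqrt (real N)" using True d(4) sN by (smt (verit) mult_right_mono)
      then have uI: "indicator (I N) u = (1::real)" by (simp add: I_def abs_le_iff)
      \<comment> \<open>The centring phase cancels the drift, and \<open>N t^2 = u^2\<close> leaves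
        a fixed Gaussian times a factor that depends on \<open>N\<close> only through
        \<open>t\<close>.\<close>
      have kN: "iexp (- (u * A * sqrt (real N))) * \<kappa> t ^ N = of_real (exp (- (s / 2) * u\<^sup>2)) * exp (of_real (u\<^sup>2) * g t)"
      proof -
        have "\<kappa> t ^ N = exp (of_nat N * (\<i> * of_real (A * t) - of_real (s * t\<^sup>2 / 2) + of_real (t\<^sup>2) * g t))"
          using kappa[of t] t d(2) by (simp add: exp_of_nat_mult)
        also have "of_nat N * (\<i> * of_real (A * t) - of_real (s * t\<^sup>2 / 2) + of_real (t\<^sup>2) * g t)
            = \<i> * of_real (A * (real N * t)) - of_real (s * (real N * t\<^sup>2) / 2) + of_real (real N * t\<^sup>2) * g t"
          by (simp add: algebra_simps)
        finally show ?thesis unfolding tt by (simp add: exp_of_real[symmetric] exp_add[symmetric] algebra_simps)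
      qed
      have G_t: "G N u = of_real (exp (- (s / 2) * u\<^sup>2)) * (\<Sum>k\<le>r. \<Sum>p\<le>r. a k p * of_real (u ^ (2 * k) * t ^ p))"
        by (simp only: G_def t_def)
      define H where "H = exp (of_real (u\<^sup>2) * g t) * z t - (\<Sum>k\<le>r. \<Sum>p\<le>r. a k p * of_real (u ^ (2 * k) * t ^ p))"
      have "\<Psi> N u - G N u = iexp (- (u * A * sqrt (real N))) * (\<Phi> N t - \<kappa> t ^ N * z t) + (iexp (- (u * A * sqrt (real N))) * \<kappa> t ^ N * z t - G N u)"
        by (simp add: \<Psi>_def t_def algebra_simps)
      also have "iexp (- (u * A * sqrt (real N))) * \<kappa> t ^ N * z t - G N u = of_real (exp (- (s / 2) * u\<^sup>2)) * H"
        unfolding kN H_def G_t by (simp only: mult.assoc right_diff_distrib)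
      finally have "cmod (\<Psi> N u - G N u) \<le> cmod (\<Phi> N t - \<kappa> t ^ N * z t) + exp (- (s / 2) * u\<^sup>2) * cmod H"
        using norm_triangle_ineq[of "iexp (- (u * A * sqrt (real N))) * (\<Phi> N t - \<kappa> t ^ N * z t)" "of_real (exp (- (s / 2) * u\<^sup>2)) * H"]
        unfolding norm_mult norm_iexp norm_of_real mult_1 abs_exp_cancel by (simp only:)
      also have "\<dots> \<le> D / \<rho> ^ N + exp (- (s / 2) * u\<^sup>2) * (e1 * \<bar>t\<bar> ^ r * (1 + u\<^sup>2) ^ (r + 1) * exp (s * u\<^sup>2 / 4))"
      proof (intro add_mono mult_left_mono)
        show "cmod (\<Phi> N t - \<kappa> t ^ N * z t) \<le> D / \<rho> ^ N"
          using near[of t N] t d(2) N D_le[of C0 R0 N] C0 C1(1) by (simp add: D_def \<rho>_def)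
        show "cmod H \<le> e1 * \<bar>t\<bar> ^ r * (1 + u\<^sup>2) ^ (r + 1) * exp (s * u\<^sup>2 / 4)"
          unfolding H_def using d1(2)[of t u] t d(3) by simp
      qed simp
      also have "exp (- (s / 2) * u\<^sup>2) * (e1 * \<bar>t\<bar> ^ r * (1 + u\<^sup>2) ^ (r + 1) * exp (s * u\<^sup>2 / 4)) = e1 / sqrt (real N) ^ r * w1 u"
      proof -
        have "exp (- (s / 2) * u\<^sup>2) * exp (s * u\<^sup>2 / 4) = exp (- (s / 4) * u\<^sup>2)"
          unfolding exp_add[symmetric] by (rule arg_cong[where f=exp]) (simp add: field_simps)
        moreover have "\<bar>t\<bar> ^ r = \<bar>u\<bar> ^ r / sqrt (real N) ^ r" by (simp add: t_def power_divide)
        ultimately show ?thesis by (simp add: w1_def)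
      qed
      finally have "cmod (\<Psi> N u - G N u) \<le> D / \<rho> ^ N + e1 / sqrt (real N) ^ r * w1 u" .
      moreover have "0 \<le> 1 / sqrt (real N) ^ (r + 1) * w2 u" using w20[of u] by simp
      ultimately show ?thesis unfolding W_def uI scaleR_one mult_1_right by linarith
    next
      case False
      then have u: "\<bar>u\<bar> > d * sqrt (real N)" by simp
      then have "\<bar>u\<bar> / sqrt (real N) > d" using sN by (simp add: pos_less_divide_eq)
      then have t: "\<bar>t\<bar> > d" using sN by (simp add: t_def)
      have p1: "cmod (indicator (I N) u *\<^sub>R \<Psi> N u) \<le> D / \<rho> ^ N * indicator (I N) u"
      proof (cases "u \<in> I N")
        case True
        then have "\<bar>u\<bar> \<le> pi * sqrt (real N)" by (auto simp: I_def)
        then have "\<bar>u\<bar> / sqrt (real N) \<le> pi" using sN by (simp add: pos_divide_le_eq)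
        then have "\<bar>t\<bar> \<le> pi" using sN by (simp add: t_def)
        then have "cmod (\<Phi> N t) \<le> C1 / R1 ^ N" using C1(3)[of N t] N t by simp
        also have "\<dots> \<le> D / \<rho> ^ N" using C0 C1(1) by (intro D_le) (auto simp: D_def \<rho>_def)
        finally show ?thesis using True by (simp add: \<Psi>_def t_def norm_mult)
      qed simp
      have "cmod (G N u) \<le> exp (- (s / 2) * u\<^sup>2) * (\<Sum>k\<le>r. \<Sum>p\<le>r. cmod (a k p) * \<bar>u\<bar> ^ (2 * k + p))"
      proof -
        have "cmod (a k p * of_real (u ^ (2 * k) * (u / sqrt (real N)) ^ p)) \<le> cmod (a k p) * \<bar>u\<bar> ^ (2 * k + p)" for k p
        proof -
          have "\<bar>u / sqrt (real N)\<bar> \<le> \<bar>u\<bar>" using sN by (simp add: divide_le_eq mult_le_cancel_left1)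
          then have "\<bar>u / sqrt (real N)\<bar> ^ p \<le> \<bar>u\<bar> ^ p" by (intro power_mono) auto
          then have "\<bar>u\<bar> ^ (2 * k) * \<bar>u / sqrt (real N)\<bar> ^ p \<le> \<bar>u\<bar> ^ (2 * k) * \<bar>u\<bar> ^ p" by (intro mult_left_mono) auto
          then show ?thesis unfolding norm_mult norm_of_real abs_mult power_abs power_add by (rule mult_left_mono) simp
        qed
        then have "cmod (\<Sum>k\<le>r. \<Sum>p\<le>r. a k p * of_real (u ^ (2 * k) * (u / sqrt (real N)) ^ p)) \<le> (\<Sum>k\<le>r. \<Sum>p\<le>r. cmod (a k p) * \<bar>u\<bar> ^ (2 * k + p))"
          by (intro order_trans[OF norm_sum] sum_mono)
        then show ?thesis unfolding G_def norm_mult norm_of_real by (simp add: mult_left_mono)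
      qed
      also have "\<dots> = V u" unfolding V_def sum_distrib_left by (intro sum.cong refl) (simp only: mult_ac)
      also have "\<dots> \<le> V u * (\<bar>u\<bar> / (d * sqrt (real N))) ^ (r + 1)"
      proof -
        have "1 \<le> \<bar>u\<bar> / (d * sqrt (real N))" using u d(1) sN by (subst le_divide_eq_1_pos) auto
        then have "1 \<le> (\<bar>u\<bar> / (d * sqrt (real N))) ^ (r + 1)" by (rule one_le_power)
        then show ?thesis using mult_left_mono[OF _ V0[of u], of 1] by (metis mult_1_right)
      qed
      also have "\<dots> = 1 / sqrt (real N) ^ (r + 1) * w2 u"
        unfolding w2_V by (simp only: power_divide power_mult_distrib) (simp only: times_divide_eq_left times_divide_eq_right divide_divide_eq_left mult_1 mult_ac)
      finally have p2: "cmod (G N u) \<le> 1 / sqrt (real N) ^ (r + 1) * w2 u" .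
      have "0 \<le> e1 / sqrt (real N) ^ r * w1 u" using e1 w1_0 by simp
      then show ?thesis unfolding W_def using p1 p2 norm_triangle_ineq4[of "indicator (I N) u *\<^sub>R \<Psi> N u" "G N u"] by linarith
    qed
  qed
  have main: "cmod ((LINT u|lborel. indicator (I N) u *\<^sub>R (iexp (- (u * y)) * \<Psi> N u)) - (LINT u|lborel. iexp (- (u * y)) * G N u))
      \<le> (LINT u|lborel. W N u)" if N: "N \<ge> 1" for N y
  proof -
    have "(LINT u|lborel. indicator (I N) u *\<^sub>R (iexp (- (u * y)) * \<Psi> N u)) - (LINT u|lborel. iexp (- (u * y)) * G N u)
      = (LINT u|lborel. indicator (I N) u *\<^sub>R (iexp (- (u * y)) * \<Psi> N u) - iexp (- (u * y)) * G N u)"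
      by (rule Bochner_Integration.integral_diff[OF q_int G_int, symmetric])
    also have "cmod \<dots> \<le> (LINT u|lborel. W N u)"
    proof (rule Bochner_Integration.integral_norm_bound_integral)
      show "integrable lborel (\<lambda>u. indicator (I N) u *\<^sub>R (iexp (- (u * y)) * \<Psi> N u) - iexp (- (u * y)) * G N u)"
        by (rule Bochner_Integration.integrable_diff[OF q_int G_int])
      show "norm (indicator (I N) u *\<^sub>R (iexp (- (u * y)) * \<Psi> N u) - iexp (- (u * y)) * G N u) \<le> W N u" for u
      proof -
        have "indicator (I N) u *\<^sub>R (iexp (- (u * y)) * \<Psi> N u) - iexp (- (u * y)) * G N u
          = iexp (- (u * y)) * (indicator (I N) u *\<^sub>R \<Psi> N u - G N u)"
          by (simp only: right_diff_distrib mult_scaleR_right)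
        then have "norm (indicator (I N) u *\<^sub>R (iexp (- (u * y)) * \<Psi> N u) - iexp (- (u * y)) * G N u) = norm (indicator (I N) u *\<^sub>R \<Psi> N u - G N u)"
          by (simp only: norm_mult norm_iexp mult_1)
        then show ?thesis using bound[OF N, of u] by simp
      qed
    qed (rule W_int)
    finally show ?thesis .
  qed
  have lim1: "(\<lambda>N. D / \<rho> ^ N * (2 * pi * sqrt (real N)) * sqrt (real N) ^ r) \<longlonglongrightarrow> 0"
    using \<rho> by real_asymp
  have lim2: "(\<lambda>N. (LINT u|lborel. w2 u) / sqrt (real N)) \<longlonglongrightarrow> 0"
    by (rule tendsto_div_sqrt_0)
  have "\<forall>\<^sub>F N in sequentially. D / \<rho> ^ N * (2 * pi * sqrt (real N)) * sqrt (real N) ^ r < \<epsilon> / 3"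
    by (rule order_tendstoD(2)[OF lim1]) (use \<epsilon> in simp)
  moreover have "\<forall>\<^sub>F N in sequentially. (LINT u|lborel. w2 u) / sqrt (real N) < \<epsilon> / 3"
    by (rule order_tendstoD(2)[OF lim2]) (use \<epsilon> in simp)
  ultimately show ?thesis
    using eventually_ge_at_top[of 1]
  proof eventually_elim
    case (elim N)
    define q where "q = sqrt (real N) ^ r"
    have q: "q > 0" using elim(3) by (simp add: q_def)
    have "(LINT u|lborel. W N u) * q = e1 * (LINT u|lborel. w1 u) + D / \<rho> ^ N * (2 * pi * sqrt (real N)) * q + (LINT u|lborel. w2 u) / sqrt (real N)"
      unfolding W_integral power_add q_def[symmetric] using q by (simp add: distrib_right)
    also have "\<dots> \<le> \<epsilon> / 3 + \<epsilon> / 3 + \<epsilon> / 3"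
    proof (intro add_mono)
      show "e1 * (LINT u|lborel. w1 u) \<le> \<epsilon> / 3" using W1 \<epsilon> by (simp add: e1_def field_simps)
    qed (use elim(1,2) in \<open>simp_all add: q_def less_imp_le\<close>)
    finally have "(LINT u|lborel. W N u) \<le> \<epsilon> / q" using q by (simp add: pos_le_divide_eq)
    then show ?case using main[OF elim(3)] unfolding G_integral I_def \<Psi>_def q_def by (meson order_trans)
  qed
qed

section \<open>Uniform decay away from 0 and assembly\<close>

text \<open>Compactness is used jointly in \<open>t\<close> and in \<open>z\<close> from the closed
  unit disc, so one constant and one radius \<open>R > 1\<close> serve every \<open>t\<close> in
  \<open>K\<close>.\<close>

lemma uniform_exponential_decay:
  fixes L :: "'t::t2_space \<Rightarrow> ('a::complex_banach \<Rightarrow>\<^sub>L 'a)"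
  assumes L: "\<And>t. t \<in> K \<Longrightarrow> bounded_clinear_op (L t)" and K: "compact K" "continuous_on K L"
    and spec: "\<And>t. t \<in> K \<Longrightarrow> op_spectrum (L t) \<subseteq> ball 0 1" and l: "cdual l"
  obtains C R where "C \<ge> 0" "R > 1" "\<And>t n. t \<in> K \<Longrightarrow> cmod (l ((blinfun_apply (L t) ^^ n) v)) \<le> C / R ^ n"
proof -
  define F where "F p = id_blinfun - (cscale_op (snd p) o\<^sub>L L (fst p))" for p :: "'t \<times> complex"
  have "continuous_on (K \<times> cball 0 1) F"
    unfolding F_def
    by (intro continuous_intros bounded_bilinear.continuous_on[OF bounded_bilinear_blinfun_compose]
        continuous_on_compose2[OF continuous_on_cscale_op[of UNIV]] continuous_on_compose2[OF K(2)]) auto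
  moreover have "\<exists>C. bounded_below_surj C (F p)" if p: "p \<in> K \<times> cball 0 1" for p
  proof -
    have t: "fst p \<in> K" and z: "cmod (snd p) \<le> 1" using p by (auto simp: mem_Times_iff)
    have "snd p = 0 \<or> 1 / snd p \<notin> op_spectrum (L (fst p))"
    proof (cases "snd p = 0")
      case False
      then have "cmod (1 / snd p) \<ge> 1" using z by (simp add: norm_divide)
      then show ?thesis using spec[OF t] by (auto simp: subset_iff)
    qed simp
    then show ?thesis unfolding F_def by (rule bounded_below_surj_off_spectrum[OF L[OF t]])
  qed
  ultimately obtain C where C: "C > 0" "\<And>p. p \<in> K \<times> cball 0 1 \<Longrightarrow> bounded_below_surj C (F p)"
    using compact_uniformly_bounded_below_surj[OF compact_Times[OF K(1) compact_cball]] by metis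
  obtain M where M: "M > 0" "\<And>t. t \<in> K \<Longrightarrow> norm (L t) \<le> M"
    using compact_imp_bounded[OF compact_continuous_image[OF K(2,1)]] unfolding bounded_pos by blast
  obtain Bl where Bl: "Bl > 0" "\<And>x. cmod (l x) \<le> Bl * norm x" using cdual_boundE[OF l] by blast
  \<comment> \<open>Solves \<open>2 * C * (R - 1) * M = 1\<close>, the condition for enlarging the
    disc uniformly in \<open>t\<close>.\<close>
  define R where "R = 1 + 1 / (2 * C * M)"
  have R: "R > 1" using C M by (simp add: R_def)
  have "cmod (l ((blinfun_apply (L t) ^^ n) v)) \<le> Bl * (2 * C) * norm v / R ^ n" if t: "t \<in> K" for t n
  proof (rule power_bound_off_spectrum[OF L[OF t] l Bl(2)])
    fix z assume z: "cmod z \<le> R"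
    show "bounded_below_surj (2 * C) (id_blinfun - (cscale_op z o\<^sub>L L t))"
    proof (rule bounded_below_surj_larger_disc[OF _ C(1) _ _ z])
      show "bounded_below_surj C (id_blinfun - (cscale_op z o\<^sub>L L t))" if "cmod z \<le> 1" for z
        using C(2)[of "(t, z)"] t that by (simp add: F_def)
      have "2 * C * (R - 1) * norm (L t) \<le> 2 * C * (R - 1) * M"
        using C(1) R M(2)[OF t] by (intro mult_left_mono) auto
      also have "\<dots> = 1" using C(1) M(1) by (simp add: R_def)
      finally show "2 * C * (R - 1) * norm (L t) \<le> 1" .
    qed (use R in simp)
  qed (use Bl C R in auto)
  then show ?thesis using that[of "Bl * (2 * C) * norm v" R] Bl(1) C(1) R by simp
qed

text \<open>Self-duality of the Gaussian: the characteristic function for variance \<open>s\<close>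
  is the transform already computed, with parameter \<open>1 / s\<close>.\<close>

lemma char_normal:
  assumes "s > 0"
  shows "char (density lborel (normal_density 0 (sqrt s))) u = of_real (exp (- s * u\<^sup>2 / 2))"
proof -
  have "char (density lborel (normal_density 0 (sqrt s))) u = (LINT x|lborel. normal_density 0 (sqrt s) x *\<^sub>R iexp (u * x))"
    unfolding char_def by (subst integral_density) auto
  also have "\<dots> = (LINT x|lborel. of_real (1 / sqrt (2 * pi * s)) * (of_real (x ^ 0 * exp (- (1 / s / 2) * x\<^sup>2)) * iexp (- (x * (- u)))))"
    using assms by (intro Bochner_Integration.integral_cong refl)
      (simp add: normal_density_def scaleR_conv_of_real mult_ac)
  also have "\<dots> = of_real (1 / sqrt (2 * pi * s)) * gauss_fourier (1 / s) 0 (- u)"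
    unfolding gauss_fourier_def by (rule integral_mult_right_zero)
  also have "\<dots> = of_real (1 / sqrt (2 * pi * s) * (2 * pi * gauss_n (1 / s) (- u)))"
    using assms by (simp add: gauss_fourier_0)
  also have "1 / sqrt (2 * pi * s) * (2 * pi * gauss_n (1 / s) (- u)) = exp (- s * u\<^sup>2 / 2)"
  proof -
    have "sqrt (2 * pi * s) * sqrt (2 * pi * (1 / s)) = sqrt ((2 * pi)\<^sup>2)"
      unfolding real_sqrt_mult[symmetric] using assms by (simp add: power2_eq_square)
    then have *: "sqrt (2 * pi * s) * sqrt (2 * pi * (1 / s)) = 2 * pi" by (simp only: real_sqrt_abs) simp
    have "1 / sqrt (2 * pi * s) * (2 * pi * gauss_n (1 / s) (- u))
        = 2 * pi / (sqrt (2 * pi * s) * sqrt (2 * pi * (1 / s))) * exp (- (- u)\<^sup>2 / (2 * (1 / s)))"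
      unfolding gauss_n_def by simp
    then show ?thesis unfolding * by (simp add: mult.commute)
  qed
  finally show ?thesis .
qed

lemma poly_map_poly_Re: "poly (map_poly Re p) y = Re (poly p (of_real y))"
  by (induction p) (simp_all add: map_poly_pCons)

lemma sqrt_power_eq_powr: "N > 0 \<Longrightarrow> sqrt (real N) ^ p = real N powr (real p / 2)"
  by (simp add: powr_half_sqrt[symmetric] powr_power)

text \<open>Substituting \<open>t = u / sqrt N\<close> produces the factor \<open>sqrt N\<close>;
  \<open>k = y * sqrt N + N * A\<close> splits the phase into the one for \<open>y\<close> and the
  centring one.\<close>

lemma lattice_fourier_inversion_scaled:
  assumes "prob_space M" and S: "S \<in> measurable M (count_space UNIV)" and N: "N > 0"
    and y: "y = (of_int k - real N * A) / sqrt (real N)"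
  shows "(LINT u|lborel. indicator {-(pi * sqrt (real N))..pi * sqrt (real N)} u *\<^sub>R
            (iexp (- (u * y)) * (iexp (- (u * A * sqrt (real N))) * (LINT \<omega>|M. cis (u / sqrt (real N) * real_of_int (S \<omega>))))))
    = of_real (2 * pi * (sqrt (real N) * measure M {\<omega>\<in>space M. S \<omega> = k}))"
proof -
  define \<Phi> where "\<Phi> t = (LINT \<omega>|M. cis (t * real_of_int (S \<omega>)))" for t
  define f where "f t = indicator {-pi..pi} t *\<^sub>R (iexp (- (t * of_int k)) * \<Phi> t)" for t
  define c where "c = 1 / sqrt (real N)"
  have sN: "sqrt (real N) > 0" using N by simp
  have "of_real (2 * pi * measure M {\<omega>\<in>space M. S \<omega> = k}) = (LINT t|lborel. f t)"
    using lattice_fourier_inversion[OF assms(1,2), of k] by (simp add: f_def \<Phi>_def)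
  also have "\<dots> = \<bar>c\<bar> *\<^sub>R (LINT u|lborel. f (0 + c * u))"
    by (rule lborel_integral_real_affine) (use sN in \<open>simp add: c_def\<close>)
  also have "(\<lambda>u. f (0 + c * u)) = (\<lambda>u. indicator {-(pi * sqrt (real N))..pi * sqrt (real N)} u *\<^sub>R
            (iexp (- (u * y)) * (iexp (- (u * A * sqrt (real N))) * \<Phi> (u / sqrt (real N)))))"
  proof
    fix u
    have ind: "indicator {-pi..pi} (c * u) = (indicator {-(pi * sqrt (real N))..pi * sqrt (real N)} u :: real)"
      using sN by (auto simp: indicator_def c_def field_simps)
    have "- (c * u * of_int k) = - (u * y) + - (u * A * sqrt (real N))"
    proof -
      have "real N = sqrt (real N) * sqrt (real N)" by simp
      then have "of_int k = y * sqrt (real N) + A * (sqrt (real N) * sqrt (real N))"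
        using sN by (simp add: y)
      then show ?thesis using sN unfolding c_def by (simp add: field_simps)
    qed
    then have "iexp (- (c * u * of_int k)) = iexp (- (u * y)) * iexp (- (u * A * sqrt (real N)))"
      by (simp only: of_real_add distrib_left exp_add)
    then show "f (0 + c * u) = indicator {-(pi * sqrt (real N))..pi * sqrt (real N)} u *\<^sub>R
            (iexp (- (u * y)) * (iexp (- (u * A * sqrt (real N))) * \<Phi> (u / sqrt (real N))))"
      by (simp only: f_def add_0 ind mult.assoc) (simp add: c_def)
  qed
  finally have "of_real (2 * pi * measure M {\<omega>\<in>space M. S \<omega> = k})
    = c *\<^sub>R (LINT u|lborel. indicator {-(pi * sqrt (real N))..pi * sqrt (real N)} u *\<^sub>R
            (iexp (- (u * y)) * (iexp (- (u * A * sqrt (real N))) * \<Phi> (u / sqrt (real N)))))"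
    using sN by (simp add: c_def)
  then have "sqrt (real N) *\<^sub>R of_real (2 * pi * measure M {\<omega>\<in>space M. S \<omega> = k})
    = (LINT u|lborel. indicator {-(pi * sqrt (real N))..pi * sqrt (real N)} u *\<^sub>R
            (iexp (- (u * y)) * (iexp (- (u * A * sqrt (real N))) * \<Phi> (u / sqrt (real N)))))"
    using sN by (simp add: c_def)
  then show ?thesis unfolding \<Phi>_def by (simp add: scaleR_conv_of_real mult_ac)
qed

lemma char_standardized_sum:
  assumes "prob_space M" and S: "S \<in> measurable M (count_space UNIV)" and N: "N > 0"
  shows "char (distr M borel (\<lambda>\<omega>. (real_of_int (S \<omega>) - real N * A) / sqrt (real N))) u
    = exp (- \<i> * of_real (u * A * sqrt (real N))) * (LINT \<omega>|M. cis (u / sqrt (real N) * real_of_int (S \<omega>)))"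
proof -
  have S': "(\<lambda>\<omega>. real_of_int (S \<omega>)) \<in> borel_measurable M" using S by (rule measurable_compose) simp
  have "char (distr M borel (\<lambda>\<omega>. (real_of_int (S \<omega>) - real N * A) / sqrt (real N))) u
    = (LINT \<omega>|M. iexp (u * ((real_of_int (S \<omega>) - real N * A) / sqrt (real N))))"
    unfolding char_def using S' by (subst integral_distr) auto
  also have "\<dots> = (LINT \<omega>|M. exp (- \<i> * of_real (u * A * sqrt (real N))) * cis (u / sqrt (real N) * real_of_int (S \<omega>)))"
  proof (rule Bochner_Integration.integral_cong[OF refl])
    fix \<omega>
    have "real N / sqrt (real N) = sqrt (real N)" by (rule real_div_sqrt) simp
    moreover have "u * ((real_of_int (S \<omega>) - real N * A) / sqrt (real N)) = - (u * A * (real N / sqrt (real N))) + u / sqrt (real N) * real_of_int (S \<omega>)"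
      by (simp add: diff_divide_distrib right_diff_distrib mult_ac)
    ultimately have "u * ((real_of_int (S \<omega>) - real N * A) / sqrt (real N)) = - (u * A * sqrt (real N)) + u / sqrt (real N) * real_of_int (S \<omega>)"
      by (simp only:)
    then have "iexp (u * ((real_of_int (S \<omega>) - real N * A) / sqrt (real N))) = iexp (- (u * A * sqrt (real N))) * iexp (u / sqrt (real N) * real_of_int (S \<omega>))"
      by (simp only: of_real_add distrib_left exp_add)
    then show "iexp (u * ((real_of_int (S \<omega>) - real N * A) / sqrt (real N))) = exp (- \<i> * of_real (u * A * sqrt (real N))) * cis (u / sqrt (real N) * real_of_int (S \<omega>))"
      by (simp only: cis_conv_exp of_real_minus mult_minus_right mult_minus_left)
  qed
  also have "\<dots> = exp (- \<i> * of_real (u * A * sqrt (real N))) * (LINT \<omega>|M. cis (u / sqrt (real N) * real_of_int (S \<omega>)))"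
    by (rule integral_mult_right_zero)
  finally show ?thesis .
qed

theorem theorem2p7:
  fixes M :: "'a measure"
    and X :: "nat \<Rightarrow> 'a \<Rightarrow> int"
    and L :: "real \<Rightarrow> ('b::complex_banach \<Rightarrow>\<^sub>L 'b)"
    and v :: 'b
    and l :: "'b \<Rightarrow> complex"
    and r :: nat and \<delta> :: real and A :: real and sigma2 :: real
  defines "S \<equiv> (\<lambda>N \<omega>. \<Sum>n=1..N. X n \<omega>)"
  assumes prob: "prob_space M"
    and X_meas: "\<And>n. X n \<in> measurable M (count_space UNIV)"
    and L_clin: "\<And>t. bounded_clinear_op (L t)"
    and l_dual: "cdual l"
    and charf: "\<And>t N. N \<ge> 1 \<Longrightarrow>
        (LINT \<omega>|M. cis (t * real_of_int (S N \<omega>))) = l ((blinfun_apply (L t) ^^ N) v)"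
    \<comment> \<open>(A1) with s = r + 2\<close>
    and A1_cont: "continuous_on UNIV L"
    and A1_delta: "\<delta> > 0"
    and A1_smooth: "Ck_on (r + 2) L {-\<delta>..\<delta>}"
    \<comment> \<open>(A2)\<close>
    and A2_eig: "op_eigenvalue (L 0) 1"
    and A2_iso: "isolated_in_spectrum (L 0) 1"
    and A2_simple: "simple_eigenvalue (L 0) 1"
    and A2_other: "\<And>z. op_eigenvalue (L 0) z \<Longrightarrow> z \<noteq> 1 \<Longrightarrow> cmod z < 1"
    and A2_ess: "\<exists>\<rho><1. ess_spectrum (L 0) \<subseteq> cball 0 \<rho>"
    \<comment> \<open>(A3 tilde)\<close>
    and A3_gen: "\<And>t. (\<nexists>m::int. t = 2 * pi * m) \<Longrightarrow> op_spectrum (L t) \<subseteq> ball 0 1"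
    and A3_lat: "\<And>m::int. op_spectrum (L (2 * pi * m)) \<subseteq> ball 0 1 \<union> {1}"
    \<comment> \<open>CLT with positive variance\<close>
    and clt: "weak_conv_m (\<lambda>N. distr M borel (\<lambda>\<omega>. (real_of_int (S N \<omega>) - real N * A) / sqrt (real N)))
                (density lborel (normal_density 0 (sqrt sigma2)))"
    and sigma_pos: "sigma2 > 0"
  shows "\<exists>P :: nat \<Rightarrow> real poly. \<forall>\<epsilon>>0. \<forall>\<^sub>F N in sequentially. \<forall>k::int.
           \<bar>sqrt (real N) * prob_space.prob M {\<omega>\<in>space M. S N \<omega> = k}
             - gauss_n sigma2 ((real_of_int k - real N * A) / sqrt (real N))
               * (\<Sum>p=0..r. poly (P p) ((real_of_int k - real N * A) / sqrt (real N)) / real N powr (real p / 2))\<bar>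
           \<le> \<epsilon> * real N powr (- real r / 2)"
proof -
  interpret prob_space M by (rule prob)
  have S_meas: "S N \<in> measurable M (count_space UNIV)" for N
  proof (induction N)
    case (Suc N)
    have "(\<lambda>\<omega>. S N \<omega> + X (Suc N) \<omega>) \<in> measurable M (count_space UNIV)"
      by (rule measurable_compose_countable[OF measurable_compose[OF X_meas] Suc.IH]) simp
    then show ?case by (simp add: S_def)
  qed (simp add: S_def)
  have S_meas': "(\<lambda>\<omega>. real_of_int (S N \<omega>)) \<in> borel_measurable M" for N
    using S_meas by (rule measurable_compose) simp
  define \<Phi> where "\<Phi> N t = (LINT \<omega>|M. cis (t * real_of_int (S N \<omega>)))" for N t
  have \<Phi>_char: "\<Phi> N = char (distr M borel (\<lambda>\<omega>. real_of_int (S N \<omega>)))" for N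
    unfolding char_def \<Phi>_def fun_eq_iff using S_meas' by (subst integral_distr) (auto simp: cis_conv_exp)
  have rd: "real_distribution (distr M borel (\<lambda>\<omega>. real_of_int (S N \<omega>)))" for N
    by (rule real_distribution_distr[OF S_meas'])
  have \<Phi>_meas: "\<Phi> N \<in> borel_measurable borel" and \<Phi>_le1: "cmod (\<Phi> N t) \<le> 1" for N t
    unfolding \<Phi>_char using real_distribution.char_measurable[OF rd] real_distribution.cmod_char_le_1[OF rd] by auto
  \<comment> \<open>The point 1 lies outside the disk of radius \<open>\<rho> < 1\<close> that
    contains the essential spectrum.\<close>
  have fred: "fredholm (shift_op (L 0) 1)"
  proof -
    obtain \<rho> where "\<rho> < 1" "ess_spectrum (L 0) \<subseteq> cball 0 \<rho>" using A2_ess by blast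
    then have "1 \<notin> ess_spectrum (L 0)" by (auto simp: subset_iff)
    then show ?thesis by (simp add: ess_spectrum_def)
  qed
  have "op_spectrum (L 0) \<subseteq> ball 0 1 \<union> {1}" using A3_lat[of 0] by simp
  from simple_eigenvalue_splitting[OF L_clin A2_simple A2_iso fred this]
  obtain x\<^sub>0 \<phi> where x0: "L 0 x\<^sub>0 = x\<^sub>0" "cdual \<phi>" "\<phi> x\<^sub>0 = 1" "\<And>x. \<phi> (L 0 x) = \<phi> x"
    "\<And>z. cmod z \<le> 1 \<Longrightarrow> \<exists>C. bounded_below_surj C (id_blinfun - (cscale_op z o\<^sub>L (L 0 - rank_one \<phi> x\<^sub>0)))"
    by blast
  interpret perturbed_operator L x\<^sub>0 \<phi> "r + 2"
    by unfold_locales (use L_clin x0 Ck_on_imp_expands[OF A1_smooth A1_delta] in auto)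
  obtain \<kappa> z d R C where exp: "expands (r + 2) \<kappa>" "\<kappa> 0 = 1" "expands (r + 2) z" "d > 0" "R > 1" "C \<ge> 0"
    and approx: "\<And>t N. \<bar>t\<bar> \<le> d \<Longrightarrow> cmod (l ((blinfun_apply (L t) ^^ N) v) - \<kappa> t ^ N * z t) \<le> C / R ^ N"
    using spectral_expansion[OF l_dual] by metis
  have near: "cmod (\<Phi> N t - \<kappa> t ^ N * z t) \<le> C / R ^ N" if "\<bar>t\<bar> \<le> d" "N \<ge> 1" for N t
    using approx[OF that(1), of N] charf[OF that(2), of t] by (simp add: \<Phi>_def)
  have z_exp: "expands r z" using expands_mono[OF exp(3)] by simp
  have clt_char: "(\<lambda>N. exp (- \<i> * of_real (u * A * sqrt (real N))) * \<Phi> N (u / sqrt (real N)))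
      \<longlonglongrightarrow> of_real (exp (- sigma2 * u\<^sup>2 / 2))" for u
  proof -
    have "(\<lambda>N. char (distr M borel (\<lambda>\<omega>. (real_of_int (S N \<omega>) - real N * A) / sqrt (real N))) u)
      \<longlonglongrightarrow> char (density lborel (normal_density 0 (sqrt sigma2))) u"
    proof (rule levy_continuity1[OF _ _ clt])
      show "real_distribution (distr M borel (\<lambda>\<omega>. (real_of_int (S N \<omega>) - real N * A) / sqrt (real N)))" for N
        by (rule real_distribution_distr, intro borel_measurable_divide borel_measurable_diff S_meas' borel_measurable_const)
      have "prob_space (density lborel (normal_density 0 (sqrt sigma2)))"
        using sigma_pos by (intro prob_space_normal_density) simp
      then show "real_distribution (density lborel (normal_density 0 (sqrt sigma2)))"
        by (simp add: real_distribution_def real_distribution_axioms_def)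
    qed
    then have "(\<lambda>N. char (distr M borel (\<lambda>\<omega>. (real_of_int (S N \<omega>) - real N * A) / sqrt (real N))) u)
      \<longlonglongrightarrow> of_real (exp (- sigma2 * u\<^sup>2 / 2))" by (simp only: char_normal[OF sigma_pos])
    then show ?thesis
    proof (rule Lim_transform_eventually)
      show "\<forall>\<^sub>F N in sequentially. char (distr M borel (\<lambda>\<omega>. (real_of_int (S N \<omega>) - real N * A) / sqrt (real N))) u
        = exp (- \<i> * of_real (u * A * sqrt (real N))) * \<Phi> N (u / sqrt (real N))"
        using eventually_gt_at_top[of 0]
        by (rule eventually_mono) (simp only: char_standardized_sum[OF prob S_meas] \<Phi>_def)
    qed
  qed
  obtain g d' where g: "expands r g" "g 0 = 0" "d' > 0"
    "\<And>t. \<bar>t\<bar> \<le> d' \<Longrightarrow> \<kappa> t = exp (\<i> * of_real (A * t) - of_real (sigma2 * t\<^sup>2 / 2) + of_real (t\<^sup>2) * g t)"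
    by (rule clt_imp_log_expansion[OF exp(1,2) z_exp exp(4,5) near clt_char]) (assumption | rule that)+
  obtain a :: "nat \<Rightarrow> nat \<Rightarrow> complex" where a: "\<And>\<epsilon>. \<epsilon> > 0 \<Longrightarrow> \<exists>d>0. \<forall>\<tau> u. \<bar>\<tau>\<bar> < d \<longrightarrow>
      cmod (exp (of_real (u\<^sup>2) * g \<tau>) * z \<tau> - (\<Sum>k\<le>r. \<Sum>p\<le>r. a k p * of_real (u ^ (2 * k) * \<tau> ^ p)))
        \<le> \<epsilon> * \<bar>\<tau>\<bar> ^ r * (1 + u\<^sup>2) ^ (r + 1) * exp (sigma2 * u\<^sup>2 / 4)"
    by (rule pointwise_edgeworth_expansion[OF g(1,2) z_exp sigma_pos]) (assumption | rule that)+
  have far: "\<exists>C R. C \<ge> 0 \<and> R > 1 \<and> (\<forall>N\<ge>1. \<forall>t. e \<le> \<bar>t\<bar> \<and> \<bar>t\<bar> \<le> pi \<longrightarrow> cmod (\<Phi> N t) \<le> C / R ^ N)" if e: "e > 0" for e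
  proof -
    \<comment> \<open>This set meets no multiple of \<open>2 pi\<close>: 0 is cut out and the next
      multiples exceed \<open>pi\<close> in modulus.\<close>
    define K where "K = {-pi..-e} \<union> {e..pi}"
    have K: "compact K" by (simp add: K_def compact_Un)
    have spec: "op_spectrum (L t) \<subseteq> ball 0 1" if t: "t \<in> K" for t
    proof (rule A3_gen)
      have t': "0 < \<bar>t\<bar>" "\<bar>t\<bar> \<le> pi" using t e by (auto simp: K_def)
      show "\<nexists>m::int. t = 2 * pi * m"
      proof
        assume "\<exists>m::int. t = 2 * pi * m"
        then obtain m :: int where m: "t = 2 * pi * m" by blast
        then have "m \<noteq> 0" using t'(1) by auto
        then have "1 \<le> \<bar>real_of_int m\<bar>" by linarith
        then have "2 * pi * 1 \<le> 2 * pi * \<bar>real_of_int m\<bar>" by (intro mult_left_mono) auto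
        then have "2 * pi \<le> \<bar>t\<bar>" by (simp add: m abs_mult)
        then show False using t'(2) pi_gt_zero by linarith
      qed
    qed
    obtain C R where C: "C \<ge> 0" "R > 1" "\<And>t n. t \<in> K \<Longrightarrow> cmod (l ((blinfun_apply (L t) ^^ n) v)) \<le> C / R ^ n"
      by (rule uniform_exponential_decay[OF L_clin K continuous_on_subset[OF A1_cont subset_UNIV] spec l_dual, of v])
        (assumption | rule that)+
    have "cmod (\<Phi> N t) \<le> C / R ^ N" if "N \<ge> 1" "e \<le> \<bar>t\<bar>" "\<bar>t\<bar> \<le> pi" for N t
    proof -
      have "t \<in> K" using that by (auto simp: K_def abs_if split: if_splits)
      then show ?thesis using C(3)[of t N] charf[OF that(1), of t] by (simp add: \<Phi>_def)
    qed
    then show ?thesis using C(1,2) by blast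
  qed
  obtain H where H: "\<And>m y. gauss_fourier sigma2 m y = of_real (2 * pi * gauss_n sigma2 y) * poly (H m) (of_real y)"
    using gauss_fourier_poly[OF sigma_pos] by metis
  \<comment> \<open>Since \<open>u^(2k) * (u / sqrt N)^p\<close> is \<open>u^(2k+p)\<close> divided
    by \<open>sqrt N ^ p\<close>, the terms with fixed \<open>p\<close> and all \<open>k\<close>
    form the coefficient of \<open>N^(-p/2)\<close>.\<close>
  define Q where "Q p = (\<Sum>k\<le>r. smult (a k p) (H (2 * k + p)))" for p
  define P where "P p = map_poly Re (Q p)" for p
  have sum_Q: "(\<Sum>k\<le>r. \<Sum>p\<le>r. a k p / of_real (sqrt (real N) ^ p) * gauss_fourier sigma2 (2 * k + p) y)
      = of_real (2 * pi * gauss_n sigma2 y) * (\<Sum>p\<le>r. poly (Q p) (of_real y) / of_real (sqrt (real N) ^ p))" for N y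
    unfolding Q_def H poly_sum sum_distrib_left sum_divide_distrib
    by (subst sum.swap) (intro sum.cong refl, simp)
  show ?thesis
  proof (rule exI[of _ P], intro allI impI)
    fix \<epsilon> :: real assume \<epsilon>: "\<epsilon> > 0"
    define J where "J N y = (LINT u|lborel. indicator {-(pi * sqrt (real N))..pi * sqrt (real N)} u *\<^sub>R
            (iexp (- (u * y)) * (iexp (- (u * A * sqrt (real N))) * \<Phi> N (u / sqrt (real N)))))" for N y
    have "\<forall>\<^sub>F N in sequentially. \<forall>y. cmod (J N y
        - (\<Sum>k\<le>r. \<Sum>p\<le>r. a k p / of_real (sqrt (real N) ^ p) * gauss_fourier sigma2 (2 * k + p) y)) \<le> \<epsilon> / sqrt (real N) ^ r"
      unfolding J_def
    proof (rule lattice_edgeworth_integral[OF \<Phi>_meas \<Phi>_le1 sigma_pos _ exp(5,6) _ _ far a \<epsilon>])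
      show "min d d' > 0" using exp(4) g(3) by simp
      show "cmod (\<Phi> N t - \<kappa> t ^ N * z t) \<le> C / R ^ N" if "\<bar>t\<bar> \<le> min d d'" "N \<ge> 1" for N t
        using near[of t N] that by simp
      show "\<kappa> t = exp (\<i> * of_real (A * t) - of_real (sigma2 * t\<^sup>2 / 2) + of_real (t\<^sup>2) * g t)" if "\<bar>t\<bar> \<le> min d d'" for t
        using g(4)[of t] that by simp
    qed
    then show "\<forall>\<^sub>F N in sequentially. \<forall>k::int.
           \<bar>sqrt (real N) * prob {\<omega>\<in>space M. S N \<omega> = k}
             - gauss_n sigma2 ((real_of_int k - real N * A) / sqrt (real N))
               * (\<Sum>p=0..r. poly (P p) ((real_of_int k - real N * A) / sqrt (real N)) / real N powr (real p / 2))\<bar>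
           \<le> \<epsilon> * real N powr (- real r / 2)"
      using eventually_gt_at_top[of 0]
    proof eventually_elim
      case (elim N)
      show ?case
      proof
        fix k :: int
        define y where "y = (real_of_int k - real N * A) / sqrt (real N)"
        define p where "p = sqrt (real N) * prob {\<omega>\<in>space M. S N \<omega> = k}"
        define q where "q = gauss_n sigma2 y * (\<Sum>p\<le>r. poly (P p) y / sqrt (real N) ^ p)"
        define E where "E = of_real p - of_real (gauss_n sigma2 y) * (\<Sum>p\<le>r. poly (Q p) (of_real y) / of_real (sqrt (real N) ^ p))"
        have "J N y = of_real (2 * pi * p)"
          unfolding J_def p_def \<Phi>_def by (rule lattice_fourier_inversion_scaled[OF prob S_meas elim(2) y_def])
        then have "J N y - (\<Sum>k\<le>r. \<Sum>p\<le>r. a k p / of_real (sqrt (real N) ^ p) * gauss_fourier sigma2 (2 * k + p) y) = of_real (2 * pi) * E"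
          unfolding sum_Q E_def by (simp only: of_real_mult right_diff_distrib mult.assoc)
        then have "cmod (of_real (2 * pi) * E) \<le> \<epsilon> / sqrt (real N) ^ r" using spec[OF elim(1), of y] by (simp only:)
        then have "2 * pi * cmod E \<le> \<epsilon> / sqrt (real N) ^ r" by (simp add: norm_mult)
        \<comment> \<open>The factor \<open>2 pi\<close> of the inversion formula exceeds 1, so
          discarding it keeps the bound.\<close>
        moreover have "1 * cmod E \<le> 2 * pi * cmod E" using pi_gt3 by (intro mult_right_mono) auto
        moreover have "\<bar>p - q\<bar> \<le> cmod E"
        proof -
          \<comment> \<open>The probability and the density are real and \<open>y\<close> is a real
            argument, so passing to real parts of the coefficients does not increase the
            error.\<close>
          have "Re E = p - q"
            unfolding E_def q_def P_def poly_map_poly_Re minus_complex.sel Re_complex_of_real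
            by (simp only: times_complex.sel Re_complex_of_real Im_complex_of_real mult_zero_left diff_zero Re_sum Re_divide_of_real)
          then show ?thesis using abs_Re_le_cmod[of E] by simp
        qed
        ultimately have "\<bar>p - q\<bar> \<le> \<epsilon> / sqrt (real N) ^ r" by simp
        also have "\<epsilon> / sqrt (real N) ^ r = \<epsilon> * real N powr (- real r / 2)"
          using elim(2) by (simp add: sqrt_power_eq_powr powr_minus_divide)
        finally show "\<bar>sqrt (real N) * prob {\<omega>\<in>space M. S N \<omega> = k}
             - gauss_n sigma2 ((real_of_int k - real N * A) / sqrt (real N))
               * (\<Sum>p=0..r. poly (P p) ((real_of_int k - real N * A) / sqrt (real N)) / real N powr (real p / 2))\<bar>
           \<le> \<epsilon> * real N powr (- real r / 2)"
          using elim(2) by (simp add: p_def q_def y_def sqrt_power_eq_powr atLeast0AtMost)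
      qed
    qed
  qed
qed

end
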